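(* Let $a\in C^1(\mathbb T)$ be real valued with $0<\inf_{\mathbb T} a<\sup_{\mathbb T} a<\infty$. Put $\kappa=\big(\mathbb E[a^{-1}]\big)^{-1}$, $q(x)=\kappa^{-1}-a(x)^{-1}$ and $$c_a=\frac{\kappa}{8}\Big(\mathbb E\big[q^2(x)\big]+2\sum_{s=1}^\infty\mathbb E\big[q(x)q(2^sx)\big]\Big).$$ Suppose $c_a>0$. Then there exists $E_0>0$ such that both the Lyapunov exponent $L(E)$ and the integrated density of states $\mathcal N(E)$ are locally H\"older continuous on $(0,E_0)$. More precisely, for each $E\in(0,E_0)$ there exist $\tau=\tau(E)\in(0,1)$, $\varepsilon_0=\varepsilon_0(E)>0$ and $C=C(E)>0$ such that $$|L(E)-L(E')|+|\mathcal N(E)-\mathcal N(E')|\le C|E-E'|^\tau$$ whenever $E'\in(0,E_0)$ and $|E-E'|<\varepsilon_0$.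
   Context: $\mathbb T=\mathbb R/\mathbb Z$ and $\mathbb E[f]=\int_{\mathbb T}f(x)\,dx$. For $x\in\mathbb T$, $n\in\mathbb Z_{\ge0}$ put $a_n=a_n(x)=a(2^n x \bmod 1)$. The operator $H(x)$ on $\ell^2(\mathbb Z_{\ge0})$ is $$(H(x)u)_n=-a_{n+1}u_{n+1}+(a_n+a_{n+1})u_n-a_nu_{n-1},\quad n\ge0,\qquad u_{-1}=0.$$ Integrated density of states: with $E_1^N(x)\le\dots\le E_N^N(x)$ the eigenvalues of the restriction of $H(x)$ to $[0,N-1]$ with Dirichlet conditions $\psi_{-1}=\psi_N=0$, $\mathcal N(E)=\lim_{N\to\infty}\frac1N\#\{j:E_j^N(x)\le E\}$ for a.e. $x$ (the limit is a.s. constant). Lyapunov exponent: $T_0^E=\mathrm{Id}$ and, for $n\ge1$, $T_n^E(x)=A_{n-1}^E\cdots A_0^E$ with $A_j^E=\frac1{a_j}\begin{pmatrix}a_{j+1}+a_j-E&-a_j^2\\1&0\end{pmatrix}$; $L(E)=\inf_{n>0}\frac1n\mathbb E[\log\|T_n^E(x)\|]=\lim_{n\to\infty}\frac1n\log\|T_n^E(x)\|$ for a.e. $x$. *)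

theory Defs
  imports
    "HOL-Analysis.Analysis"
    "Jordan_Normal_Form.Char_Poly"
begin

text \<open>
  Functions on \<open>\<real>/\<int>\<close> are represented by 1-periodic functions on the reals, and the circle with
  its normalised Haar measure by Lebesgue measure on the fundamental domain \<open>{0..<1}\<close>.
\<close>

definition circle :: "real measure" where
  "circle = restrict_space lborel {0..<1}"

definition C1_circle :: "(real \<Rightarrow> real) \<Rightarrow> bool" where
  "C1_circle f \<longleftrightarrow> (\<forall>x. f (x + 1) = f x) \<and> f C1_differentiable_on UNIV"

definition coef :: "(real \<Rightarrow> real) \<Rightarrow> real \<Rightarrow> nat \<Rightarrow> real" where
  "coef a x n = a (frac (2 ^ n * x))"

text \<open>
  The operator \<open>H(x)\<close>, given by its action on arbitrary real sequences; the boundary condition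
  \<open>u\<^sub>-\<^sub>1 = 0\<close> is built in.
\<close>

definition hamiltonian :: "(real \<Rightarrow> real) \<Rightarrow> real \<Rightarrow> (nat \<Rightarrow> real) \<Rightarrow> nat \<Rightarrow> real" where
  "hamiltonian a x u n =
     - coef a x (n + 1) * u (n + 1)
     + (coef a x n + coef a x (n + 1)) * u n
     - coef a x n * (if n = 0 then 0 else u (n - 1))"

text \<open>
  Restriction to \<open>[0, N - 1]\<close> with Dirichlet conditions: the matrix of \<open>H(x)\<close> on the sequences
  supported in \<open>{..<N}\<close>, whose \<open>j\<close>-th column is the image of the \<open>j\<close>-th unit sequence.
\<close>

definition dirichlet_matrix :: "(real \<Rightarrow> real) \<Rightarrow> real \<Rightarrow> nat \<Rightarrow> real Matrix.mat" where
  "dirichlet_matrix a x N =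
     Matrix.mat N N (\<lambda>(i, j). hamiltonian a x (\<lambda>k. if k = j then 1 else 0) i)"

text \<open>
  The eigenvalues in increasing order, repeated according to multiplicity. The matrix is real
  symmetric, so its characteristic polynomial splits over the reals and the list has length \<open>N\<close>.
\<close>

definition dirichlet_eigenvalues :: "(real \<Rightarrow> real) \<Rightarrow> real \<Rightarrow> nat \<Rightarrow> real list" where
  "dirichlet_eigenvalues a x N =
     sorted_list_of_multiset (proots (char_poly (dirichlet_matrix a x N)))"

definition eigenvalue_count :: "(real \<Rightarrow> real) \<Rightarrow> real \<Rightarrow> nat \<Rightarrow> real \<Rightarrow> nat" where
  "eigenvalue_count a x N E =
     card {j. j < length (dirichlet_eigenvalues a x N) \<and> dirichlet_eigenvalues a x N ! j \<le> E}"

definition integrated_dos :: "(real \<Rightarrow> real) \<Rightarrow> real \<Rightarrow> real" where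
  "integrated_dos a E =
     (THE c. AE x in circle. (\<lambda>N. real (eigenvalue_count a x N E) / real N) \<longlonglongrightarrow> c)"

definition step_matrix :: "(real \<Rightarrow> real) \<Rightarrow> real \<Rightarrow> real \<Rightarrow> nat \<Rightarrow> real^2^2" where
  "step_matrix a E x j =
     (1 / coef a x j) *\<^sub>R
       vector [vector [coef a x (j + 1) + coef a x j - E, - (coef a x j)\<^sup>2],
               vector [1, 0]]"

primrec transfer_matrix :: "(real \<Rightarrow> real) \<Rightarrow> real \<Rightarrow> real \<Rightarrow> nat \<Rightarrow> real^2^2" where
  "transfer_matrix a E x 0 = Finite_Cartesian_Product.mat 1"
| "transfer_matrix a E x (Suc n) = step_matrix a E x n ** transfer_matrix a E x n"

text \<open>The type class norm on \<open>real^2^2\<close> is the Frobenius norm, hence the explicit operator norm.\<close>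

definition lyapunov :: "(real \<Rightarrow> real) \<Rightarrow> real \<Rightarrow> real" where
  "lyapunov a E =
     (INF n\<in>{0<..}. (1 / real n) *
        (\<integral>x. ln (onorm (\<lambda>v. transfer_matrix a E x n *v v)) \<partial>circle))"

definition harmonic_avg :: "(real \<Rightarrow> real) \<Rightarrow> real" where
  "harmonic_avg a = inverse (\<integral>x. inverse (a x) \<partial>circle)"

definition fluct :: "(real \<Rightarrow> real) \<Rightarrow> real \<Rightarrow> real" where
  "fluct a x = inverse (harmonic_avg a) - inverse (a x)"

text \<open>The sum over \<open>s \<ge> 1\<close> is shifted by one to run over all natural numbers.\<close>

definition c_const :: "(real \<Rightarrow> real) \<Rightarrow> real" where
  "c_const a = harmonic_avg a / 8 *
     ((\<integral>x. (fluct a x)\<^sup>2 \<partial>circle)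
      + 2 * (\<Sum>s. \<integral>x. fluct a x * fluct a (2 ^ Suc s * x) \<partial>circle))"

end

theory Submission imports Defs begin

text \<open>
  Read backwards, the orbit of the doubling map is a Markov chain that jumps from \<open>y\<close> to one of its
  two preimages with probability \<open>1/2\<close>; the corresponding averaging operator halves Lipschitz
  constants. In the coordinates \<open>z = p + \<i> u\<close>, with \<open>p\<close> the flux of the solution \<open>u\<close>, the eigenvalue
  equation becomes an area preserving cocycle of shears over this chain. A second-order expansion,
  with correctors that solve Poisson equations, shows that for small \<open>E\<close> a bounded correction of
  \<open>ln \<bar>z\<bar>\<close> drifts upwards from every starting point; the leading coefficient of the drift is
  \<open>c_const a * E\<close>. Since areas are preserved, the drift contracts a small power of the distance of
  lines on average. Hence the expected logarithmic growth and the expected lifted angle after \<open>n\<close>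
  steps change by at most \<open>n * K * \<bar>E - E'\<bar> powr \<alpha>\<close>. The growth rate of the norm is the Lyapunov
  exponent. The lifted angle divided by \<open>\<pi>\<close> counts the eigenvalues up to a bounded error, so its
  growth rate is the integrated density of states.
\<close>

subsection \<open>Averages over the preimages of the doubling map\<close>

text \<open>At energy 0 a step is a single shear, so there is no drift from which to perturb. For
  small \<open>E\<close> the two shears of a step have the incomparable sizes \<open>E\<close> and
  \<open>1 / a\<close>. Stretching the imaginary axis makes them \<open>\<eta>\<close> and
  \<open>\<eta> * (1 + Q)\<close> with \<open>\<eta> ^ 2 = E * \<beta>\<close>, where \<beta> is the
  mean of \<open>1 / a\<close> and \<open>Q\<close> its relative fluctuation. A step is then a
  rotation by about \<eta> plus a fluctuation of the same order. The first-order effect on the norm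
  averages out; the second-order one is \<open>\<eta> ^ 2 * \<sigma> / 8\<close>, that is
  \<open>c_const a * E\<close>, with \<sigma> the variance of \<open>Q\<close> plus twice the sum of
  its correlations. The drift is required at every base point and in every direction, because the
  contraction it yields is iterated along pairs of directions. Two energies are compared by
  switching the energy one step at a time: the rest of the orbit, run at the fixed energy
  \<open>E\<close>, forgets the change of direction. Hence the Hoelder constants depend on
  \<open>E\<close> alone.\<close>

definition circle_periodic :: "(real \<Rightarrow> 'a) \<Rightarrow> bool" where
  "circle_periodic f \<longleftrightarrow> (\<forall>x. f (x + 1) = f x)"

definition circle_lipschitz :: "real \<Rightarrow> (real \<Rightarrow> 'a::real_normed_vector) \<Rightarrow> bool" where
  "circle_lipschitz L f \<longleftrightarrow> circle_periodic f \<and> (\<forall>x y. norm (f x - f y) \<le> L * \<bar>x - y\<bar>)"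

definition branch_avg :: "(real \<Rightarrow> 'a::real_normed_vector) \<Rightarrow> real \<Rightarrow> 'a" where
  "branch_avg f y = (f (y / 2) + f ((y + 1) / 2)) /\<^sub>R 2"

lemma circle_periodicD: "circle_periodic f \<Longrightarrow> f (x + 1) = f x"
  by (simp add: circle_periodic_def)

lemma circle_periodic_add_nat:
  assumes "circle_periodic f" shows "f (x + of_nat k) = f x"
proof (induction k)
  case (Suc k)
  have "x + of_nat (Suc k) = (x + of_nat k) + 1" by simp
  then show ?case using Suc circle_periodicD[OF assms] by metis
qed simp

lemma circle_periodic_add_int:
  assumes "circle_periodic f" shows "f (x + of_int k) = f x"
proof (cases "k \<ge> 0")
  case True
  then show ?thesis using circle_periodic_add_nat[OF assms, of x "nat k"] by simp
next
  case False
  then show ?thesis using circle_periodic_add_nat[OF assms, of "x + of_int k" "nat (-k)"] by simp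
qed

lemma circle_periodic_frac:
  assumes "circle_periodic f" shows "f (frac x) = f x"
  using circle_periodic_add_int[OF assms, of "frac x" "\<lfloor>x\<rfloor>"] by (simp add: frac_def)

lemma circle_periodic_scale:
  assumes "circle_periodic f" shows "circle_periodic (\<lambda>x. f (of_nat k * x))"
  using circle_periodic_add_nat[OF assms, of _ k] by (simp add: circle_periodic_def distrib_left)

lemma circle_periodic_power2:
  assumes "circle_periodic f" shows "circle_periodic (\<lambda>x. f (2 ^ n * x))"
  using circle_periodic_scale[OF assms, of "2 ^ n"] by simp

lemma circle_periodic_branch_avg:
  assumes "circle_periodic f" shows "circle_periodic (branch_avg f)"
proof -
  have "f ((x + 1 + 1) / 2) = f (x / 2)" for x
    using circle_periodicD[OF assms, of "x / 2"] by (simp add: add_divide_distrib add.commute)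
  then show ?thesis by (simp add: circle_periodic_def branch_avg_def add.commute)
qed

lemma circle_lipschitzD: "circle_lipschitz L f \<Longrightarrow> norm (f x - f y) \<le> L * \<bar>x - y\<bar>"
  by (simp add: circle_lipschitz_def)

lemma circle_lipschitz_periodic: "circle_lipschitz L f \<Longrightarrow> circle_periodic f"
  by (simp add: circle_lipschitz_def)

lemma circle_lipschitz_nonneg: "circle_lipschitz L f \<Longrightarrow> 0 \<le> L"
  using circle_lipschitzD[of L f 1 0] norm_ge_zero[of "f 1 - f 0"] by (simp del: norm_ge_zero)

lemma circle_lipschitz_continuous:
  assumes "circle_lipschitz L f" shows "continuous_on S f"
proof -
  have "L-lipschitz_on S f"
    using circle_lipschitzD[OF assms] circle_lipschitz_nonneg[OF assms]
    by (auto intro!: lipschitz_onI simp: dist_norm)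
  then show ?thesis by (rule lipschitz_on_continuous_on)
qed

lemma circle_lipschitz_branch_avg:
  assumes "circle_lipschitz L f" shows "circle_lipschitz (L / 2) (branch_avg f)"
proof -
  have "norm (branch_avg f x - branch_avg f y) \<le> L / 2 * \<bar>x - y\<bar>" for x y
  proof -
    have "branch_avg f x - branch_avg f y =
        ((f (x/2) - f (y/2)) + (f ((x+1)/2) - f ((y+1)/2))) /\<^sub>R 2"
      by (simp add: branch_avg_def algebra_simps)
    then have "norm (branch_avg f x - branch_avg f y)
        = norm ((f (x/2) - f (y/2)) + (f ((x+1)/2) - f ((y+1)/2))) / 2" by simp
    also have "\<dots> \<le> (norm (f (x/2) - f (y/2)) + norm (f ((x+1)/2) - f ((y+1)/2))) / 2"
      by (simp add: norm_triangle_ineq)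
    also have "\<dots> \<le> (L * \<bar>x/2 - y/2\<bar> + L * \<bar>(x+1)/2 - (y+1)/2\<bar>) / 2"
      by (intro divide_right_mono add_mono circle_lipschitzD[OF assms]) auto
    also have "\<dots> = L / 2 * \<bar>x - y\<bar>" by (simp flip: diff_divide_distrib)
    finally show ?thesis .
  qed
  then show ?thesis
    using circle_periodic_branch_avg[OF circle_lipschitz_periodic[OF assms]]
    by (simp add: circle_lipschitz_def)
qed

lemma circle_lipschitz_branch_iter:
  assumes "circle_lipschitz L f" shows "circle_lipschitz (L / 2 ^ n) ((branch_avg ^^ n) f)"
proof (induction n)
  case (Suc n)
  then show ?case using circle_lipschitz_branch_avg[OF Suc] by (simp add: field_simps)
qed (use assms in simp)

lemma continuous_branch_avg:
  assumes "continuous_on UNIV f" shows "continuous_on UNIV (branch_avg f)"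
  unfolding branch_avg_def
  by (intro continuous_intros continuous_on_compose2[OF assms]) auto

lemma continuous_branch_iter:
  assumes "continuous_on UNIV f" shows "continuous_on UNIV ((branch_avg ^^ n) f)"
  by (induction n) (auto intro: assms continuous_branch_avg)

lemma branch_iter_Suc: "(branch_avg ^^ Suc n) f y =
    ((branch_avg ^^ n) f (y / 2) + (branch_avg ^^ n) f ((y + 1) / 2)) /\<^sub>R 2"
  by (simp add: branch_avg_def)

lemma branch_iter_add:
  "(branch_avg ^^ n) (\<lambda>x. f x + g x) y = (branch_avg ^^ n) f y + (branch_avg ^^ n) g y"
proof (induction n arbitrary: y)
  case (Suc n)
  show ?case unfolding branch_iter_Suc Suc by (simp add: scaleR_right_distrib)
qed simp

lemma branch_iter_scaleR:
  "(branch_avg ^^ n) (\<lambda>x. c *\<^sub>R f x) y = c *\<^sub>R (branch_avg ^^ n) f y"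
proof (induction n arbitrary: y)
  case (Suc n)
  show ?case unfolding branch_iter_Suc Suc by (simp add: scaleR_right_distrib mult.commute)
qed simp

lemma branch_iter_diff:
  "(branch_avg ^^ n) (\<lambda>x. f x - g x) y = (branch_avg ^^ n) f y - (branch_avg ^^ n) g y"
proof (induction n arbitrary: y)
  case (Suc n)
  show ?case unfolding branch_iter_Suc Suc by (simp add: scaleR_right_distrib scaleR_right_diff_distrib)
qed simp

lemma branch_iter_const: "(branch_avg ^^ n) (\<lambda>x. c) y = c"
proof (induction n arbitrary: y)
  case (Suc n)
  show ?case unfolding branch_iter_Suc Suc by (metis scaleR_half_double inverse_eq_divide)
qed simp

lemma branch_iter_mono:
  fixes f g :: "real \<Rightarrow> real"
  assumes "\<And>x. f x \<le> g x"
  shows "(branch_avg ^^ n) f y \<le> (branch_avg ^^ n) g y"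
  by (induction n arbitrary: y) (auto simp: branch_avg_def assms intro!: add_mono)

lemma norm_branch_iter:
  "norm ((branch_avg ^^ n) f y) \<le> (branch_avg ^^ n) (\<lambda>x. norm (f x)) y"
proof (induction n arbitrary: y)
  case (Suc n)
  show ?case unfolding branch_iter_Suc
    using norm_triangle_ineq[of "(branch_avg ^^ n) f (y / 2)" "(branch_avg ^^ n) f ((y + 1) / 2)"]
      Suc[of "y/2"] Suc[of "(y+1)/2"] by simp
qed simp

text \<open>The points over which the \<open>n\<close>-th average at \<open>y\<close> is taken are the \<open>n\<close>-fold preimages of \<open>y\<close>.\<close>

lemma branch_iter_pullback:
  assumes "\<And>x. circle_periodic (\<lambda>t. h t x)"
  shows "(branch_avg ^^ n) (\<lambda>x. h (2 ^ n * x) x) y = (branch_avg ^^ n) (h y) y"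
  using assms
proof (induction n arbitrary: h y)
  case (Suc n)
  have per: "circle_periodic (\<lambda>t. h (2 * t) x)" for x
    using circle_periodic_power2[OF Suc.prems, where n = 1] by simp
  have *: "(branch_avg ^^ n) (\<lambda>x. h (2 ^ Suc n * x) x) t = (branch_avg ^^ n) (h (2 * t)) t" for t
    using Suc.IH[of "\<lambda>t. h (2 * t)" t, OF per] by (simp add: ac_simps)
  have y: "2 * ((y + 1) / 2) = y + 1" "2 * (y / 2) = y" by simp_all
  have "h (y + 1) = h y"
    using circle_periodicD[OF Suc.prems, of y] by (intro ext)
  then show ?case unfolding branch_iter_Suc * y by simp
qed simp

lemma branch_iter_mult_pullback:
  fixes f g :: "real \<Rightarrow> real"
  assumes "circle_periodic g"
  shows "(branch_avg ^^ n) (\<lambda>x. f x * g (2 ^ n * x)) y = (branch_avg ^^ n) f y * g y"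
proof -
  have "(branch_avg ^^ n) (\<lambda>x. f x * g (2 ^ n * x)) y = (branch_avg ^^ n) (\<lambda>x. g y *\<^sub>R f x) y"
    using branch_iter_pullback[where h = "\<lambda>t x. f x * g t" and n = n and y = y] assms
    by (simp add: circle_periodic_def mult.commute)
  then show ?thesis unfolding branch_iter_scaleR by simp
qed

section \<open>The mean over the circle, its invariance and exponential mixing\<close>

definition circle_mean :: "(real \<Rightarrow> real) \<Rightarrow> real" where
  "circle_mean f = (\<integral>x. f x \<partial>circle)"

lemma integrable_circle_continuous:
  fixes f :: "real \<Rightarrow> real"
  assumes "continuous_on UNIV f"
  shows "integrable circle f" "circle_mean f = integral {0..1} f"
proof -
  have ab: "set_integrable lborel {0..1} f"
    using borel_integrable_atLeastAtMost'[of 0 1 f] assms continuous_on_subset by blast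
  have [measurable]: "f \<in> borel_measurable borel"
    by (rule borel_measurable_continuous_onI[OF assms])
  have sub: "set_integrable lborel {0..<1} f"
    by (rule set_integrable_subset[OF ab]) auto
  show "integrable circle f"
    using sub unfolding circle_def set_integrable_def
    by (subst integrable_restrict_space) (auto simp: )
  have "circle_mean f = (LINT x:{0..<1}|lborel. f x)"
    unfolding circle_mean_def circle_def set_lebesgue_integral_def
    by (subst integral_restrict_space) auto
  also have "\<dots> = (LINT x:{0..1}|lborel. f x)"
    unfolding set_lebesgue_integral_def
  proof (rule Bochner_Integration.integral_cong_AE)
    have "AE x in lborel. x \<noteq> (1::real)" by (rule AE_lborel_singleton)
    then show "AE x in lborel. indicat_real {0..<1} x *\<^sub>R f x = indicat_real {0..1} x *\<^sub>R f x"
      by eventually_elim (auto simp: indicator_def)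
  qed simp_all
  also have "\<dots> = integral {0..1} f"
    by (rule set_borel_integral_eq_integral(2)[OF ab])
  finally show "circle_mean f = integral {0..1} f" .
qed

lemma circle_mean_const [simp]: "circle_mean (\<lambda>x. c) = c"
  by (simp add: integrable_circle_continuous(2))

lemma circle_mean_add:
  assumes "continuous_on UNIV f" "continuous_on UNIV g"
  shows "circle_mean (\<lambda>x. f x + g x) = circle_mean f + circle_mean g"
  unfolding circle_mean_def
  by (intro Bochner_Integration.integral_add integrable_circle_continuous assms)

lemma circle_mean_diff:
  assumes "continuous_on UNIV f" "continuous_on UNIV g"
  shows "circle_mean (\<lambda>x. f x - g x) = circle_mean f - circle_mean g"
  unfolding circle_mean_def
  by (intro Bochner_Integration.integral_diff integrable_circle_continuous assms)

lemma circle_mean_cmult: "circle_mean (\<lambda>x. c * f x) = c * circle_mean f"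
  unfolding circle_mean_def by simp

lemma circle_mean_sum:
  assumes "\<And>i. i \<in> I \<Longrightarrow> continuous_on UNIV (f i)"
  shows "circle_mean (\<lambda>x. \<Sum>i\<in>I. f i x) = (\<Sum>i\<in>I. circle_mean (f i))"
  unfolding circle_mean_def
  by (intro Bochner_Integration.integral_sum integrable_circle_continuous assms)

lemma circle_mean_mono:
  assumes "continuous_on UNIV f" "continuous_on UNIV g" "\<And>x. f x \<le> g x"
  shows "circle_mean f \<le> circle_mean g"
  unfolding circle_mean_def
  by (intro integral_mono integrable_circle_continuous assms)

lemma abs_circle_mean_le:
  assumes "continuous_on UNIV f" "\<And>x. \<bar>f x\<bar> \<le> B"
  shows "\<bar>circle_mean f\<bar> \<le> B"
proof -
  have "circle_mean f \<le> circle_mean (\<lambda>x. B)" "circle_mean (\<lambda>x. -B) \<le> circle_mean f"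
    using assms(2) by (intro circle_mean_mono assms(1) continuous_on_const; simp add: abs_le_iff minus_le_iff)+
  then show ?thesis by simp
qed

text \<open>The two inverse branches map the fundamental interval onto its two halves, each with
  derivative \<open>1 / 2\<close>. This is the invariance of Lebesgue measure under doubling, in
  dual form.\<close>

lemma circle_mean_branch_avg:
  assumes "continuous_on UNIV f"
  shows "circle_mean (branch_avg f) = circle_mean f"
proof -
  have cont: "continuous_on S f" for S using assms continuous_on_subset by blast
  have I: "f integrable_on {a..b}" for a b :: real
    using cont by (rule integrable_continuous_interval)
  have 1: "((\<lambda>x. f (x / 2)) has_integral 2 * integral {0..1/2} f) {0..1}"
    using has_integral_affinity[of f "integral {0..1/2} f" 0 "1/2" "1/2" 0]
      integrable_integral[OF I[of 0 "1/2"]] image_affinity_cbox[of 2 0 0 "1/2::real"]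
    by (simp add: mult.commute)
  have 2: "((\<lambda>x. f ((x + 1) / 2)) has_integral 2 * integral {1/2..1} f) {0..1}"
  proof -
    have "((\<lambda>x. f ((1/2) *\<^sub>R x + 1/2)) has_integral (1 / \<bar>1/2\<bar> ^ DIM(real)) *\<^sub>R integral {1/2..1} f)
        ((\<lambda>x. (1 / (1/2)) *\<^sub>R x + - ((1 / (1/2)) *\<^sub>R (1/2))) ` cbox (1/2) 1)"
      using integrable_integral[OF I[of "1/2" 1]] by (intro has_integral_affinity) auto
    moreover have "(\<lambda>x::real. (1 / (1/2)) *\<^sub>R x + - ((1 / (1/2)) *\<^sub>R (1/2))) ` cbox (1/2) 1 = {0..1}"
      by (subst image_affinity_cbox) auto
    ultimately show ?thesis by (simp add: add_divide_distrib mult.commute)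
  qed
  have 3: "integral {0..1/2} f + integral {1/2..1} f = integral {0..1} f"
    by (rule Henstock_Kurzweil_Integration.integral_combine) (auto intro: I)
  have "(branch_avg f has_integral (2 * integral {0..1/2} f + 2 * integral {1/2..1} f) /\<^sub>R 2) {0..1}"
    unfolding branch_avg_def by (intro has_integral_cmul has_integral_add 1 2)
  then have "integral {0..1} (branch_avg f) = integral {0..1} f"
    using 3 by (intro integral_unique) (simp add: algebra_simps)
  then show ?thesis
    by (simp add: integrable_circle_continuous(2) assms continuous_branch_avg)
qed

lemma circle_mean_branch_iter:
  assumes "continuous_on UNIV f"
  shows "circle_mean ((branch_avg ^^ n) f) = circle_mean f"
  by (induction n) (auto simp: circle_mean_branch_avg continuous_branch_iter assms)

text \<open>Duality: averaging over the branches is the adjoint of composition with the doubling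
  map. A correlation with a future observable becomes an integral against a smoothed
  \<open>f\<close>.\<close>

lemma circle_mean_mult_pullback:
  assumes "continuous_on UNIV f" "continuous_on UNIV g" "circle_periodic g"
  shows "circle_mean (\<lambda>x. f x * g (2 ^ n * x)) = circle_mean (\<lambda>x. (branch_avg ^^ n) f x * g x)"
proof -
  have "continuous_on UNIV (\<lambda>x. f x * g (2 ^ n * x))"
    by (intro continuous_intros assms continuous_on_compose2[OF assms(2)]) auto
  from circle_mean_branch_iter[OF this, of n] show ?thesis
    unfolding branch_iter_mult_pullback[OF assms(3)] by simp
qed

lemma circle_mean_pullback:
  assumes "continuous_on UNIV g" "circle_periodic g"
  shows "circle_mean (\<lambda>x. g (2 ^ n * x)) = circle_mean g"
  using circle_mean_mult_pullback[of "\<lambda>x. 1" g n] assms by (simp add: branch_iter_const)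

lemma circle_lipschitz_dist_mean:
  assumes "circle_lipschitz L f"
  shows "\<bar>f x - circle_mean f\<bar> \<le> L"
proof -
  have per: "circle_periodic f" and c: "continuous_on S f" for S
    using assms circle_lipschitz_periodic circle_lipschitz_continuous by auto
  have "\<bar>f x - f y\<bar> \<le> L" for y
  proof -
    have "\<bar>f (frac x) - f (frac y)\<bar> \<le> L * \<bar>frac x - frac y\<bar>"
      using circle_lipschitzD[OF assms, of "frac x" "frac y"] by simp
    also have "\<dots> \<le> L * 1"
      using circle_lipschitz_nonneg[OF assms] frac_ge_0[of x] frac_ge_0[of y]
        frac_lt_1[of x] frac_lt_1[of y]
      by (intro mult_left_mono) linarith+
    finally show ?thesis using per by (simp add: circle_periodic_frac)
  qed
  then have "\<bar>circle_mean (\<lambda>y. f x - f y)\<bar> \<le> L"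
    by (intro abs_circle_mean_le continuous_intros c)
  then show ?thesis by (simp add: circle_mean_diff c)
qed

text \<open>Mixing at rate \<open>1 / 2\<close>: each average halves the Lipschitz constant and
  keeps the mean, and a function on the circle deviates from its mean by at most its Lipschitz
  constant.\<close>

lemma branch_iter_lipschitz_dist_mean:
  assumes "circle_lipschitz L f"
  shows "\<bar>(branch_avg ^^ n) f y - circle_mean f\<bar> \<le> L / 2 ^ n"
  using circle_lipschitz_dist_mean[OF circle_lipschitz_branch_iter[OF assms], of n y]
  by (simp add: circle_mean_branch_iter[OF circle_lipschitz_continuous[OF assms]])

lemma circle_lipschitz_bounded:
  assumes "circle_lipschitz L f" shows "\<bar>f x\<bar> \<le> \<bar>circle_mean f\<bar> + L"
  using circle_lipschitz_dist_mean[OF assms, of x] by linarith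

lemma circle_lipschitz_add:
  assumes "circle_lipschitz L f" "circle_lipschitz M g"
  shows "circle_lipschitz (L + M) (\<lambda>x. f x + g x)"
proof -
  have "norm (f x + g x - (f y + g y)) \<le> (L + M) * \<bar>x - y\<bar>" for x y
    using norm_triangle_ineq[of "f x - f y" "g x - g y"] circle_lipschitzD[OF assms(1), of x y]
      circle_lipschitzD[OF assms(2), of x y] by (simp add: algebra_simps)
  then show ?thesis using assms by (simp add: circle_lipschitz_def circle_periodic_def)
qed

lemma circle_lipschitz_cmult:
  fixes f :: "real \<Rightarrow> real"
  assumes "circle_lipschitz L f"
  shows "circle_lipschitz (\<bar>c\<bar> * L) (\<lambda>x. c * f x)"
proof -
  have "norm (c * f x - c * f y) \<le> \<bar>c\<bar> * L * \<bar>x - y\<bar>" for x y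
  proof -
    have "norm (c * f x - c * f y) = \<bar>c\<bar> * norm (f x - f y)"
      by (metis abs_mult right_diff_distrib real_norm_def)
    then show ?thesis
      using mult_left_mono[OF circle_lipschitzD[OF assms, of x y], of "\<bar>c\<bar>"]
      by (simp add: mult.assoc)
  qed
  then show ?thesis using assms by (simp add: circle_lipschitz_def circle_periodic_def)
qed

lemma circle_lipschitz_const: "circle_lipschitz 0 (\<lambda>x. c)"
  by (simp add: circle_lipschitz_def circle_periodic_def)

lemma circle_lipschitz_mult:
  fixes f g :: "real \<Rightarrow> real"
  assumes "circle_lipschitz L f" "circle_lipschitz M g"
  shows "\<exists>K. circle_lipschitz K (\<lambda>x. f x * g x)"
proof -
  define A B where "A = \<bar>circle_mean f\<bar> + L" and "B = \<bar>circle_mean g\<bar> + M"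
  have "norm (f x * g x - f y * g y) \<le> (A * M + B * L) * \<bar>x - y\<bar>" for x y
  proof -
    have "f x * g x - f y * g y = f x * (g x - g y) + g y * (f x - f y)" by (simp add: algebra_simps)
    then have "\<bar>f x * g x - f y * g y\<bar> \<le> \<bar>f x\<bar> * \<bar>g x - g y\<bar> + \<bar>g y\<bar> * \<bar>f x - f y\<bar>"
      by (metis abs_mult abs_triangle_ineq)
    also have "\<dots> \<le> A * (M * \<bar>x - y\<bar>) + B * (L * \<bar>x - y\<bar>)"
      using circle_lipschitzD[OF assms(1), of x y] circle_lipschitzD[OF assms(2), of x y]
        circle_lipschitz_bounded[OF assms(1), of x] circle_lipschitz_bounded[OF assms(2), of y]
        circle_lipschitz_nonneg[OF assms(1)] circle_lipschitz_nonneg[OF assms(2)]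
      by (intro add_mono mult_mono) (auto simp: A_def B_def)
    finally show ?thesis by (simp add: algebra_simps)
  qed
  then show ?thesis using assms by (auto simp: circle_lipschitz_def circle_periodic_def)
qed

subsection \<open>The Poisson equation\<close>

lemma branch_avg_diff_const:
  fixes f :: "real \<Rightarrow> real"
  shows "branch_avg (\<lambda>y. f y - c) y = branch_avg f y - c"
  using branch_iter_diff[of 1 f "\<lambda>_. c" y] branch_iter_const[of 1 c y] by simp

lemma poisson_equation:
  fixes f :: "real \<Rightarrow> real"
  assumes "circle_lipschitz L f"
  obtains g where "circle_lipschitz (2 * L) g" "circle_mean g = 0"
    "\<And>y. g y - branch_avg g y = f y - circle_mean f"
proof -
  define t where "t k y = (branch_avg ^^ k) f y - circle_mean f" for k y
  have geo: "(\<lambda>k. L / 2 ^ k) sums (2 * L)"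
    using sums_mult[OF geometric_sums[of "1/2::real"], of L] by (simp add: power_one_over mult.commute)
  have sum: "summable (\<lambda>k. t k y)" for y
  proof (rule summable_comparison_test'[OF sums_summable[OF geo]])
    show "norm (t k y) \<le> L / 2 ^ k" if "k \<ge> 0" for k
      unfolding t_def real_norm_def by (rule branch_iter_lipschitz_dist_mean[OF assms])
  qed
  define g where "g y = (\<Sum>k. t k y)" for y
  have per: "circle_periodic g"
    using circle_lipschitz_periodic[OF circle_lipschitz_branch_iter[OF assms]]
    by (simp add: circle_periodic_def g_def t_def)
  have lip: "norm (g x - g y) \<le> 2 * L * \<bar>x - y\<bar>" for x y
  proof -
    have le: "norm (t k x - t k y) \<le> L / 2 ^ k * \<bar>x - y\<bar>" for k
      using circle_lipschitzD[OF circle_lipschitz_branch_iter[OF assms], of k x y] by (simp add: t_def)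
    have s: "(\<lambda>k. L / 2 ^ k * \<bar>x - y\<bar>) sums (2 * L * \<bar>x - y\<bar>)"
      by (rule sums_mult2[OF geo])
    have "norm (\<Sum>k. t k x - t k y) \<le> (\<Sum>k. L / 2 ^ k * \<bar>x - y\<bar>)"
      by (rule norm_suminf_le[OF le sums_summable[OF s]])
    then show ?thesis
      unfolding g_def suminf_diff[OF sum sum, symmetric] sums_unique[OF s, symmetric] .
  qed
  have gl: "circle_lipschitz (2 * L) g" using per lip by (simp add: circle_lipschitz_def)
  have eq: "g y - branch_avg g y = f y - circle_mean f" for y
  proof -
    have "(\<lambda>k. (t k (y/2) + t k ((y+1)/2)) /\<^sub>R 2) sums branch_avg g y"
      unfolding branch_avg_def g_def by (intro sums_scaleR_right sums_add summable_sums sum)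
    then have "branch_avg g y = (\<Sum>k. (t k (y/2) + t k ((y+1)/2)) /\<^sub>R 2)"
      by (rule sums_unique)
    also have "\<dots> = (\<Sum>k. t (Suc k) y)"
      by (intro suminf_cong) (simp add: t_def branch_avg_def field_simps)
    also have "\<dots> = g y - t 0 y"
      unfolding g_def by (rule suminf_split_head[OF sum])
    finally show ?thesis by (simp add: t_def)
  qed
  \<comment> \<open>A constant may be added to any solution; it is chosen here so that the mean
    vanishes.\<close>
  define h where "h y = g y - circle_mean g" for y
  show thesis
  proof
    show "circle_lipschitz (2 * L) h"
      using gl by (simp add: circle_lipschitz_def circle_periodic_def h_def)
    show "circle_mean h = 0"
      unfolding h_def by (simp add: circle_mean_diff circle_lipschitz_continuous[OF gl])
    show "h y - branch_avg h y = f y - circle_mean f" for y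
      unfolding h_def branch_avg_diff_const using eq[of y] by simp
  qed
qed

text \<open>By duality the correlation at lag \<open>Suc s\<close> is the mean of \<open>Q\<close>
  times the iterate of \<open>Q\<close> of that order. The equation for \<open>G\<close> turns it
  into a difference of consecutive terms, so the series telescopes to its initial term; the tail
  vanishes because \<open>G\<close> has mean zero.\<close>

lemma poisson_correlations:
  fixes Q G :: "real \<Rightarrow> real"
  assumes Q: "circle_lipschitz L Q" and G: "circle_lipschitz M G" "circle_mean G = 0"
    and eq: "\<And>y. G y - branch_avg G y = branch_avg Q y"
  shows "(\<lambda>s. circle_mean (\<lambda>x. Q x * Q (2 ^ Suc s * x))) sums circle_mean (\<lambda>x. Q x * G x)"
proof -
  have cQ: "continuous_on UNIV Q" and pQ: "circle_periodic Q" and cG: "continuous_on UNIV G"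
    by (rule circle_lipschitz_continuous[OF Q] circle_lipschitz_periodic[OF Q]
        circle_lipschitz_continuous[OF G(1)])+
  let ?r = "\<lambda>k x. (branch_avg ^^ k) G x * Q x"
  have dec: "?r n x - ?r (Suc n) x = (branch_avg ^^ Suc n) Q x * Q x" for n x
  proof -
    have "(branch_avg ^^ n) (\<lambda>y. G y - branch_avg G y) x = (branch_avg ^^ n) (branch_avg Q) x"
      using eq by simp
    then show ?thesis
      unfolding branch_iter_diff by (simp only: funpow_Suc_right o_def flip: left_diff_distrib)
  qed
  have c: "continuous_on UNIV (?r n)" for n
    by (intro continuous_intros continuous_branch_iter cG cQ)
  have step: "circle_mean (\<lambda>x. Q x * Q (2 ^ Suc n * x)) = circle_mean (?r n) - circle_mean (?r (Suc n))" for n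
    using circle_mean_mult_pullback[OF cQ cQ pQ, of "Suc n"] circle_mean_diff[OF c[of n] c[of "Suc n"]]
    by (simp only: dec)
  have "(\<lambda>n. circle_mean (?r n)) \<longlonglongrightarrow> 0"
  proof (rule Lim_null_comparison)
    define B where "B = \<bar>circle_mean Q\<bar> + L"
    have B: "\<bar>Q x\<bar> \<le> B" for x using circle_lipschitz_bounded[OF Q] by (simp add: B_def)
    have "\<bar>?r n x\<bar> \<le> M / 2 ^ n * B" for n x
      unfolding abs_mult using branch_iter_lipschitz_dist_mean[OF G(1), of n x] B[of x] G(2)
        circle_lipschitz_nonneg[OF G(1)]
      by (intro mult_mono) auto
    then have "\<bar>circle_mean (?r n)\<bar> \<le> M / 2 ^ n * B" for n
      by (intro abs_circle_mean_le c)
    then show "\<forall>\<^sub>F n in sequentially. norm (circle_mean (?r n)) \<le> M / 2 ^ n * B" by simp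
    have "(\<lambda>n. M * B * (1/2::real) ^ n) \<longlonglongrightarrow> M * B * 0"
      by (intro tendsto_intros LIMSEQ_power_zero) auto
    then show "(\<lambda>n. M / 2 ^ n * B) \<longlonglongrightarrow> 0" by (simp add: power_one_over field_simps)
  qed
  from telescope_sums'[OF this] have "(\<lambda>n. circle_mean (?r n) - circle_mean (?r (Suc n))) sums circle_mean (?r 0)"
    by simp
  then show ?thesis unfolding step by (simp add: mult.commute)
qed

section \<open>The coefficient: Lipschitz bounds and the constant \<open>c_const\<close>\<close>

lemma C1_circle_lipschitz:
  assumes "C1_circle a"
  obtains L where "circle_lipschitz L a"
proof -
  have per: "circle_periodic a" and C1: "a C1_differentiable_on UNIV"
    using assms by (auto simp: C1_circle_def circle_periodic_def)
  then obtain D where D: "\<And>x. (a has_vector_derivative D x) (at x)" and cD: "continuous_on UNIV D"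
    by (auto simp: C1_differentiable_on_def)
  \<comment> \<open>Two periods, so that a point of the first period can be joined to one of the
    second without wrapping around.\<close>
  have "compact (D ` {0..2})"
    using cD continuous_on_subset by (intro compact_continuous_image) auto
  then obtain B where B: "\<And>x. x \<in> {0..2} \<Longrightarrow> norm (D x) \<le> B"
    using compact_imp_bounded by (force simp: bounded_iff)
  have near: "norm (a y - a x) \<le> B * \<bar>y - x\<bar>" if "x \<in> {0..2}" "y \<in> {0..2}" for x y
  proof -
    have "norm (a y - a x) \<le> B * norm (y - x)"
    proof (rule differentiable_bound[of "{0..2}" a "\<lambda>x h. h *\<^sub>R D x"])
      show "(a has_derivative (\<lambda>h. h *\<^sub>R D x)) (at x within {0..2})" for x
        using D[of x] unfolding has_vector_derivative_def by (rule has_derivative_at_withinI)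
      show "onorm (\<lambda>h. h *\<^sub>R D x) \<le> B" if "x \<in> {0..2}" for x
        using B[OF that] by (intro onorm_le) (simp add: abs_mult mult.commute[of B] mult_left_mono)
    qed (use that in auto)
    then show ?thesis by simp
  qed
  have B0: "0 \<le> B" using B[of 0] norm_ge_zero[of "D 0"] by (simp del: norm_ge_zero)
  have "norm (a x - a y) \<le> B * \<bar>x - y\<bar>" for x y
  proof -
    have *: "norm (a y - a x) \<le> B * \<bar>y - x\<bar>" if "x \<le> y" for x y
    proof -
      define k where "k = \<lfloor>x\<rfloor>"
      define x' y' where "x' = x - of_int k" and "y' = y - of_int k"
      have x': "0 \<le> x'" "x' < 1" unfolding x'_def k_def by linarith+
      have a: "a x = a x'" "a y = a y'"
        using circle_periodic_add_int[OF per, of x' k] circle_periodic_add_int[OF per, of y' k]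
        by (auto simp: x'_def y'_def)
      have d: "y' - x' = y - x" "x' \<le> y'" using that by (auto simp: x'_def y'_def)
      show ?thesis
      proof (cases "y' \<le> 2")
        case True
        then show ?thesis using near[of x' y'] x' d a by auto
      next
        case False
        \<comment> \<open>Here the points are more than one apart, so replacing \<open>y'\<close> by
          its fractional part only shortens the distance.\<close>
        have f: "0 \<le> frac y'" "frac y' < 1" by (simp_all add: frac_lt_1)
        have "norm (a (frac y') - a x') \<le> B * \<bar>frac y' - x'\<bar>"
          using x' f by (intro near) auto
        also have "\<dots> \<le> B * \<bar>y' - x'\<bar>"
          using False x' f B0 by (intro mult_left_mono) linarith+
        finally show ?thesis using a d circle_periodic_frac[OF per, of y'] by simp
      qed
    qed
    show ?thesis
      using *[of x y] *[of y x] by (cases "x \<le> y") (auto simp: abs_minus_commute)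
  qed
  then have "circle_lipschitz B a" using per by (simp add: circle_lipschitz_def)
  then show thesis by (rule that)
qed

lemma circle_lipschitz_inverse:
  fixes a :: "real \<Rightarrow> real"
  assumes "circle_lipschitz L a" "0 < m" "\<And>x. m \<le> a x"
  shows "circle_lipschitz (L / m\<^sup>2) (\<lambda>x. inverse (a x))"
proof -
  have "norm (inverse (a x) - inverse (a y)) \<le> L / m\<^sup>2 * \<bar>x - y\<bar>" for x y
  proof -
    have pos: "0 < a x" "0 < a y" using assms(2,3) by (meson less_le_trans)+
    have "\<bar>inverse (a x) - inverse (a y)\<bar> = \<bar>a x - a y\<bar> / (a x * a y)"
      using pos by (simp add: field_simps abs_mult abs_divide abs_minus_commute)
    also have "\<dots> \<le> (L * \<bar>x - y\<bar>) / (m * m)"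
      using circle_lipschitzD[OF assms(1), of x y] assms(2) assms(3)[of x] assms(3)[of y]
      by (intro frac_le mult_mono) auto
    finally show ?thesis by (simp add: power2_eq_square)
  qed
  then show ?thesis using assms(1) by (simp add: circle_lipschitz_def circle_periodic_def)
qed

text \<open>With \<open>Q\<close> the relative fluctuation of \<open>1 / a\<close>,
  \<open>fluct a\<close> is \<open>- \<beta> * Q\<close> and \<open>harmonic_avg a\<close> is
  \<open>inverse \<beta>\<close>, so one factor \<beta> survives. The correlation series is summed
  by \<open>poisson_correlations\<close>; \<open>G\<close> solves the equation for
  \<open>branch_avg Q\<close> instead of \<open>Q\<close> because the series starts at lag
  one.\<close>

lemma c_const_eq:
  fixes a :: "real \<Rightarrow> real"
  defines "\<beta> \<equiv> circle_mean (\<lambda>x. inverse (a x))"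
  defines "Q \<equiv> \<lambda>x. inverse (a x) / \<beta> - 1"
  assumes \<beta>: "\<beta> \<noteq> 0" and Q: "circle_lipschitz L Q" and G: "circle_lipschitz M G" "circle_mean G = 0"
    and eq: "\<And>y. G y - branch_avg G y = branch_avg Q y"
  shows "c_const a = \<beta> / 8 * (circle_mean (\<lambda>x. (Q x)\<^sup>2) + 2 * circle_mean (\<lambda>x. Q x * G x))"
proof -
  have h: "harmonic_avg a = inverse \<beta>"
    unfolding harmonic_avg_def \<beta>_def circle_mean_def by (rule refl)
  have f: "fluct a x = - \<beta> * Q x" for x
    unfolding fluct_def h Q_def inverse_inverse_eq using \<beta> by (simp add: right_diff_distrib)
  have "(\<Sum>s. \<integral>x. fluct a x * fluct a (2 ^ Suc s * x) \<partial>circle) =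
      (\<Sum>s. \<beta>\<^sup>2 * circle_mean (\<lambda>x. Q x * Q (2 ^ Suc s * x)))"
  proof (intro suminf_cong)
    fix s
    have "fluct a x * fluct a (2 ^ Suc s * x) = \<beta>\<^sup>2 * (Q x * Q (2 ^ Suc s * x))" for x
      unfolding f by (simp add: power2_eq_square)
    then have "(\<integral>x. fluct a x * fluct a (2 ^ Suc s * x) \<partial>circle) =
        circle_mean (\<lambda>x. \<beta>\<^sup>2 * (Q x * Q (2 ^ Suc s * x)))"
      unfolding circle_mean_def by metis
    then show "(\<integral>x. fluct a x * fluct a (2 ^ Suc s * x) \<partial>circle) =
        \<beta>\<^sup>2 * circle_mean (\<lambda>x. Q x * Q (2 ^ Suc s * x))"
      unfolding circle_mean_cmult .
  qed
  also have "\<dots> = \<beta>\<^sup>2 * circle_mean (\<lambda>x. Q x * G x)"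
    using sums_mult[OF poisson_correlations[OF Q G eq], of "\<beta>\<^sup>2"] by (rule sums_unique[symmetric])
  finally have 2: "(\<Sum>s. \<integral>x. fluct a x * fluct a (2 ^ Suc s * x) \<partial>circle) = \<beta>\<^sup>2 * circle_mean (\<lambda>x. Q x * G x)" .
  have 1: "(\<integral>x. (fluct a x)\<^sup>2 \<partial>circle) = \<beta>\<^sup>2 * circle_mean (\<lambda>x. (Q x)\<^sup>2)"
  proof -
    have "(fluct a x)\<^sup>2 = \<beta>\<^sup>2 * (Q x)\<^sup>2" for x unfolding f by (simp add: power2_eq_square)
    then have "(\<integral>x. (fluct a x)\<^sup>2 \<partial>circle) = circle_mean (\<lambda>x. \<beta>\<^sup>2 * (Q x)\<^sup>2)"
      unfolding circle_mean_def by metis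
    then show ?thesis unfolding circle_mean_cmult .
  qed
  have "inverse \<beta> / 8 * (\<beta>\<^sup>2 * s + 2 * (\<beta>\<^sup>2 * t)) = \<beta> / 8 * (s + 2 * t)" for s t
    using \<beta> by (simp add: field_simps power2_eq_square)
  then show ?thesis unfolding c_const_def 1 2 h by blast
qed

subsection \<open>Shears and the distance of lines\<close>

definition shear :: "real \<Rightarrow> complex \<Rightarrow> complex" where
  "shear t z = z + \<i> * complex_of_real (t * Re z)"

text \<open>The real part of \<open>Ln\<close> of the quotient is the growth of the norm, its imaginary part the lifted increment of the argument.\<close>

definition shear_log :: "real \<Rightarrow> complex \<Rightarrow> complex" where
  "shear_log t z = Ln (shear t z / z)"

text \<open>
  For \<open>z = p + \<i> u\<close>, where \<open>u\<close> solves \<open>H u = E u\<close> and \<open>p\<close> is the flux \<open>a\<^sub>n (u\<^sub>n\<^sub>-\<^sub>1 - u\<^sub>n)\<close>, the map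
  \<open>hstep E (1 / a\<^sub>n)\<close> moves the solution one site to the left: first \<open>p\<close> decreases by \<open>E u\<close>, then \<open>u\<close>
  increases by \<open>p / a\<^sub>n\<close>. Conjugating with \<open>\<i>\<close> makes both shears instances of \<^const>\<open>shear\<close>.
\<close>

definition hstep :: "real \<Rightarrow> real \<Rightarrow> complex \<Rightarrow> complex" where
  "hstep e c z = shear c (- \<i> * shear e (\<i> * z))"

definition hstep_log :: "real \<Rightarrow> real \<Rightarrow> complex \<Rightarrow> complex" where
  "hstep_log e c z = shear_log e (\<i> * z) + shear_log c (- \<i> * shear e (\<i> * z))"

text \<open>The distance of the lines spanned by \<open>z\<close> and \<open>w\<close>: twice the sine of their angle.\<close>

definition line_dist :: "complex \<Rightarrow> complex \<Rightarrow> real" where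
  "line_dist z w = cmod (cnj z / z - cnj w / w)"

lemma Re_shear [simp]: "Re (shear t z) = Re z"
  and Im_shear [simp]: "Im (shear t z) = Im z + t * Re z"
  by (simp_all add: shear_def)

lemma hstep_components:
  "Re (hstep e c z) = Re z - e * Im z"
  "Im (hstep e c z) = Im z + c * (Re z - e * Im z)"
  by (simp_all add: hstep_def algebra_simps)

lemma shear_minus_shear [simp]: "shear (- t) (shear t z) = z"
  by (simp add: complex_eq_iff)

lemma shear_zero [simp]: "shear t 0 = 0"
  by (simp add: complex_eq_iff)

lemma shear_eq_0_iff [simp]: "shear t z = 0 \<longleftrightarrow> z = 0"
  by (metis shear_minus_shear shear_zero)

lemma hstep_eq_0_iff [simp]: "hstep e c z = 0 \<longleftrightarrow> z = 0"
  by (simp add: hstep_def)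

lemma norm_shear_le: "cmod (shear t z) \<le> (1 + \<bar>t\<bar>) * cmod z"
proof -
  have "cmod (shear t z) \<le> cmod z + \<bar>t\<bar> * \<bar>Re z\<bar>"
    unfolding shear_def using norm_triangle_ineq[of z "\<i> * complex_of_real (t * Re z)"]
    by (simp add: norm_mult abs_mult)
  also have "\<dots> \<le> cmod z + \<bar>t\<bar> * cmod z"
    by (intro add_left_mono mult_left_mono abs_Re_le_cmod) auto
  finally show ?thesis by (simp add: algebra_simps)
qed

lemma norm_shear_ge: "cmod z \<le> (1 + \<bar>t\<bar>) * cmod (shear t z)"
  using norm_shear_le[of "- t" "shear t z"] by simp

lemma area_shear: "Im (cnj (shear t z) * shear t w) = Im (cnj z * w)"
  by (simp add: algebra_simps)

lemma area_hstep: "Im (cnj (hstep e c z) * hstep e c w) = Im (cnj z * w)"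
proof -
  have "Im (cnj (- \<i> * z) * (- \<i> * w)) = Im (cnj z * w)" "Im (cnj (\<i> * z) * (\<i> * w)) = Im (cnj z * w)" for z w
    by (simp_all add: algebra_simps)
  then show ?thesis unfolding hstep_def area_shear by (simp only: area_shear)
qed

text \<open>For nonzero \<open>z\<close>, \<open>cnj z / z\<close> lies on the unit circle at minus
  twice the argument of \<open>z\<close>, so lines become points of the circle and their distance a
  chord. The form with the area over the norms shows how an area preserving map acts on it: only the
  norms change.\<close>

lemma line_dist_eq:
  assumes "z \<noteq> 0" "w \<noteq> 0"
  shows "line_dist z w = 2 * \<bar>Im (cnj z * w)\<bar> / (cmod z * cmod w)"
proof -
  define A where "A = Im (cnj z * w)"
  have "cnj z / z - cnj w / w = (cnj z * w - cnj (cnj z * w)) / (z * w)"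
    using assms by (simp add: field_simps)
  also have "cnj z * w - cnj (cnj z * w) = complex_of_real (2 * A) * \<i>"
    unfolding A_def by (rule complex_diff_cnj)
  finally have eq: "cnj z / z - cnj w / w = complex_of_real (2 * A) * \<i> / (z * w)" .
  show ?thesis
    unfolding line_dist_def eq A_def[symmetric] norm_divide norm_mult norm_of_real norm_ii by (simp add: abs_mult)
qed

lemma line_dist_nonneg [simp]: "0 \<le> line_dist z w"
  by (simp add: line_dist_def)

lemma line_dist_triangle: "line_dist z w \<le> line_dist z v + line_dist v w"
  using norm_triangle_ineq[of "cnj z / z - cnj v / v" "cnj v / v - cnj w / w"]
  by (simp add: line_dist_def)

lemma line_dist_i: "line_dist (\<i> * z) (\<i> * w) = line_dist z w"
proof -
  have "cnj (\<i> * z) / (\<i> * z) - cnj (\<i> * w) / (\<i> * w) = - (cnj z / z - cnj w / w)" by simp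
  then show ?thesis unfolding line_dist_def by (metis norm_minus_cancel)
qed

lemma line_dist_minus_i: "line_dist (- \<i> * z) (- \<i> * w) = line_dist z w"
proof -
  have "cnj (- \<i> * z) / (- \<i> * z) - cnj (- \<i> * w) / (- \<i> * w) = - (cnj z / z - cnj w / w)" by simp
  then show ?thesis unfolding line_dist_def by (metis norm_minus_cancel)
qed

section \<open>Logarithms of shears\<close>

lemma shear_quotient:
  assumes "z \<noteq> 0"
  shows "shear t z / z = 1 + \<i> * complex_of_real (t / 2) * (1 + cnj z / z)"
proof -
  have "complex_of_real (t * Re z) = complex_of_real (t / 2) * (z + cnj z)"
    by (simp add: complex_eq_iff)
  then show ?thesis using assms unfolding shear_def by (simp add: divide_simps)
qed

lemma norm_cnj_quotient: "z \<noteq> 0 \<Longrightarrow> cmod (cnj z / z) = 1"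
  by (simp add: norm_divide)

text \<open>For \<open>0 \<le> t\<close> this disc touches the real axis at \<open>1\<close> from
  above, and its boundary carries all quotients \<open>shear t z / z\<close>. It is convex and
  avoids the branch cut of \<open>Ln\<close>.\<close>

definition shear_disc :: "real \<Rightarrow> complex set" where
  "shear_disc t = cball (Complex 1 (t / 2)) (t / 2)"

lemma shear_disc_D:
  assumes "w \<in> shear_disc t" "0 \<le> t"
  shows "0 \<le> Im w" "w \<notin> \<real>\<^sub>\<le>\<^sub>0" "1 \<le> (1 + t) * cmod w" "w \<noteq> 0"
proof -
  have "cmod (Complex 1 (t/2) - w) \<le> t / 2"
    using assms by (simp add: shear_disc_def dist_norm)
  then have "(cmod (Complex 1 (t/2) - w))\<^sup>2 \<le> (t / 2)\<^sup>2"
    by (intro power_mono) auto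
  then have le: "(1 - Re w)\<^sup>2 + (Im w)\<^sup>2 \<le> t * Im w"
    by (simp add: cmod_power2 power2_diff power_divide)
  then have "0 \<le> t * Im w" by (smt (verit) zero_le_power2)
  then show 0: "0 \<le> Im w"
  proof (cases "t = 0")
    case True
    then show ?thesis using le by (simp add: sum_power2_le_zero_iff)
  next
    case False
    then show ?thesis using \<open>0 \<le> t * Im w\<close> assms(2) by (simp add: zero_le_mult_iff)
  qed
  have 1: "Re w = 1" if "Im w = 0" using le that by simp
  then show nr: "w \<notin> \<real>\<^sub>\<le>\<^sub>0" by (auto simp: complex_nonpos_Reals_iff)
  then show "w \<noteq> 0" by auto
  \<comment> \<open>The distance of the disc from the origin is \<open>q - s\<close>, where
    \<open>(q + s) * (q - s) = 1\<close> and \<open>q + s \<le> 1 + t\<close>.\<close>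
  define s q where "s = t / 2" and "q = cmod (Complex 1 s)"
  have s: "0 \<le> s" using assms(2) by (simp add: s_def)
  have q2: "q\<^sup>2 = 1 + s\<^sup>2" by (simp add: q_def cmod_power2)
  have q: "q \<le> 1 + s"
    using s by (intro power2_le_imp_le[of q]) (auto simp: q2 power2_sum)
  have "0 \<le> q" by (simp add: q_def)
  then have "s \<le> q" by (intro power2_le_imp_le[of s]) (auto simp: q2)
  have "q - s \<le> cmod w"
    using norm_triangle_ineq2[of "Complex 1 s" w] \<open>cmod (Complex 1 (t/2) - w) \<le> t / 2\<close>
    by (simp add: q_def s_def)
  then have "(q + s) * (q - s) \<le> (1 + t) * cmod w"
    using s q \<open>s \<le> q\<close> by (intro mult_mono) (auto simp: s_def)
  moreover have "(q + s) * (q - s) = 1" using q2 by (simp add: power2_eq_square algebra_simps)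
  ultimately show "1 \<le> (1 + t) * cmod w" by simp
qed

lemma Ln_lipschitz_shear_disc:
  assumes "u \<in> shear_disc t" "w \<in> shear_disc t" "0 \<le> t"
  shows "cmod (Ln u - Ln w) \<le> (1 + t) * cmod (u - w)"
proof (rule field_differentiable_bound[where S = "shear_disc t" and f' = inverse])
  fix z assume z: "z \<in> shear_disc t"
  note D = shear_disc_D[OF z assms(3)]
  show "(Ln has_field_derivative inverse z) (at z within shear_disc t)"
    using has_field_derivative_Ln[OF D(2)] by (rule has_field_derivative_at_within)
  show "cmod (inverse z) \<le> 1 + t"
    using D(3,4) by (simp add: norm_inverse) (simp add: divide_simps)
qed (use assms in \<open>auto simp: shear_disc_def\<close>)

lemma shear_disc_mono:
  assumes "0 \<le> t" "t \<le> B"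
  shows "shear_disc t \<subseteq> shear_disc B"
proof -
  have "dist (Complex 1 (t / 2)) (Complex 1 (B / 2)) = \<bar>t / 2 - B / 2\<bar>"
    by (simp add: dist_norm cmod_def)
  also have "\<dots> = B / 2 - t / 2" using assms by simp
  finally show ?thesis
    unfolding shear_disc_def by (subst cball_subset_cball_iff) simp
qed

lemma shear_quotient_disc:
  assumes "z \<noteq> 0" "0 \<le> t"
  shows "shear t z / z \<in> shear_disc t"
proof -
  have "Complex 1 (t / 2) = 1 + \<i> * complex_of_real (t / 2)" by (simp add: complex_eq_iff)
  then have "Complex 1 (t / 2) - shear t z / z = - (\<i> * complex_of_real (t / 2) * (cnj z / z))"
    using shear_quotient[OF assms(1), of t] by (simp add: algebra_simps)
  then have "cmod (Complex 1 (t / 2) - shear t z / z) = t / 2 * cmod (cnj z / z)"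
    using assms(2) by (simp add: norm_mult norm_divide)
  then show ?thesis
    using norm_cnj_quotient[OF assms(1)] by (simp add: shear_disc_def dist_norm)
qed

lemma exp_shear_log: "z \<noteq> 0 \<Longrightarrow> exp (shear_log t z) = shear t z / z"
  by (simp add: shear_log_def)

lemma exp_hstep_log:
  assumes "z \<noteq> 0" shows "z * exp (hstep_log e c z) = hstep e c z"
  using assms by (simp add: hstep_log_def exp_add exp_shear_log hstep_def)

text \<open>A shear with nonnegative parameter turns a vector counterclockwise, by less than a half
  turn. The principal logarithm therefore gives the true angle, and sums of such angles form a lift
  without any choice of branch.\<close>

lemma Im_shear_log:
  assumes "z \<noteq> 0" "0 \<le> t" shows "0 \<le> Im (shear_log t z)" "Im (shear_log t z) < pi"
proof -
  note D = shear_disc_D[OF shear_quotient_disc[OF assms] assms(2)]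
  show "0 \<le> Im (shear_log t z)" unfolding shear_log_def
    using Im_Ln_pos_le[OF D(4)] D(1) by simp
  show "Im (shear_log t z) < pi" unfolding shear_log_def
    using Im_Ln_pos_le[OF D(4)] Im_Ln_eq_pi[OF D(4)] D(2) Im_Ln_le_pi[OF D(4)]
    by (auto simp: complex_nonpos_Reals_iff less_le)
qed

lemma Im_hstep_log:
  assumes "z \<noteq> 0" "0 \<le> e" "0 \<le> c"
  shows "0 \<le> Im (hstep_log e c z)" "Im (hstep_log e c z) < 2 * pi"
  using Im_shear_log[of "\<i> * z" e] Im_shear_log[of "- \<i> * shear e (\<i> * z)" c] assms
  by (simp_all add: hstep_log_def)

lemma shear_log_lipschitz:
  assumes "z \<noteq> 0" "w \<noteq> 0" "0 \<le> t" "t \<le> B" "0 \<le> t'" "t' \<le> B"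
  shows "cmod (shear_log t z - shear_log t' w) \<le> (1 + B) * (\<bar>t - t'\<bar> + B * line_dist z w)"
proof -
  let ?r = "shear t z / z" and ?r' = "shear t' w / w"
  have "cmod (shear_log t z - shear_log t' w) \<le> (1 + B) * cmod (?r - ?r')"
    unfolding shear_log_def
    using subsetD[OF shear_disc_mono[OF assms(3,4)] shear_quotient_disc[OF assms(1,3)]]
      subsetD[OF shear_disc_mono[OF assms(5,6)] shear_quotient_disc[OF assms(2,5)]] assms
    by (intro Ln_lipschitz_shear_disc) auto
  also have "?r - ?r' = \<i> * (complex_of_real ((t - t') / 2) * (1 + cnj z / z)
      + complex_of_real (t' / 2) * (cnj z / z - cnj w / w))"
  proof -
    have "complex_of_real ((t - t') / 2) = complex_of_real (t / 2) - complex_of_real (t' / 2)"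
      by (simp add: diff_divide_distrib)
    moreover have "(1 + \<i> * a * (1 + u)) - (1 + \<i> * b * (1 + v)) = \<i> * ((a - b) * (1 + u) + b * (u - v))"
      for a b u v by (simp add: algebra_simps)
    ultimately show ?thesis
      unfolding shear_quotient[OF assms(1)] shear_quotient[OF assms(2)] by metis
  qed
  also have "cmod \<dots> \<le> \<bar>t - t'\<bar> / 2 * cmod (1 + cnj z / z) + t' / 2 * line_dist z w"
    using norm_triangle_ineq[of "complex_of_real ((t - t') / 2) * (1 + cnj z / z)"
        "complex_of_real (t' / 2) * (cnj z / z - cnj w / w)"] assms(5)
    unfolding norm_mult line_dist_def norm_of_real by simp
  also have "\<dots> \<le> \<bar>t - t'\<bar> / 2 * 2 + B * line_dist z w"
    using norm_triangle_ineq[of 1 "cnj z / z"] norm_cnj_quotient[OF assms(1)] assms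
    by (intro add_mono mult_mono) auto
  also have "\<bar>t - t'\<bar> / 2 * 2 = \<bar>t - t'\<bar>" by simp
  finally show ?thesis using assms by (simp only: mult_left_mono)
qed

section \<open>Dependence of lines and logarithms on the parameters of a step\<close>

lemma line_dist_shear_shear:
  assumes "z \<noteq> 0" "w \<noteq> 0" "0 \<le> t" "t \<le> B"
  shows "line_dist (shear t z) (shear t w) \<le> (1 + B)\<^sup>2 * line_dist z w"
proof -
  have pos: "0 < cmod z * cmod w" using assms by simp
  have "cmod z * cmod w \<le> ((1 + t) * cmod (shear t z)) * ((1 + t) * cmod (shear t w))"
    using norm_shear_ge[of z t] norm_shear_ge[of w t] assms(3) by (intro mult_mono) auto
  also have "\<dots> = (1 + t)\<^sup>2 * (cmod (shear t z) * cmod (shear t w))" by (simp add: power2_eq_square)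
  also have "\<dots> \<le> (1 + B)\<^sup>2 * (cmod (shear t z) * cmod (shear t w))"
    using assms by (intro mult_right_mono power_mono) auto
  finally have le: "cmod z * cmod w \<le> (1 + B)\<^sup>2 * (cmod (shear t z) * cmod (shear t w))" .
  have pos': "0 < cmod (shear t z) * cmod (shear t w)" using assms by simp
  have "1 / (cmod (shear t z) * cmod (shear t w)) \<le> (1 + B)\<^sup>2 / (cmod z * cmod w)"
    using le pos pos' by (simp add: divide_simps mult.commute)
  then have "2 * \<bar>Im (cnj z * w)\<bar> * (1 / (cmod (shear t z) * cmod (shear t w)))
      \<le> 2 * \<bar>Im (cnj z * w)\<bar> * ((1 + B)\<^sup>2 / (cmod z * cmod w))"
    by (intro mult_left_mono) auto
  then show ?thesis
    using assms by (simp only: line_dist_eq shear_eq_0_iff area_shear not_False_eq_True) (simp add: mult_ac)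
qed

lemma line_dist_shear_parameter:
  assumes "w \<noteq> 0" "0 \<le> t" "t \<le> B" "0 \<le> t'" "t' \<le> B"
  shows "line_dist (shear t w) (shear t' w) \<le> 2 * (1 + B)\<^sup>2 * \<bar>t - t'\<bar>"
proof -
  have area: "\<bar>Im (cnj (shear t w) * shear t' w)\<bar> = \<bar>t - t'\<bar> * (Re w)\<^sup>2"
  proof -
    have "Im (cnj (shear t w) * shear t' w) = (t' - t) * (Re w)\<^sup>2"
      by (simp add: algebra_simps power2_eq_square)
    then show ?thesis by (simp add: abs_mult abs_minus_commute)
  qed
  have "(cmod w)\<^sup>2 \<le> ((1 + B) * cmod (shear t w)) * ((1 + B) * cmod (shear t' w))"
    unfolding power2_eq_square
    using norm_shear_ge[of w t] norm_shear_ge[of w t'] assms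
    by (intro mult_mono) (auto intro: order_trans[OF _ mult_right_mono])
  moreover have "(Re w)\<^sup>2 \<le> (cmod w)\<^sup>2" by (simp add: cmod_power2)
  ultimately have "(Re w)\<^sup>2 \<le> (1 + B)\<^sup>2 * (cmod (shear t w) * cmod (shear t' w))"
    by (simp add: power2_eq_square mult_ac)
  then have "\<bar>t - t'\<bar> * (Re w)\<^sup>2 \<le> \<bar>t - t'\<bar> * ((1 + B)\<^sup>2 * (cmod (shear t w) * cmod (shear t' w)))"
    by (intro mult_left_mono) auto
  moreover have "0 < cmod (shear t w) * cmod (shear t' w)" using assms by simp
  moreover have "line_dist (shear t w) (shear t' w) =
      2 * (\<bar>t - t'\<bar> * (Re w)\<^sup>2) / (cmod (shear t w) * cmod (shear t' w))"
    using assms(1) by (subst line_dist_eq) (simp_all only: area shear_eq_0_iff not_False_eq_True)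
  ultimately show ?thesis by (simp add: pos_divide_le_eq) (simp only: mult_ac)
qed

lemma line_dist_shear:
  assumes "z \<noteq> 0" "w \<noteq> 0" "0 \<le> t" "t \<le> B" "0 \<le> t'" "t' \<le> B"
  shows "line_dist (shear t z) (shear t' w) \<le> (1 + B)\<^sup>2 * (line_dist z w + 2 * \<bar>t - t'\<bar>)"
  using line_dist_triangle[of "shear t z" "shear t' w" "shear t w"]
    line_dist_shear_shear[OF assms(1-4)] line_dist_shear_parameter[OF assms(2-6)]
  by (simp add: algebra_simps)

lemma line_dist_hstep:
  assumes "z \<noteq> 0" "w \<noteq> 0" "0 \<le> e" "e \<le> B" "0 \<le> e'" "e' \<le> B" "0 \<le> c" "c \<le> B" "0 \<le> c'" "c' \<le> B"
  shows "line_dist (hstep e c z) (hstep e' c' w) \<le>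
    2 * (1 + B) ^ 4 * (line_dist z w + \<bar>e - e'\<bar> + \<bar>c - c'\<bar>)"
proof -
  let ?z = "- \<i> * shear e (\<i> * z)" and ?w = "- \<i> * shear e' (\<i> * w)"
  have B: "1 \<le> (1 + B)\<^sup>2" using assms by simp
  have 1: "line_dist ?z ?w \<le> (1 + B)\<^sup>2 * (line_dist z w + 2 * \<bar>e - e'\<bar>)"
    unfolding line_dist_minus_i using line_dist_shear[of "\<i> * z" "\<i> * w" e B e'] assms
    by (simp add: line_dist_i)
  have "line_dist (hstep e c z) (hstep e' c' w) \<le> (1 + B)\<^sup>2 * (line_dist ?z ?w + 2 * \<bar>c - c'\<bar>)"
    unfolding hstep_def using assms by (intro line_dist_shear) auto
  also have "\<dots> \<le> (1 + B)\<^sup>2 * ((1 + B)\<^sup>2 * (line_dist z w + 2 * \<bar>e - e'\<bar>) + (1 + B)\<^sup>2 * (2 * \<bar>c - c'\<bar>))"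
    using 1 mult_right_mono[OF B, of "2 * \<bar>c - c'\<bar>"] by (intro mult_left_mono add_mono) auto
  also have "\<dots> = (1 + B) ^ 4 * (line_dist z w + 2 * \<bar>e - e'\<bar> + 2 * \<bar>c - c'\<bar>)"
    by (simp add: algebra_simps power2_eq_square numeral_eq_Suc)
  also have "\<dots> \<le> (1 + B) ^ 4 * (2 * (line_dist z w + \<bar>e - e'\<bar> + \<bar>c - c'\<bar>))"
    using assms by (intro mult_left_mono) auto
  finally show ?thesis by (simp only: mult_ac)
qed

lemma hstep_log_lipschitz:
  assumes "z \<noteq> 0" "w \<noteq> 0" "0 \<le> e" "e \<le> B" "0 \<le> e'" "e' \<le> B" "0 \<le> c" "c \<le> B" "0 \<le> c'" "c' \<le> B"
  shows "cmod (hstep_log e c z - hstep_log e' c' w) \<le>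
    3 * (1 + B) ^ 4 * (line_dist z w + \<bar>e - e'\<bar> + \<bar>c - c'\<bar>)"
proof -
  let ?z = "- \<i> * shear e (\<i> * z)" and ?w = "- \<i> * shear e' (\<i> * w)"
  define d x y where "d = line_dist z w" and "x = \<bar>e - e'\<bar>" and "y = \<bar>c - c'\<bar>"
  have nn: "0 \<le> d" "0 \<le> x" "0 \<le> y" "0 \<le> B" using assms by (auto simp: d_def x_def y_def)
  have 1: "line_dist ?z ?w \<le> (1 + B)\<^sup>2 * (d + 2 * x)"
    unfolding line_dist_minus_i using line_dist_shear[of "\<i> * z" "\<i> * w" e B e'] assms
    by (simp add: line_dist_i d_def x_def)
  have 2: "cmod (shear_log e (\<i> * z) - shear_log e' (\<i> * w)) \<le> (1 + B) * (x + B * d)"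
    using shear_log_lipschitz[of "\<i> * z" "\<i> * w" e B e'] assms by (simp add: line_dist_i d_def x_def)
  have "cmod (shear_log c ?z - shear_log c' ?w) \<le> (1 + B) * (y + B * line_dist ?z ?w)"
    unfolding y_def using assms by (intro shear_log_lipschitz) auto
  also have "\<dots> \<le> (1 + B) * (y + B * ((1 + B)\<^sup>2 * (d + 2 * x)))"
    using 1 nn by (intro mult_left_mono add_left_mono) auto
  finally have 3: "cmod (shear_log c ?z - shear_log c' ?w) \<le> (1 + B) * (y + B * ((1 + B)\<^sup>2 * (d + 2 * x)))" .
  have "cmod (hstep_log e c z - hstep_log e' c' w) \<le>
      (1 + B) * (x + B * d) + (1 + B) * (y + B * ((1 + B)\<^sup>2 * (d + 2 * x)))"
    using norm_triangle_ineq[of "shear_log e (\<i> * z) - shear_log e' (\<i> * w)" "shear_log c ?z - shear_log c' ?w"] 2 3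
    by (simp add: hstep_log_def algebra_simps)
  also have "\<dots> \<le> (1 + B) ^ 4 * (x + d) + (1 + B) ^ 4 * (y + d + 2 * x)"
  proof (intro add_mono)
    have p: "1 \<le> (1 + B) ^ k" for k using nn by simp
    have "(1 + B) * (x + B * d) \<le> (1 + B) * ((1 + B) * (x + d))"
      using nn by (intro mult_left_mono) (auto simp: algebra_simps)
    also have "\<dots> = (1 + B)\<^sup>2 * (x + d)" by (simp add: power2_eq_square)
    also have "\<dots> \<le> (1 + B) ^ 4 * (x + d)"
      using nn by (intro mult_right_mono power_increasing) auto
    finally show "(1 + B) * (x + B * d) \<le> (1 + B) ^ 4 * (x + d)" .
    have "y + B * ((1 + B)\<^sup>2 * (d + 2 * x)) \<le> (1 + B) ^ 3 * y + (1 + B) * ((1 + B)\<^sup>2 * (d + 2 * x))"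
      using mult_right_mono[OF p[of 3] nn(3)] nn by (intro add_mono mult_right_mono) auto
    also have "\<dots> = (1 + B) ^ 3 * (y + d + 2 * x)"
    proof -
      have "s ^ 3 * u + s * (s\<^sup>2 * v) = s ^ 3 * (u + v)" for s u v :: real
        by (simp add: power3_eq_cube power2_eq_square distrib_left)
      then show ?thesis by (metis add.assoc)
    qed
    finally have "(1 + B) * (y + B * ((1 + B)\<^sup>2 * (d + 2 * x))) \<le> (1 + B) * ((1 + B) ^ 3 * (y + d + 2 * x))"
      using nn by (intro mult_left_mono) auto
    also have "\<dots> = (1 + B) ^ 4 * (y + d + 2 * x)" by (simp add: numeral_eq_Suc)
    finally show "(1 + B) * (y + B * ((1 + B)\<^sup>2 * (d + 2 * x))) \<le> (1 + B) ^ 4 * (y + d + 2 * x)" .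
  qed
  also have "\<dots> = (1 + B) ^ 4 * (2 * d + 3 * x + y)" unfolding distrib_left[symmetric] by simp
  also have "\<dots> \<le> (1 + B) ^ 4 * (3 * (d + x + y))" using nn by (intro mult_left_mono) auto
  also have "\<dots> = 3 * (1 + B) ^ 4 * (d + x + y)" by simp
  finally show ?thesis by (simp add: d_def x_def y_def)
qed

subsection \<open>The cocycle and its lifted angle\<close>

text \<open>The coefficient at \<open>2\<^sup>n\<^sup>-\<^sup>1 x\<close> acts first and the one at \<open>x\<close> last.\<close>

primrec cocycle :: "real \<Rightarrow> (real \<Rightarrow> real) \<Rightarrow> nat \<Rightarrow> real \<Rightarrow> complex \<Rightarrow> complex" where
  "cocycle e c 0 x z = z"
| "cocycle e c (Suc n) x z = cocycle e c n x (hstep e (c (2 ^ n * x)) z)"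

text \<open>The logarithm is summed step by step and not taken of the product: each summand depends
  continuously on its data, so the imaginary part is a continuous lift of the argument and counts
  full turns.\<close>

primrec log_cocycle :: "real \<Rightarrow> (real \<Rightarrow> real) \<Rightarrow> nat \<Rightarrow> real \<Rightarrow> complex \<Rightarrow> complex" where
  "log_cocycle e c 0 x z = 0"
| "log_cocycle e c (Suc n) x z =
    hstep_log e (c (2 ^ n * x)) z + log_cocycle e c n x (hstep e (c (2 ^ n * x)) z)"

lemma cocycle_eq_0_iff [simp]: "cocycle e c n x z = 0 \<longleftrightarrow> z = 0"
  by (induction n arbitrary: z) auto

lemma exp_log_cocycle: "z \<noteq> 0 \<Longrightarrow> z * exp (log_cocycle e c n x z) = cocycle e c n x z"
proof (induction n arbitrary: z)
  case (Suc n)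
  have "z * exp (log_cocycle e c (Suc n) x z) =
      hstep e (c (2 ^ n * x)) z * exp (log_cocycle e c n x (hstep e (c (2 ^ n * x)) z))"
    using Suc.prems by (simp add: exp_add exp_hstep_log flip: mult.assoc)
  then show ?case using Suc by simp
qed simp

lemma norm_cocycle: "z \<noteq> 0 \<Longrightarrow> cmod (cocycle e c n x z) = cmod z * exp (Re (log_cocycle e c n x z))"
  using exp_log_cocycle[of z e c n x] by (metis norm_exp_eq_Re norm_mult)

lemma area_cocycle: "Im (cnj (cocycle e c n x z) * cocycle e c n x w) = Im (cnj z * w)"
  by (induction n arbitrary: z w) (simp_all only: cocycle.simps area_hstep)

lemma log_cocycle_add:
  "log_cocycle e c (n + m) x z =
    log_cocycle e c n (2 ^ m * x) z + log_cocycle e c m x (cocycle e c n (2 ^ m * x) z)"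
  by (induction n arbitrary: z) (simp_all add: power_add mult.assoc)

lemma circle_periodic_cocycle:
  assumes "circle_periodic c"
  shows "cocycle e c n (x + 1) z = cocycle e c n x z"
    and "log_cocycle e c n (x + 1) z = log_cocycle e c n x z"
  using circle_periodic_power2[OF assms]
  by (induction n arbitrary: z) (auto simp: circle_periodic_def)

lemma Im_log_cocycle:
  assumes "z \<noteq> 0" "0 \<le> e" "\<And>x. 0 \<le> c x"
  shows "0 \<le> Im (log_cocycle e c n x z)" "Im (log_cocycle e c n x z) \<le> 2 * pi * n"
proof -
  have "0 \<le> Im (log_cocycle e c n x z) \<and> Im (log_cocycle e c n x z) \<le> 2 * pi * n"
    using assms(1)
  proof (induction n arbitrary: z)
    case (Suc n)
    have "2 * pi * real (Suc n) = 2 * pi + 2 * pi * real n" by (simp add: distrib_left)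
    then show ?case
      using Im_hstep_log[OF Suc.prems assms(2,3), of "2 ^ n * x"] Suc.IH[of "hstep e (c (2 ^ n * x)) z"] Suc.prems
      unfolding log_cocycle.simps plus_complex.sel by auto
  qed simp
  then show "0 \<le> Im (log_cocycle e c n x z)" "Im (log_cocycle e c n x z) \<le> 2 * pi * n" by auto
qed

text \<open>Induction over the steps. The constant \<open>K\<close> grows with \<open>n\<close> and
  is meant for fixed \<open>n\<close>, where it gives continuity; bounds with controlled growth in
  \<open>n\<close> come from the contraction. Vectors enter through their lines, since a step
  logarithm depends on nothing else.\<close>

lemma log_cocycle_lipschitz:
  assumes "circle_lipschitz L c" "\<And>x. 0 \<le> c x" "\<And>x. c x \<le> B"
  obtains K where "0 \<le> K" "\<And>e e' x x' z w. 0 \<le> e \<Longrightarrow> e \<le> B \<Longrightarrow> 0 \<le> e' \<Longrightarrow> e' \<le> B \<Longrightarrow> z \<noteq> 0 \<Longrightarrow> w \<noteq> 0 \<Longrightarrow>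
    cmod (log_cocycle e c n x z - log_cocycle e' c n x' w) \<le> K * (\<bar>e - e'\<bar> + \<bar>x - x'\<bar> + line_dist z w)"
proof -
  have "\<exists>K\<ge>0. \<forall>e e' x x' z w. 0 \<le> e \<longrightarrow> e \<le> B \<longrightarrow> 0 \<le> e' \<longrightarrow> e' \<le> B \<longrightarrow> z \<noteq> 0 \<longrightarrow> w \<noteq> 0 \<longrightarrow>
    cmod (log_cocycle e c n x z - log_cocycle e' c n x' w) \<le> K * (\<bar>e - e'\<bar> + \<bar>x - x'\<bar> + line_dist z w)"
  proof (induction n)
    case 0
    show ?case by (intro exI[of _ 0]) auto
  next
    case (Suc n)
    then obtain K where K: "0 \<le> K" "\<And>e e' x x' z w. 0 \<le> e \<Longrightarrow> e \<le> B \<Longrightarrow> 0 \<le> e' \<Longrightarrow> e' \<le> B \<Longrightarrow> z \<noteq> 0 \<Longrightarrow> w \<noteq> 0 \<Longrightarrow>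
      cmod (log_cocycle e c n x z - log_cocycle e' c n x' w) \<le> K * (\<bar>e - e'\<bar> + \<bar>x - x'\<bar> + line_dist z w)"
      by blast
    have B: "0 \<le> B" and L: "0 \<le> L"
      using assms(2)[of 0] assms(3)[of 0] circle_lipschitz_nonneg[OF assms(1)] by linarith+
    define M where "M = 3 * (1 + B) ^ 4 * (1 + L * 2 ^ n)"
    have M: "0 \<le> M" using B L by (simp add: M_def)
    have "cmod (log_cocycle e c (Suc n) x z - log_cocycle e' c (Suc n) x' w)
        \<le> (M + K * (1 + M)) * (\<bar>e - e'\<bar> + \<bar>x - x'\<bar> + line_dist z w)"
      if H: "0 \<le> e" "e \<le> B" "0 \<le> e'" "e' \<le> B" "z \<noteq> 0" "w \<noteq> 0" for e e' x x' z w
    proof -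
      define s where "s = \<bar>e - e'\<bar> + \<bar>x - x'\<bar> + line_dist z w"
      define t t' where "t = c (2 ^ n * x)" and "t' = c (2 ^ n * x')"
      have t: "0 \<le> t" "t \<le> B" "0 \<le> t'" "t' \<le> B" using assms(2,3) by (auto simp: t_def t'_def)
      have "\<bar>t - t'\<bar> \<le> L * \<bar>2 ^ n * x - 2 ^ n * x'\<bar>"
        using circle_lipschitzD[OF assms(1), of "2 ^ n * x" "2 ^ n * x'"] by (simp add: t_def t'_def)
      also have "\<dots> = L * 2 ^ n * \<bar>x - x'\<bar>"
        by (simp add: abs_mult flip: right_diff_distrib)
      finally have "\<bar>t - t'\<bar> \<le> L * 2 ^ n * \<bar>x - x'\<bar>" .
      then have "line_dist z w + \<bar>e - e'\<bar> + \<bar>t - t'\<bar> \<le> s + L * 2 ^ n * s"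
        using mult_left_mono[of "\<bar>x - x'\<bar>" s "L * 2 ^ n"] L by (simp add: s_def)
      then have "3 * (1 + B) ^ 4 * (line_dist z w + \<bar>e - e'\<bar> + \<bar>t - t'\<bar>) \<le> 3 * (1 + B) ^ 4 * (s + L * 2 ^ n * s)"
        using B by (intro mult_left_mono) auto
      also have "\<dots> = M * s" by (simp add: M_def distrib_left distrib_right)
      finally have le: "3 * (1 + B) ^ 4 * (line_dist z w + \<bar>e - e'\<bar> + \<bar>t - t'\<bar>) \<le> M * s" .
      have 1: "cmod (hstep_log e t z - hstep_log e' t' w) \<le> M * s"
        using hstep_log_lipschitz[of z w e B e' t t'] H t le by linarith
      have "2 * (1 + B) ^ 4 * (line_dist z w + \<bar>e - e'\<bar> + \<bar>t - t'\<bar>) \<le>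
          3 * (1 + B) ^ 4 * (line_dist z w + \<bar>e - e'\<bar> + \<bar>t - t'\<bar>)"
        using B by (intro mult_right_mono) auto
      then have 2: "line_dist (hstep e t z) (hstep e' t' w) \<le> M * s"
        using line_dist_hstep[of z w e B e' t t'] H t le by linarith
      have "cmod (log_cocycle e c n x (hstep e t z) - log_cocycle e' c n x' (hstep e' t' w))
          \<le> K * (\<bar>e - e'\<bar> + \<bar>x - x'\<bar> + line_dist (hstep e t z) (hstep e' t' w))"
        using K(2) H by simp
      also have "\<dots> \<le> K * (s + M * s)"
        using 2 K(1) line_dist_nonneg[of z w] by (intro mult_left_mono add_mono) (auto simp: s_def)
      finally have 3: "cmod (log_cocycle e c n x (hstep e t z) - log_cocycle e' c n x' (hstep e' t' w)) \<le> K * (s + M * s)" .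
      have "cmod (log_cocycle e c (Suc n) x z - log_cocycle e' c (Suc n) x' w) \<le> M * s + K * (s + M * s)"
        using norm_triangle_ineq[of "hstep_log e t z - hstep_log e' t' w"
            "log_cocycle e c n x (hstep e t z) - log_cocycle e' c n x' (hstep e' t' w)"] 1 3
        by (simp add: t_def t'_def algebra_simps)
      then show ?thesis by (simp add: s_def distrib_left distrib_right mult.assoc)
    qed
    moreover have "0 \<le> M + K * (1 + M)" using K(1) M by simp
    ultimately show ?case by blast
  qed
  then show thesis using that by blast
qed

lemma line_dist_cis:
  assumes "z \<noteq> 0"
  shows "line_dist (z * cis \<phi>) (z * cis \<psi>) \<le> 2 * \<bar>\<phi> - \<psi>\<bar>"
proof -
  have "cnj (z * cis \<phi>) * (z * cis \<psi>) = complex_of_real ((cmod z)\<^sup>2) * cis (\<psi> - \<phi>)"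
    by (simp add: cis_cnj cis_mult complex_norm_square mult_ac del: of_real_power)
  then have "Im (cnj (z * cis \<phi>) * (z * cis \<psi>)) = (cmod z)\<^sup>2 * sin (\<psi> - \<phi>)"
    by simp
  then have "line_dist (z * cis \<phi>) (z * cis \<psi>) = 2 * \<bar>(cmod z)\<^sup>2 * sin (\<psi> - \<phi>)\<bar> / (cmod z * cmod z)"
    using assms by (subst line_dist_eq) (simp_all add: norm_mult del: complex_cnj_mult)
  also have "\<dots> = 2 * \<bar>sin (\<psi> - \<phi>)\<bar>"
    using assms by (simp add: abs_mult power2_eq_square)
  also have "\<dots> \<le> 2 * \<bar>\<phi> - \<psi>\<bar>"
    using abs_sin_x_le_abs_x[of "\<psi> - \<phi>"] by (simp add: abs_minus_commute)
  finally show ?thesis .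
qed

text \<open>
  Along an arc of length less than \<open>\<pi>\<close> the images never become parallel, because the cocycle
  preserves areas; so their lifted angle cannot change by \<open>\<pi>\<close>.
\<close>

lemma Im_log_cocycle_diff:
  assumes c: "circle_lipschitz L c" "\<And>x. 0 \<le> c x" "\<And>x. c x \<le> B"
    and e: "0 \<le> e" "e \<le> B" and zw: "z \<noteq> 0" "w \<noteq> 0"
  shows "\<bar>Im (log_cocycle e c n x z) - Im (log_cocycle e c n x w)\<bar> \<le> 2 * pi"
proof -
  obtain K where K: "0 \<le> K" "\<And>e e' x x' z w. 0 \<le> e \<Longrightarrow> e \<le> B \<Longrightarrow> 0 \<le> e' \<Longrightarrow> e' \<le> B \<Longrightarrow> z \<noteq> 0 \<Longrightarrow> w \<noteq> 0 \<Longrightarrow>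
    cmod (log_cocycle e c n x z - log_cocycle e' c n x' w) \<le> K * (\<bar>e - e'\<bar> + \<bar>x - x'\<bar> + line_dist z w)"
    using log_cocycle_lipschitz[OF c] by blast
  have parallel: "log_cocycle e c n x z = log_cocycle e c n x w"
    if "z \<noteq> 0" "w \<noteq> 0" "line_dist z w = 0" for z w
    using K(2)[of e e z w x x] that e by simp
  define \<psi> where "\<psi> = Arg (w / z)"
  have \<psi>: "\<bar>\<psi>\<bar> \<le> pi" using Arg_bounded[of "w / z"] by (auto simp: \<psi>_def)
  have "w / z = complex_of_real (cmod (w / z)) * cis \<psi>"
    using rcis_cmod_Arg[of "w / z"] by (simp add: \<psi>_def rcis_def)
  then have w: "w = complex_of_real (cmod (w / z)) * (z * cis \<psi>)" using zw by (simp add: field_simps)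
  have lin: "line_dist (complex_of_real r * v) v = 0" if "r \<noteq> 0" for r v
    using that by (simp add: line_dist_def)
  \<comment> \<open>Only the line of \<open>w\<close> matters, so \<open>w\<close> is replaced by
    \<open>z\<close> rotated by \<psi>.\<close>
  have wl: "log_cocycle e c n x w = log_cocycle e c n x (z * cis \<psi>)"
    by (rule parallel) (use zw lin[of "cmod (w / z)" "z * cis \<psi>"] w in \<open>auto\<close>)
  \<comment> \<open>\<open>g t\<close> is the lifted angle from the image of \<open>z\<close> to the
    image of \<open>z\<close> rotated by \<open>t * \<psi>\<close>.\<close>
  define g where "g t = Im (log_cocycle e c n x (z * cis (t * \<psi>))) + t * \<psi> - Im (log_cocycle e c n x z)" for t
  have g0: "g 0 = 0" by (simp add: g_def)
  have cont: "continuous_on {0..1} g"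
  proof -
    have "(2 * K * pi)-lipschitz_on {0..1} (\<lambda>t. log_cocycle e c n x (z * cis (t * \<psi>)))"
    proof (rule lipschitz_onI)
      fix s t :: real
      have "dist (log_cocycle e c n x (z * cis (s * \<psi>))) (log_cocycle e c n x (z * cis (t * \<psi>)))
          \<le> K * line_dist (z * cis (s * \<psi>)) (z * cis (t * \<psi>))"
        using K(2)[of e e "z * cis (s * \<psi>)" "z * cis (t * \<psi>)" x x] e zw by (simp add: dist_norm)
      also have "\<dots> \<le> K * (2 * \<bar>s * \<psi> - t * \<psi>\<bar>)"
        by (intro mult_left_mono line_dist_cis zw K)
      also have "\<dots> = K * (2 * (\<bar>s - t\<bar> * \<bar>\<psi>\<bar>))" by (simp add: abs_mult flip: left_diff_distrib)
      also have "\<dots> \<le> K * (2 * (\<bar>s - t\<bar> * pi))" using \<psi> K(1) by (intro mult_left_mono) auto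
      finally show "dist (log_cocycle e c n x (z * cis (s * \<psi>))) (log_cocycle e c n x (z * cis (t * \<psi>)))
          \<le> 2 * K * pi * dist s t" by (simp add: dist_norm mult_ac)
    qed (use K in auto)
    then have "continuous_on {0..1} (\<lambda>t. log_cocycle e c n x (z * cis (t * \<psi>)))"
      by (rule lipschitz_on_continuous_on)
    then show ?thesis unfolding g_def by (intro continuous_intros)
  qed
  \<comment> \<open>Area preservation in polar form: \<open>sin (g t)\<close> and
    \<open>sin (t * \<psi>)\<close> agree up to a positive factor.\<close>
  have sing: "sin (g t) = 0 \<longleftrightarrow> sin (t * \<psi>) = 0" for t
  proof -
    define u v where "u = log_cocycle e c n x z" and "v = log_cocycle e c n x (z * cis (t * \<psi>))"
    have "cocycle e c n x (z * cis (t * \<psi>)) = z * cis (t * \<psi>) * exp v"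
      and "cocycle e c n x z = z * exp u"
      using zw by (simp_all add: exp_log_cocycle u_def v_def)
    then have "Im (cnj (z * exp u) * (z * cis (t * \<psi>) * exp v)) = Im (cnj z * (z * cis (t * \<psi>)))"
      using area_cocycle[of e c n x z "z * cis (t * \<psi>)"] by simp
    moreover have "cnj (z * exp u) * (z * cis (t * \<psi>) * exp v) =
        complex_of_real ((cmod z)\<^sup>2 * exp (Re u + Re v)) * cis (g t)"
    proof -
      have "exp u = complex_of_real (exp (Re u)) * cis (Im u)" "exp v = complex_of_real (exp (Re v)) * cis (Im v)"
        by (simp_all add: exp_eq_polar)
      moreover have "g t = (t * \<psi>) + (Im v - Im u)" by (simp add: g_def u_def v_def)
      ultimately show ?thesis
        by (simp only: complex_cnj_mult complex_cnj_complex_of_real cis_cnj exp_add of_real_mult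
            complex_norm_square diff_conv_add_uminus cis_mult[symmetric] mult_ac)
    qed
    moreover have "cnj z * (z * cis (t * \<psi>)) = complex_of_real ((cmod z)\<^sup>2) * cis (t * \<psi>)"
      by (simp add: complex_norm_square del: of_real_power)
    ultimately have "Im (complex_of_real ((cmod z)\<^sup>2 * exp (Re u + Re v)) * cis (g t)) =
        Im (complex_of_real ((cmod z)\<^sup>2) * cis (t * \<psi>))"
      by (simp only:)
    then have "(cmod z)\<^sup>2 * exp (Re u + Re v) * sin (g t) = (cmod z)\<^sup>2 * sin (t * \<psi>)"
      by (simp del: of_real_power of_real_mult)
    then show ?thesis using zw by auto
  qed
  show ?thesis
  proof (cases "\<psi> = 0 \<or> \<bar>\<psi>\<bar> = pi")
    case True
    then have "\<psi> = 0 \<or> \<psi> = pi \<or> \<psi> = - pi" by linarith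
    moreover have "cis (- pi) = -1" by (simp add: complex_eq_iff)
    ultimately have "cis \<psi> = complex_of_real 1 \<or> cis \<psi> = complex_of_real (-1)" by auto
    then obtain r where r: "r \<noteq> 0" "cis \<psi> = complex_of_real r"
      by (metis one_neq_zero neg_equal_0_iff_equal)
    then have "log_cocycle e c n x w = log_cocycle e c n x (complex_of_real r * z)"
      unfolding wl by (simp add: mult.commute)
    also have "\<dots> = log_cocycle e c n x z"
      using r(1) zw lin[of r z] by (intro parallel) auto
    finally have "log_cocycle e c n x w = log_cocycle e c n x z" .
    then show ?thesis by simp
  next
    case False
    then have \<psi>': "\<psi> \<noteq> 0" "\<bar>\<psi>\<bar> < pi" using \<psi> by auto
    have nz: "sin (t * \<psi>) \<noteq> 0" if "0 < t" "t \<le> 1" for t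
    proof -
      have "t * \<bar>\<psi>\<bar> \<le> 1 * \<bar>\<psi>\<bar>" using that by (intro mult_right_mono) auto
      moreover have "\<bar>t * \<psi>\<bar> = t * \<bar>\<psi>\<bar>" using that by (simp add: abs_mult)
      ultimately have "\<bar>t * \<psi>\<bar> < pi" using \<psi>' by linarith
      moreover have "t * \<psi> \<noteq> 0" using that \<psi>' by simp
      ultimately show ?thesis using sin_gt_zero[of "t * \<psi>"] sin_gt_zero[of "- (t * \<psi>)"] by fastforce
    qed
    \<comment> \<open>Otherwise \<open>g\<close> takes the value \<open>pi\<close> or
      \<open>- pi\<close> by continuity, and the images are parallel while the vectors are not. The
      final bound \<open>2 * pi\<close> adds the angle \<psi> itself.\<close>
    have "\<bar>g 1\<bar> < pi"
    proof (rule ccontr)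
      assume "\<not> \<bar>g 1\<bar> < pi"
      then have "\<exists>t. 0 \<le> t \<and> t \<le> 1 \<and> \<bar>g t\<bar> = pi"
        using g0 pi_gt_zero by (intro IVT') (auto intro!: continuous_intros cont)
      then obtain t where t: "0 \<le> t" "t \<le> 1" "\<bar>g t\<bar> = pi" by blast
      then have "t \<noteq> 0" using g0 by auto
      moreover have "g t = pi \<or> g t = - pi" using t(3) by linarith
      then have "sin (g t) = 0" by auto
      ultimately show False using nz[of t] sing[of t] t by auto
    qed
    then show ?thesis using \<psi>' wl by (simp add: g_def)
  qed
qed

subsection \<open>Contraction and Hoelder continuity from a positive drift\<close>

text \<open>Splits off the step that acts first. It sees \<open>x\<close> only through
  \<open>2 ^ n * x\<close>, which for an \<open>n\<close>-fold preimage \<open>x\<close> of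
  \<open>t\<close> equals \<open>t\<close> up to an integer; hence the periodicity.\<close>

lemma branch_iter_Suc_pullback:
  assumes "\<And>x. circle_periodic (\<lambda>t. h t x)"
  shows "(branch_avg ^^ Suc n) (\<lambda>x. h (2 ^ n * x) x) y = branch_avg (\<lambda>t. (branch_avg ^^ n) (h t) t) y"
  using branch_iter_pullback[OF assms] by (simp add: branch_avg_def)

lemma branch_iter_Re: "(branch_avg ^^ n) (\<lambda>x. Re (f x)) y = Re ((branch_avg ^^ n) f y)"
proof (induction n arbitrary: y)
  case (Suc n)
  show ?case unfolding branch_iter_Suc Suc by simp
qed simp

lemma branch_iter_Im: "(branch_avg ^^ n) (\<lambda>x. Im (f x)) y = Im ((branch_avg ^^ n) f y)"
proof (induction n arbitrary: y)
  case (Suc n)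
  show ?case unfolding branch_iter_Suc Suc by simp
qed simp

lemma branch_avg_mono:
  fixes f g :: "real \<Rightarrow> real"
  assumes "\<And>t. f t \<le> g t" shows "branch_avg f y \<le> branch_avg g y"
  using branch_iter_mono[of f g 1 y] assms by simp

lemma branch_avg_simps:
  fixes f g :: "real \<Rightarrow> real"
  shows "branch_avg (\<lambda>t. f t + g t) y = branch_avg f y + branch_avg g y"
    "branch_avg (\<lambda>t. f t - g t) y = branch_avg f y - branch_avg g y"
    "branch_avg (\<lambda>t. k * f t) y = k * branch_avg f y" "branch_avg (\<lambda>t. k) y = k"
  by (simp_all add: branch_avg_def field_simps)

lemma exp_minus_le:
  fixes s :: real assumes "\<bar>s\<bar> \<le> 1" shows "exp (- s) \<le> 1 - s + s\<^sup>2"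
proof (cases "0 \<le> s")
  case True
  have "1 \<le> (1 + s) * (1 - s + s\<^sup>2)"
    using True by (simp add: algebra_simps power2_eq_square)
  also have "\<dots> \<le> exp s * (1 - s + s\<^sup>2)"
    using exp_ge_add_one_self[of s] True assms by (intro mult_right_mono) auto
  finally show ?thesis by (simp add: exp_minus field_simps)
next
  case False
  then show ?thesis using exp_bound[of "- s"] assms by simp
qed

lemma ln_norm_shear:
  assumes "z \<noteq> 0" "0 \<le> t" "t \<le> B"
  shows "\<bar>ln (cmod (shear t z)) - ln (cmod z)\<bar> \<le> B"
proof -
  have p: "0 < cmod z" "0 < cmod (shear t z)" using assms by auto
  have "ln (cmod (shear t z)) \<le> ln ((1 + t) * cmod z)"
    using norm_shear_le[of t z] p assms by (intro ln_mono) auto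
  moreover have "ln (cmod z) \<le> ln ((1 + t) * cmod (shear t z))"
    using norm_shear_ge[of z t] p assms by (intro ln_mono) auto
  moreover have "ln ((1 + t) * x) = ln (1 + t) + ln x" if "0 < x" for x
    using that assms by (simp add: ln_mult)
  ultimately show ?thesis
    using p ln_add_one_self_le_self[of t] assms by (simp add: abs_le_iff)
qed

lemma ln_norm_hstep:
  assumes "z \<noteq> 0" "0 \<le> e" "e \<le> B" "0 \<le> t" "t \<le> B"
  shows "\<bar>ln (cmod (hstep e t z)) - ln (cmod z)\<bar> \<le> 2 * B"
  using ln_norm_shear[of "\<i> * z" e B] ln_norm_shear[of "- \<i> * shear e (\<i> * z)" t B] assms
  by (simp add: hstep_def norm_mult)

text \<open>A strict submartingale property of \<open>ln (cmod z) + v\<close> along the chain,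
  demanded at every state. The corrector \<open>v\<close> is bounded, so over many steps it costs
  only a constant, while \<delta> accumulates.\<close>

definition uniform_drift :: "real \<Rightarrow> (real \<Rightarrow> real) \<Rightarrow> real \<Rightarrow> real \<Rightarrow> (real \<Rightarrow> complex \<Rightarrow> real) \<Rightarrow> bool" where
  "uniform_drift e c \<delta> M v \<longleftrightarrow> 0 < \<delta> \<and> (\<forall>y z. z \<noteq> 0 \<longrightarrow> \<bar>v y z\<bar> \<le> M) \<and>
    (\<forall>y z. z \<noteq> 0 \<longrightarrow> ln (cmod z) + v y z + \<delta> \<le>
      branch_avg (\<lambda>t. ln (cmod (hstep e (c t) z)) + v t (hstep e (c t) z)) y)"

lemma line_dist_le_2: "line_dist z w \<le> 2"
proof -
  have "cmod (cnj z / z) \<le> 1" for z by (cases "z = 0") (simp_all add: norm_divide)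
  then show ?thesis
    using norm_triangle_ineq4[of "cnj z / z" "cnj w / w"] unfolding line_dist_def by (smt (verit))
qed

text \<open>
  Since areas are preserved, the distance of two lines is multiplied by the inverse of the growth of
  both vectors; a positive drift therefore contracts a small power of it on average.
\<close>

lemma line_dist_contraction:
  assumes c: "\<And>x. 0 \<le> c x" "\<And>x. c x \<le> B" and e: "0 \<le> e" "e \<le> B"
    and drift: "uniform_drift e c \<delta> M v"
  obtains \<alpha> where "0 < \<alpha>" "\<alpha> < 1"
    "\<And>y z w. z \<noteq> 0 \<Longrightarrow> w \<noteq> 0 \<Longrightarrow>
      branch_avg (\<lambda>t. line_dist (hstep e (c t) z) (hstep e (c t) w) powr \<alpha> *
          exp (- \<alpha> * (v t (hstep e (c t) z) + v t (hstep e (c t) w)))) y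
        \<le> (1 - \<alpha> * \<delta>) * (line_dist z w powr \<alpha> * exp (- \<alpha> * (v y z + v y w)))"
proof -
  have \<delta>: "0 < \<delta>" and v: "\<And>y z. z \<noteq> 0 \<Longrightarrow> \<bar>v y z\<bar> \<le> M"
    and D: "\<And>y z. z \<noteq> 0 \<Longrightarrow> ln (cmod z) + v y z + \<delta> \<le>
      branch_avg (\<lambda>t. ln (cmod (hstep e (c t) z)) + v t (hstep e (c t) z)) y"
    using drift by (auto simp: uniform_drift_def)
  \<comment> \<open>Bounds the summed increments of two vectors: for each, the logarithm of the norm
    moves by at most \<open>2 * B\<close> and the corrector by at most \<open>2 * M\<close>.\<close>
  define R where "R = 4 * B + 4 * M + 1"
  have "0 \<le> M" using v[of 1 0] by simp
  then have R: "1 \<le> R" using e by (simp add: R_def)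
  \<comment> \<open>\<open>\<alpha> * R \<le> 1\<close> keeps the exponent in the range of
    \<open>exp_minus_le\<close>; \<open>\<alpha> * R\<^sup>2 \<le> \<delta>\<close> lets the
    quadratic term consume only one of the two \<delta> that the pair of vectors gains.\<close>
  define \<alpha> where "\<alpha> = min (1 / 2) (min (1 / R) (\<delta> / R\<^sup>2))"
  have \<alpha>: "0 < \<alpha>" "\<alpha> < 1" "\<alpha> * R \<le> 1" "\<alpha> * R\<^sup>2 \<le> \<delta>"
  proof -
    show "0 < \<alpha>" "\<alpha> < 1" using R \<delta> by (auto simp: \<alpha>_def)
    have "\<alpha> \<le> 1 / R" "\<alpha> \<le> \<delta> / R\<^sup>2" by (auto simp: \<alpha>_def)
    then show "\<alpha> * R \<le> 1" "\<alpha> * R\<^sup>2 \<le> \<delta>" using R by (simp_all add: pos_le_divide_eq)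
  qed
  show thesis
  proof (rule that[OF \<alpha>(1,2)])
    fix y :: real and z w :: complex assume z: "z \<noteq> 0" and w: "w \<noteq> 0"
    define W where "W = line_dist z w powr \<alpha> * exp (- \<alpha> * (v y z + v y w))"
    define Y where "Y z t = ln (cmod (hstep e (c t) z)) + v t (hstep e (c t) z) - (ln (cmod z) + v y z)" for z t
    define X where "X t = Y z t + Y w t" for t
    have Y: "\<bar>Y z t\<bar> \<le> 2 * B + 2 * M" if "z \<noteq> 0" for z t
      using ln_norm_hstep[OF that e c(1,2), of t] v[OF that, of y] v[of "hstep e (c t) z" t] that
      by (simp add: Y_def abs_le_iff)
    have X: "\<bar>X t\<bar> \<le> R" for t using Y[OF z, of t] Y[OF w, of t] by (simp add: X_def R_def)
    have Ydrift: "\<delta> \<le> branch_avg (Y z) y" if "z \<noteq> 0" for z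
      using D[OF that, of y] unfolding Y_def branch_avg_simps by simp
    have Xdrift: "2 * \<delta> \<le> branch_avg X y"
      unfolding X_def branch_avg_simps using Ydrift[OF z] Ydrift[OF w] by simp
    have step: "line_dist (hstep e (c t) z) (hstep e (c t) w) powr \<alpha> *
        exp (- \<alpha> * (v t (hstep e (c t) z) + v t (hstep e (c t) w))) = W * exp (- (\<alpha> * X t))" for t
    proof -
      define z' w' where "z' = hstep e (c t) z" and "w' = hstep e (c t) w"
      have nz: "z' \<noteq> 0" "w' \<noteq> 0" using z w by (auto simp: z'_def w'_def)
      \<comment> \<open>The area in the numerator is preserved, so only the norms in the denominator
        move.\<close>
      have "line_dist z' w' = line_dist z w * exp (ln (cmod z) + ln (cmod w) - ln (cmod z') - ln (cmod w'))"
      proof -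
        have "exp (ln (cmod z) + ln (cmod w) - ln (cmod z') - ln (cmod w')) = cmod z * cmod w / (cmod z' * cmod w')"
          using z w nz by (simp add: exp_diff exp_add)
        then show ?thesis
          unfolding line_dist_eq[OF z w] line_dist_eq[OF nz] unfolding z'_def w'_def area_hstep
          using z w by simp
      qed
      then have "line_dist z' w' powr \<alpha> = line_dist z w powr \<alpha> *
          exp (\<alpha> * (ln (cmod z) + ln (cmod w) - ln (cmod z') - ln (cmod w')))"
        by (simp add: powr_mult exp_powr_real mult.commute)
      then have "line_dist z' w' powr \<alpha> * exp (- \<alpha> * (v t z' + v t w')) =
          line_dist z w powr \<alpha> * exp (\<alpha> * (ln (cmod z) + ln (cmod w) - ln (cmod z') - ln (cmod w')) + - \<alpha> * (v t z' + v t w'))"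
        by (simp only: exp_add mult.assoc)
      also have "\<alpha> * (ln (cmod z) + ln (cmod w) - ln (cmod z') - ln (cmod w')) + - \<alpha> * (v t z' + v t w') =
          - \<alpha> * (v y z + v y w) + - (\<alpha> * X t)"
        by (simp add: X_def Y_def z'_def w'_def algebra_simps)
      finally show ?thesis unfolding W_def z'_def w'_def exp_add mult.assoc .
    qed
    have W: "0 \<le> W" by (simp add: W_def)
    have "branch_avg (\<lambda>t. W * exp (- (\<alpha> * X t))) y \<le> branch_avg (\<lambda>t. W * (1 - \<alpha> * X t + \<alpha> * \<delta>)) y"
    proof (intro branch_avg_mono mult_left_mono W)
      fix t
      have "\<bar>\<alpha> * X t\<bar> = \<alpha> * \<bar>X t\<bar>" using \<alpha> by (simp add: abs_mult)
      also have "\<dots> \<le> \<alpha> * R" using X \<alpha> by (intro mult_left_mono) auto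
      finally have le: "\<bar>\<alpha> * X t\<bar> \<le> \<alpha> * R" .
      then have "(\<alpha> * X t)\<^sup>2 \<le> (\<alpha> * R)\<^sup>2" using power_mono[OF le abs_ge_zero, of 2] by simp
      also have "\<dots> = \<alpha> * (\<alpha> * R\<^sup>2)" by (simp add: power2_eq_square)
      also have "\<dots> \<le> \<alpha> * \<delta>" using \<alpha> by (intro mult_left_mono) auto
      finally show "exp (- (\<alpha> * X t)) \<le> 1 - \<alpha> * X t + \<alpha> * \<delta>"
        using exp_minus_le[of "\<alpha> * X t"] le \<alpha> by linarith
    qed
    also have "\<dots> = W * (1 - \<alpha> * branch_avg X y + \<alpha> * \<delta>)" by (simp only: branch_avg_simps)
    also have "\<dots> \<le> W * (1 - \<alpha> * (2 * \<delta>) + \<alpha> * \<delta>)"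
      using Xdrift \<alpha> by (intro mult_left_mono W add_right_mono diff_left_mono) auto
    also have "\<dots> = (1 - \<alpha> * \<delta>) * W" by (simp add: algebra_simps)
    finally show "branch_avg (\<lambda>t. line_dist (hstep e (c t) z) (hstep e (c t) w) powr \<alpha> *
          exp (- \<alpha> * (v t (hstep e (c t) z) + v t (hstep e (c t) w)))) y
        \<le> (1 - \<alpha> * \<delta>) * (line_dist z w powr \<alpha> * exp (- \<alpha> * (v y z + v y w)))"
      unfolding step W_def .
  qed
qed

text \<open>One step changes the difference of the logarithms by a multiple of the line distance,
  hence of its power \<alpha>. Weighted with the correctors, this power decays geometrically on
  average, so the sum over all steps is bounded independently of \<open>n\<close>.\<close>

lemma branch_iter_log_cocycle_diff:
  assumes L: "circle_lipschitz L c" and c: "\<And>x. 0 \<le> c x" "\<And>x. c x \<le> B" and e: "0 \<le> e" "e \<le> B"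
    and drift: "uniform_drift e c \<delta> M v"
  obtains \<alpha> K where "0 < \<alpha>" "\<alpha> < 1" "0 \<le> K"
    "\<And>n y z w. z \<noteq> 0 \<Longrightarrow> w \<noteq> 0 \<Longrightarrow>
      (branch_avg ^^ n) (\<lambda>x. cmod (log_cocycle e c n x z - log_cocycle e c n x w)) y \<le> K * line_dist z w powr \<alpha>"
proof -
  obtain \<alpha> where \<alpha>: "0 < \<alpha>" "\<alpha> < 1" and contr:
    "\<And>y z w. z \<noteq> 0 \<Longrightarrow> w \<noteq> 0 \<Longrightarrow>
      branch_avg (\<lambda>t. line_dist (hstep e (c t) z) (hstep e (c t) w) powr \<alpha> *
          exp (- \<alpha> * (v t (hstep e (c t) z) + v t (hstep e (c t) w)))) y
        \<le> (1 - \<alpha> * \<delta>) * (line_dist z w powr \<alpha> * exp (- \<alpha> * (v y z + v y w)))"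
    by (rule line_dist_contraction[OF c e drift]) (rule that)
  have \<delta>: "0 < \<delta>" and v: "\<And>y z. z \<noteq> 0 \<Longrightarrow> \<bar>v y z\<bar> \<le> M"
    using drift by (auto simp: uniform_drift_def)
  have per: "circle_periodic c" by (rule circle_lipschitz_periodic[OF L])
  have M: "0 \<le> M" using v[of 1 0] by simp
  define W where "W y z w = line_dist z w powr \<alpha> * exp (- \<alpha> * (v y z + v y w))" for y z w
  define K1 where "K1 = 3 * (1 + B) ^ 4 * 2 * exp (2 * M)"
  \<comment> \<open>The solution of \<open>K = K1 + K * (1 - \<alpha> * \<delta>)\<close>, the
    recursion met in the induction.\<close>
  define K where "K = K1 / (\<alpha> * \<delta>)"
  have K1: "0 \<le> K1" using e by (simp add: K1_def)
  have K: "0 \<le> K" using K1 \<alpha> \<delta> by (simp add: K_def)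
  have vv: "\<alpha> * (v y z + v y w) \<le> 2 * M" "- (2 * M) \<le> \<alpha> * (v y z + v y w)" if "z \<noteq> 0" "w \<noteq> 0" for y z w
  proof -
    have "\<bar>\<alpha> * (v y z + v y w)\<bar> = \<alpha> * \<bar>v y z + v y w\<bar>" using \<alpha> by (simp add: abs_mult)
    also have "\<dots> \<le> 1 * (2 * M)" using v[OF that(1), of y] v[OF that(2), of y] \<alpha> by (intro mult_mono) auto
    finally show "\<alpha> * (v y z + v y w) \<le> 2 * M" "- (2 * M) \<le> \<alpha> * (v y z + v y w)" by auto
  qed
  have one: "cmod (hstep_log e (c t) z - hstep_log e (c t) w) \<le> K1 * W y z w" if "z \<noteq> 0" "w \<noteq> 0" for t y z w
  proof -
    let ?d = "line_dist z w"
    \<comment> \<open>The distance is at most 2, so its power \<open>1 - \<alpha>\<close> is at most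
      2 as well.\<close>
    have d: "?d \<le> 2 * ?d powr \<alpha>"
    proof (cases "?d = 0")
      case False
      then have "0 < ?d" using line_dist_nonneg[of z w] by linarith
      then have "?d = ?d powr (1 - \<alpha>) * ?d powr \<alpha>" by (simp flip: powr_add)
      have "?d powr (1 - \<alpha>) \<le> 2 powr (1 - \<alpha>)"
        using line_dist_le_2[of z w] \<alpha> by (intro powr_mono2) auto
      moreover have "2 powr (1 - \<alpha>) \<le> 2 powr (1::real)" using \<alpha> by (intro powr_mono) auto
      ultimately have "?d powr (1 - \<alpha>) \<le> 2" by simp
      then have "?d powr (1 - \<alpha>) * ?d powr \<alpha> \<le> 2 * ?d powr \<alpha>" by (rule mult_right_mono) simp
      then show ?thesis using \<open>?d = ?d powr (1 - \<alpha>) * ?d powr \<alpha>\<close> by linarith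
    qed auto
    have "?d powr \<alpha> = W y z w * exp (\<alpha> * (v y z + v y w))"
      by (simp add: W_def flip: exp_add)
    also have "\<dots> \<le> W y z w * exp (2 * M)"
      using vv(1)[OF that, of y] by (intro mult_left_mono) (auto simp: W_def)
    finally have d': "?d powr \<alpha> \<le> W y z w * exp (2 * M)" .
    have "cmod (hstep_log e (c t) z - hstep_log e (c t) w) \<le> 3 * (1 + B) ^ 4 * ?d"
      using hstep_log_lipschitz[of z w e B e "c t" "c t"] that e c[of t] by simp
    also have "\<dots> \<le> 3 * (1 + B) ^ 4 * (2 * (W y z w * exp (2 * M)))"
      using d d' e by (intro mult_left_mono) auto
    finally show ?thesis by (simp add: K1_def mult_ac)
  qed
  have main: "(branch_avg ^^ n) (\<lambda>x. cmod (log_cocycle e c n x z - log_cocycle e c n x w)) y \<le> K * W y z w"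
    if "z \<noteq> 0" "w \<noteq> 0" for n y z w
    using that
  proof (induction n arbitrary: y z w)
    case 0
    show ?case using K by (simp add: W_def)
  next
    case (Suc n)
    define h where "h t x = cmod (hstep_log e (c t) z + log_cocycle e c n x (hstep e (c t) z)
        - (hstep_log e (c t) w + log_cocycle e c n x (hstep e (c t) w)))" for t x
    have "circle_periodic (\<lambda>t. h t x)" for x
      using per by (simp add: h_def circle_periodic_def)
    then have "(branch_avg ^^ Suc n) (\<lambda>x. cmod (log_cocycle e c (Suc n) x z - log_cocycle e c (Suc n) x w)) y
        = branch_avg (\<lambda>t. (branch_avg ^^ n) (h t) t) y"
      using branch_iter_Suc_pullback[where h = h and n = n and y = y] by (simp add: h_def)
    also have "\<dots> \<le> branch_avg (\<lambda>t. K1 * W y z w + K * W t (hstep e (c t) z) (hstep e (c t) w)) y"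
    proof (rule branch_avg_mono)
      fix t
      have "(branch_avg ^^ n) (h t) t \<le> (branch_avg ^^ n) (\<lambda>x. K1 * W y z w +
          cmod (log_cocycle e c n x (hstep e (c t) z) - log_cocycle e c n x (hstep e (c t) w))) t"
      proof (rule branch_iter_mono)
        fix x
        have "h t x \<le> cmod (hstep_log e (c t) z - hstep_log e (c t) w) +
            cmod (log_cocycle e c n x (hstep e (c t) z) - log_cocycle e c n x (hstep e (c t) w))"
          unfolding h_def by (rule norm_diff_triangle_ineq)
        then show "h t x \<le> K1 * W y z w +
            cmod (log_cocycle e c n x (hstep e (c t) z) - log_cocycle e c n x (hstep e (c t) w))"
          using one[OF Suc.prems, of t y] by linarith
      qed
      also have "\<dots> \<le> K1 * W y z w + K * W t (hstep e (c t) z) (hstep e (c t) w)"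
        unfolding branch_iter_add branch_iter_const using Suc by simp
      finally show "(branch_avg ^^ n) (h t) t \<le> K1 * W y z w + K * W t (hstep e (c t) z) (hstep e (c t) w)" .
    qed
    also have "\<dots> = K1 * W y z w + K * branch_avg (\<lambda>t. W t (hstep e (c t) z) (hstep e (c t) w)) y"
      by (simp only: branch_avg_simps)
    also have "\<dots> \<le> K1 * W y z w + K * ((1 - \<alpha> * \<delta>) * W y z w)"
      using contr[OF Suc.prems, of y] K by (intro add_left_mono mult_left_mono) (auto simp: W_def)
    also have "\<dots> = (K1 + K - K * (\<alpha> * \<delta>)) * W y z w" by (simp add: algebra_simps)
    also have "K1 + K - K * (\<alpha> * \<delta>) = K" using \<alpha> \<delta> by (simp add: K_def)
    finally show ?case .
  qed
  show thesis
  proof (rule that[OF \<alpha>, of "K * exp (2 * M)"])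
    show "0 \<le> K * exp (2 * M)" using K by simp
    fix n y and z w :: complex assume zw: "z \<noteq> 0" "w \<noteq> 0"
    have "W y z w \<le> line_dist z w powr \<alpha> * exp (2 * M)"
      unfolding W_def using vv(2)[OF zw, of y] by (intro mult_left_mono) auto
    then have "K * W y z w \<le> K * (line_dist z w powr \<alpha> * exp (2 * M))"
      using K by (rule mult_left_mono)
    then show "(branch_avg ^^ n) (\<lambda>x. cmod (log_cocycle e c n x z - log_cocycle e c n x w)) y
        \<le> K * exp (2 * M) * line_dist z w powr \<alpha>"
      using main[OF zw, of n y] by (simp add: mult_ac)
  qed
qed

text \<open>Switching the energy in one step causes a direct error and a nearby new direction. The
  cocycle at \<open>e\<close> forgets the change of direction by \<open>contr\<close>, and the
  induction continues from the new direction. Every step thus costs the same multiple of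
  \<open>\<bar>e - e'\<bar> powr \<alpha>\<close>, and the multiple does not involve
  \<open>e'\<close>.\<close>

lemma branch_iter_log_cocycle_holder:
  assumes L: "circle_lipschitz L c" and c: "\<And>x. 0 \<le> c x" "\<And>x. c x \<le> B" and e: "0 \<le> e" "e \<le> B"
    and \<alpha>: "0 < \<alpha>" "\<alpha> < 1" and K: "0 \<le> K"
    and contr: "\<And>n y z w. z \<noteq> 0 \<Longrightarrow> w \<noteq> 0 \<Longrightarrow>
      (branch_avg ^^ n) (\<lambda>x. cmod (log_cocycle e c n x z - log_cocycle e c n x w)) y \<le> K * line_dist z w powr \<alpha>"
    and e': "0 \<le> e'" "e' \<le> B" "\<bar>e - e'\<bar> \<le> 1" and z: "z \<noteq> 0"
  shows "cmod ((branch_avg ^^ n) (\<lambda>x. log_cocycle e c n x z - log_cocycle e' c n x z) y)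
    \<le> real n * ((3 * (1 + B) ^ 4 + K * (2 * (1 + B) ^ 4) powr \<alpha>) * \<bar>e - e'\<bar> powr \<alpha>)"
  using z
proof (induction n arbitrary: y z)
  case 0
  show ?case by simp
next
  case (Suc n)
  define C where "C = (3 * (1 + B) ^ 4 + K * (2 * (1 + B) ^ 4) powr \<alpha>) * \<bar>e - e'\<bar> powr \<alpha>"
  have per: "circle_periodic c" by (rule circle_lipschitz_periodic[OF L])
  define h where "h t x = hstep_log e (c t) z + log_cocycle e c n x (hstep e (c t) z)
      - (hstep_log e' (c t) z + log_cocycle e' c n x (hstep e' (c t) z))" for t x
  have "circle_periodic (\<lambda>t. h t x)" for x
    using per by (simp add: h_def circle_periodic_def)
  then have eq: "(branch_avg ^^ Suc n) (\<lambda>x. log_cocycle e c (Suc n) x z - log_cocycle e' c (Suc n) x z) y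
      = branch_avg (\<lambda>t. (branch_avg ^^ n) (h t) t) y"
    using branch_iter_Suc_pullback[where h = h and n = n and y = y] by (simp add: h_def)
  have "cmod ((branch_avg ^^ n) (h t) t) \<le> C + real n * C" for t
  proof -
    let ?z = "hstep e (c t) z" and ?w = "hstep e' (c t) z"
    \<comment> \<open>Three differences: the step itself, the cocycle at \<open>e\<close> from two
      directions, and the two energies from a common direction.\<close>
    have h: "h t = (\<lambda>x. (hstep_log e (c t) z - hstep_log e' (c t) z) +
        ((log_cocycle e c n x ?z - log_cocycle e c n x ?w) + (log_cocycle e c n x ?w - log_cocycle e' c n x ?w)))"
      by (simp add: h_def fun_eq_iff)
    have 1: "cmod (hstep_log e (c t) z - hstep_log e' (c t) z) \<le> 3 * (1 + B) ^ 4 * \<bar>e - e'\<bar> powr \<alpha>"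
    proof -
      have "cmod (hstep_log e (c t) z - hstep_log e' (c t) z) \<le> 3 * (1 + B) ^ 4 * \<bar>e - e'\<bar>"
        using hstep_log_lipschitz[of z z e B e' "c t" "c t"] Suc.prems e e' c[of t]
        by (simp add: line_dist_def)
      also have "\<bar>e - e'\<bar> \<le> \<bar>e - e'\<bar> powr \<alpha>"
        using e'(3) \<alpha> powr_mono'[of \<alpha> 1 "\<bar>e - e'\<bar>"] by (cases "e = e'") auto
      finally show ?thesis using e by (simp add: mult_left_mono)
    qed
    have 2: "cmod ((branch_avg ^^ n) (\<lambda>x. log_cocycle e c n x ?z - log_cocycle e c n x ?w) t)
        \<le> K * ((2 * (1 + B) ^ 4) powr \<alpha> * \<bar>e - e'\<bar> powr \<alpha>)"
    proof -
      have "cmod ((branch_avg ^^ n) (\<lambda>x. log_cocycle e c n x ?z - log_cocycle e c n x ?w) t)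
          \<le> K * line_dist ?z ?w powr \<alpha>"
        using norm_branch_iter[of n "\<lambda>x. log_cocycle e c n x ?z - log_cocycle e c n x ?w" t]
          contr[of ?z ?w n t] Suc.prems by simp
      also have "line_dist ?z ?w \<le> 2 * (1 + B) ^ 4 * \<bar>e - e'\<bar>"
        using line_dist_hstep[of z z e B e' "c t" "c t"] Suc.prems e e' c[of t]
        by (simp add: line_dist_def)
      then have "line_dist ?z ?w powr \<alpha> \<le> (2 * (1 + B) ^ 4 * \<bar>e - e'\<bar>) powr \<alpha>"
        using \<alpha> by (intro powr_mono2) auto
      also have "\<dots> = (2 * (1 + B) ^ 4) powr \<alpha> * \<bar>e - e'\<bar> powr \<alpha>"
        using e by (simp add: powr_mult)
      finally show ?thesis using K by (simp add: mult_left_mono)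
    qed
    have 3: "cmod ((branch_avg ^^ n) (\<lambda>x. log_cocycle e c n x ?w - log_cocycle e' c n x ?w) t) \<le> real n * C"
      unfolding C_def using Suc by simp
    have "cmod ((branch_avg ^^ n) (h t) t) \<le> cmod (hstep_log e (c t) z - hstep_log e' (c t) z)
        + (cmod ((branch_avg ^^ n) (\<lambda>x. log_cocycle e c n x ?z - log_cocycle e c n x ?w) t)
         + cmod ((branch_avg ^^ n) (\<lambda>x. log_cocycle e c n x ?w - log_cocycle e' c n x ?w) t))"
      unfolding h branch_iter_add branch_iter_const
      by (intro order_trans[OF norm_triangle_ineq] add_left_mono norm_triangle_ineq)
    then show ?thesis using 1 2 3 by (simp add: C_def algebra_simps)
  qed
  then have "branch_avg (\<lambda>t. cmod ((branch_avg ^^ n) (h t) t)) y \<le> branch_avg (\<lambda>t. C + real n * C) y"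
    by (rule branch_avg_mono)
  then have "cmod (branch_avg (\<lambda>t. (branch_avg ^^ n) (h t) t) y) \<le> C + real n * C"
    using norm_branch_iter[of 1 "\<lambda>t. (branch_avg ^^ n) (h t) t" y] by (simp only: branch_avg_simps) simp
  then show ?case unfolding eq C_def[symmetric] by (simp add: algebra_simps)
qed

lemma continuous_log_cocycle:
  assumes "circle_lipschitz L c" "\<And>x. 0 \<le> c x" "\<And>x. c x \<le> B" "0 \<le> e" "e \<le> B" "z \<noteq> 0"
  shows "continuous_on S (\<lambda>x. log_cocycle e c n x z)"
proof -
  obtain K where K: "0 \<le> K" "\<And>e e' x x' z w. 0 \<le> e \<Longrightarrow> e \<le> B \<Longrightarrow> 0 \<le> e' \<Longrightarrow> e' \<le> B \<Longrightarrow> z \<noteq> 0 \<Longrightarrow> w \<noteq> 0 \<Longrightarrow>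
    cmod (log_cocycle e c n x z - log_cocycle e' c n x' w) \<le> K * (\<bar>e - e'\<bar> + \<bar>x - x'\<bar> + line_dist z w)"
    using log_cocycle_lipschitz[OF assms(1-3)] by blast
  have "K-lipschitz_on S (\<lambda>x. log_cocycle e c n x z)"
    using K(2)[of e e z z] K(1) assms by (intro lipschitz_onI) (auto simp: dist_norm line_dist_def)
  then show ?thesis by (rule lipschitz_on_continuous_on)
qed

text \<open>Invariance of the mean under \<open>branch_avg\<close> turns the estimates over
  preimages into estimates of means. The bound for two vectors will compare the norm of a matrix
  with the growth of a single vector; the real and imaginary parts lead to the Lyapunov exponent and
  to the density of states.\<close>

theorem circle_mean_log_cocycle_holder:
  assumes L: "circle_lipschitz L c" and c: "\<And>x. 0 \<le> c x" "\<And>x. c x \<le> B" and e: "0 \<le> e" "e \<le> B"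
    and drift: "uniform_drift e c \<delta> M v"
  obtains \<alpha> K where "0 < \<alpha>" "\<alpha> < 1" "0 \<le> K"
    "\<And>n z w. z \<noteq> 0 \<Longrightarrow> w \<noteq> 0 \<Longrightarrow> circle_mean (\<lambda>x. cmod (log_cocycle e c n x z - log_cocycle e c n x w)) \<le> K"
    "\<And>n z e'. z \<noteq> 0 \<Longrightarrow> 0 \<le> e' \<Longrightarrow> e' \<le> B \<Longrightarrow> \<bar>e - e'\<bar> \<le> 1 \<Longrightarrow>
      \<bar>circle_mean (\<lambda>x. Re (log_cocycle e c n x z)) - circle_mean (\<lambda>x. Re (log_cocycle e' c n x z))\<bar>
        \<le> real n * (K * \<bar>e - e'\<bar> powr \<alpha>)"
    "\<And>n z e'. z \<noteq> 0 \<Longrightarrow> 0 \<le> e' \<Longrightarrow> e' \<le> B \<Longrightarrow> \<bar>e - e'\<bar> \<le> 1 \<Longrightarrow>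
      \<bar>circle_mean (\<lambda>x. Im (log_cocycle e c n x z)) - circle_mean (\<lambda>x. Im (log_cocycle e' c n x z))\<bar>
        \<le> real n * (K * \<bar>e - e'\<bar> powr \<alpha>)"
proof -
  obtain \<alpha> K where \<alpha>: "0 < \<alpha>" "\<alpha> < 1" and K: "0 \<le> K" and contr: "\<And>n y z w. z \<noteq> 0 \<Longrightarrow> w \<noteq> 0 \<Longrightarrow>
      (branch_avg ^^ n) (\<lambda>x. cmod (log_cocycle e c n x z - log_cocycle e c n x w)) y \<le> K * line_dist z w powr \<alpha>"
    by (rule branch_iter_log_cocycle_diff[OF L c e drift]) (rule that)
  define K2 where "K2 = 3 * (1 + B) ^ 4 + K * (2 * (1 + B) ^ 4) powr \<alpha>"
  have K2: "0 \<le> K2" using e K by (simp add: K2_def)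
  have cont: "continuous_on UNIV (\<lambda>x. log_cocycle e' c n x z)" if "0 \<le> e'" "e' \<le> B" "z \<noteq> 0" for e' n z
    using continuous_log_cocycle[OF L c that] .
  show thesis
  proof (rule that[OF \<alpha>, of "2 * K + K2"])
    show "0 \<le> 2 * K + K2" using K K2 by simp
    fix n :: nat and z :: complex assume z: "z \<noteq> 0"
    {
      fix w :: complex assume w: "w \<noteq> 0"
      let ?f = "\<lambda>x. cmod (log_cocycle e c n x z - log_cocycle e c n x w)"
      have cf: "continuous_on UNIV ?f" by (intro continuous_intros cont e z w)
      have "circle_mean ?f = circle_mean ((branch_avg ^^ n) ?f)" by (simp add: circle_mean_branch_iter[OF cf])
      also have "\<dots> \<le> circle_mean (\<lambda>y. K * line_dist z w powr \<alpha>)"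
        by (intro circle_mean_mono continuous_branch_iter cf contr z w continuous_on_const)
      also have "\<dots> \<le> K * 2"
      proof -
        have "line_dist z w powr \<alpha> \<le> 2 powr \<alpha>" using line_dist_le_2 \<alpha> by (intro powr_mono2) auto
        also have "2 powr \<alpha> \<le> 2 powr (1::real)" using \<alpha> by (intro powr_mono) auto
        finally show ?thesis using K by (simp add: mult_left_mono)
      qed
      finally show "circle_mean ?f \<le> 2 * K + K2" using K2 by simp
    }
    fix e' assume e': "0 \<le> e'" "e' \<le> B" "\<bar>e - e'\<bar> \<le> 1"
    let ?D = "\<lambda>x. log_cocycle e c n x z - log_cocycle e' c n x z"
    have le: "cmod ((branch_avg ^^ n) ?D y) \<le> real n * (K2 * \<bar>e - e'\<bar> powr \<alpha>)" for y
      using branch_iter_log_cocycle_holder[OF L c e \<alpha> K contr e' z] unfolding K2_def .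
    have mono: "real n * (K2 * \<bar>e - e'\<bar> powr \<alpha>) \<le> real n * ((2 * K + K2) * \<bar>e - e'\<bar> powr \<alpha>)"
      using K by (intro mult_left_mono mult_right_mono) auto
    have cRe: "continuous_on UNIV (\<lambda>x. Re (?D x))" and cIm: "continuous_on UNIV (\<lambda>x. Im (?D x))"
      by (intro continuous_intros cont e e' z)+
    have "circle_mean (\<lambda>x. Re (log_cocycle e c n x z)) - circle_mean (\<lambda>x. Re (log_cocycle e' c n x z))
        = circle_mean (\<lambda>x. Re (?D x))"
      unfolding minus_complex.sel by (intro circle_mean_diff[symmetric] continuous_intros cont e e' z)
    also have "\<dots> = circle_mean ((branch_avg ^^ n) (\<lambda>x. Re (?D x)))"
      by (rule circle_mean_branch_iter[OF cRe, symmetric])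
    also have "\<bar>\<dots>\<bar> \<le> real n * (K2 * \<bar>e - e'\<bar> powr \<alpha>)"
      using order_trans[OF abs_Re_le_cmod le]
      by (intro abs_circle_mean_le continuous_branch_iter cRe) (simp only: branch_iter_Re)
    finally show "\<bar>circle_mean (\<lambda>x. Re (log_cocycle e c n x z)) - circle_mean (\<lambda>x. Re (log_cocycle e' c n x z))\<bar>
        \<le> real n * ((2 * K + K2) * \<bar>e - e'\<bar> powr \<alpha>)" using mono by linarith
    have "circle_mean (\<lambda>x. Im (log_cocycle e c n x z)) - circle_mean (\<lambda>x. Im (log_cocycle e' c n x z))
        = circle_mean (\<lambda>x. Im (?D x))"
      unfolding minus_complex.sel by (intro circle_mean_diff[symmetric] continuous_intros cont e e' z)
    also have "\<dots> = circle_mean ((branch_avg ^^ n) (\<lambda>x. Im (?D x)))"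
      by (rule circle_mean_branch_iter[OF cIm, symmetric])
    also have "\<bar>\<dots>\<bar> \<le> real n * (K2 * \<bar>e - e'\<bar> powr \<alpha>)"
      using order_trans[OF abs_Im_le_cmod le]
      by (intro abs_circle_mean_le continuous_branch_iter cIm) (simp only: branch_iter_Im)
    finally show "\<bar>circle_mean (\<lambda>x. Im (log_cocycle e c n x z)) - circle_mean (\<lambda>x. Im (log_cocycle e' c n x z))\<bar>
        \<le> real n * ((2 * K + K2) * \<bar>e - e'\<bar> powr \<alpha>)" using mono by linarith
  qed
qed

subsection \<open>The drift at small energy\<close>

text \<open>The remainder has derivative \<open>z\<^sup>2 / (1 + z)\<close>, of modulus at most
  \<open>2 * (cmod w)\<^sup>2\<close> on the disc of radius \<open>cmod w\<close>.\<close>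

lemma Ln_remainder_cubic:
  assumes "cmod w \<le> 1 / 2"
  shows "cmod (Ln (1 + w) - w + w\<^sup>2 / 2) \<le> 2 * cmod w ^ 3"
proof -
  define f where "f z = Ln (1 + z) - z + z\<^sup>2 / 2" for z :: complex
  have "cmod (f w - f 0) \<le> (2 * (cmod w)\<^sup>2) * cmod (w - 0)"
  proof (rule field_differentiable_bound[where S = "cball 0 (cmod w)" and f' = "\<lambda>z. z\<^sup>2 / (1 + z)"])
    fix z :: complex assume "z \<in> cball 0 (cmod w)"
    then have z: "cmod z \<le> cmod w" "cmod z \<le> 1 / 2" using assms by (auto simp: dist_norm)
    then have R: "0 < Re (1 + z)" using abs_Re_le_cmod[of z] by (simp add: abs_le_iff)
    then have np: "1 + z \<notin> \<real>\<^sub>\<le>\<^sub>0" and nz: "1 + z \<noteq> 0" by (auto simp: complex_nonpos_Reals_iff complex_eq_iff)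
    have "(f has_field_derivative (1 / (1 + z) - 1 + z)) (at z)"
      unfolding f_def using np by (auto intro!: derivative_eq_intros simp: power2_eq_square inverse_eq_divide)
    moreover have "1 / (1 + z) - 1 + z = z\<^sup>2 / (1 + z)"
      using nz by (simp add: field_simps power2_eq_square)
    ultimately show "(f has_field_derivative z\<^sup>2 / (1 + z)) (at z within cball 0 (cmod w))"
      by (metis has_field_derivative_at_within)
    have "1 / 2 \<le> cmod (1 + z)" using norm_triangle_ineq2[of 1 "- z"] z by simp
    then have "cmod (z\<^sup>2 / (1 + z)) \<le> (cmod z)\<^sup>2 / (1 / 2)"
      unfolding norm_divide norm_power by (intro divide_left_mono) auto
    also have "\<dots> \<le> 2 * (cmod w)\<^sup>2" using z by (simp add: power_mono)
    finally show "cmod (z\<^sup>2 / (1 + z)) \<le> 2 * (cmod w)\<^sup>2" .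
  qed auto
  then show ?thesis by (simp add: f_def power2_eq_square power3_eq_cube)
qed

text \<open>Plays the role of \<open>O(1)\<close>, uniformly over all data of a step. The index will
  be a triple of scale, base point and vector, so remainders can be handled without naming
  constants.\<close>

definition bounded_fun_on :: "'i set \<Rightarrow> ('i \<Rightarrow> complex) \<Rightarrow> bool" where
  "bounded_fun_on S f \<longleftrightarrow> (\<exists>C. \<forall>p\<in>S. cmod (f p) \<le> C)"

lemma bounded_fun_onI: "(\<And>p. p \<in> S \<Longrightarrow> cmod (f p) \<le> C) \<Longrightarrow> bounded_fun_on S f"
  by (auto simp: bounded_fun_on_def)

lemma bounded_fun_on_const [intro]: "bounded_fun_on S (\<lambda>p. c)"
  by (rule bounded_fun_onI[where C = "cmod c"]) simp

lemma bounded_fun_on_add: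
  assumes "bounded_fun_on S f" "bounded_fun_on S g" shows "bounded_fun_on S (\<lambda>p. f p + g p)"
proof -
  obtain C C' where "\<And>p. p \<in> S \<Longrightarrow> cmod (f p) \<le> C" "\<And>p. p \<in> S \<Longrightarrow> cmod (g p) \<le> C'"
    using assms by (auto simp: bounded_fun_on_def)
  then show ?thesis
    by (intro bounded_fun_onI[where C = "C + C'"]) (meson add_mono norm_triangle_ineq order_trans)
qed

lemma bounded_fun_on_mult:
  assumes "bounded_fun_on S f" "bounded_fun_on S g" shows "bounded_fun_on S (\<lambda>p. f p * g p)"
proof -
  obtain C C' where C: "\<And>p. p \<in> S \<Longrightarrow> cmod (f p) \<le> C" "\<And>p. p \<in> S \<Longrightarrow> cmod (g p) \<le> C'"
    using assms by (auto simp: bounded_fun_on_def)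
  show ?thesis
  proof (rule bounded_fun_onI)
    fix p assume "p \<in> S"
    from C(1)[OF this] C(2)[OF this] show "cmod (f p * g p) \<le> C * C'"
      unfolding norm_mult by (intro mult_mono) (auto intro: order_trans[OF norm_ge_zero])
  qed
qed

lemma bounded_fun_on_uminus: "bounded_fun_on S f \<Longrightarrow> bounded_fun_on S (\<lambda>p. - f p)"
  by (simp add: bounded_fun_on_def)

lemma bounded_fun_on_diff:
  "bounded_fun_on S f \<Longrightarrow> bounded_fun_on S g \<Longrightarrow> bounded_fun_on S (\<lambda>p. f p - g p)"
  using bounded_fun_on_add[of S f "\<lambda>p. - g p"] bounded_fun_on_uminus[of S g] by simp

lemma bounded_fun_on_power:
  "bounded_fun_on S f \<Longrightarrow> bounded_fun_on S (\<lambda>p. f p ^ n)"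
  by (induction n) (auto intro: bounded_fun_on_mult)

lemma bounded_fun_on_inverse:
  assumes "\<And>p. p \<in> S \<Longrightarrow> cmod (w p) \<le> 1 / 2" shows "bounded_fun_on S (\<lambda>p. inverse (1 + w p))"
proof (rule bounded_fun_onI[where C = 2])
  fix p assume "p \<in> S"
  then have "1 / 2 \<le> cmod (1 + w p)"
    using norm_triangle_ineq2[of 1 "- w p"] assms by fastforce
  then show "cmod (inverse (1 + w p)) \<le> 2"
    unfolding norm_inverse using le_imp_inverse_le[of "1 / 2"] by simp
qed

lemmas bounded_fun_on_intros = bounded_fun_on_const bounded_fun_on_add bounded_fun_on_mult
  bounded_fun_on_uminus bounded_fun_on_diff bounded_fun_on_power

text \<open>
  Second-order expansion in the small parameter \<open>h\<close> of one step, in the projective coordinate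
  \<open>\<zeta> = cnj z / z\<close>. The terms with \<open>g\<close>, \<open>D\<close> and \<open>k0, \<dots>, k3\<close> belong to the corrector that is added to
  the logarithm of the norm.
\<close>

lemma step_expansion:
  fixes h q g k0 k1 k2 k3 \<zeta> \<zeta>1 \<zeta>2 w1 w2 :: "'i \<Rightarrow> complex" and A D :: complex
  assumes bd: "bounded_fun_on S h" "bounded_fun_on S q" "bounded_fun_on S g" "bounded_fun_on S \<zeta>"
      "bounded_fun_on S \<zeta>1" "bounded_fun_on S k0" "bounded_fun_on S k1" "bounded_fun_on S k2" "bounded_fun_on S k3"
    and h: "\<And>p. p \<in> S \<Longrightarrow> h p \<noteq> 0"
    and w1: "\<And>p. p \<in> S \<Longrightarrow> w1 p = h p * (\<i> / 2 * (1 - \<zeta> p))" "\<And>p. p \<in> S \<Longrightarrow> cmod (w1 p) \<le> 1 / 2"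
    and \<zeta>1: "\<And>p. p \<in> S \<Longrightarrow> \<zeta>1 p * (1 + w1 p) = \<zeta> p + w1 p"
    and w2: "\<And>p. p \<in> S \<Longrightarrow> w2 p = h p * (\<i> / 2 * (1 + q p) * (1 + \<zeta>1 p))" "\<And>p. p \<in> S \<Longrightarrow> cmod (w2 p) \<le> 1 / 2"
    and \<zeta>2: "\<And>p. p \<in> S \<Longrightarrow> \<zeta>2 p * (1 + w2 p) = \<zeta>1 p - w2 p"
  obtains X where "bounded_fun_on S X" "\<And>p. p \<in> S \<Longrightarrow>
    Ln (1 + w1 p) + Ln (1 + w2 p) + h p * (\<i> / 2 * (g p - A) * \<zeta>2 p - \<i> * D / 4 * (\<zeta>2 p)\<^sup>2)
      + (h p)\<^sup>2 * (k0 p + k1 p * \<zeta>2 p + k2 p * (\<zeta>2 p)\<^sup>2 + k3 p * \<zeta>2 p ^ 3)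
    = h p * (\<i> / 2 * (2 + q p) + \<i> / 2 * (q p + g p - A) * \<zeta> p - \<i> * D / 4 * (\<zeta> p)\<^sup>2)
      + (h p)\<^sup>2 * ((k0 p + ((q p)\<^sup>2 / 8 + (g p - A) * q p / 4))
        + (k1 p + (1 / 2 + q p + (q p)\<^sup>2 / 4 + (g p - A) * (1 + q p / 2) - D * q p / 4)) * \<zeta> p
        + (k2 p + ((q p)\<^sup>2 / 8 + (g p - A) * q p / 4 - D * (1 + q p / 2))) * (\<zeta> p)\<^sup>2
        + (k3 p + - D * q p / 4) * \<zeta> p ^ 3)
      + h p ^ 3 * X p"
proof -
  define j where "j = \<i> / 2"
  \<comment> \<open>\<open>W1\<close> and \<open>W2\<close> are \<open>w1\<close> and
    \<open>w2\<close> divided by \<open>h\<close>; \<open>W20\<close> is \<open>W2\<close> with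
    \<open>\<zeta>1\<close> replaced by the initial \<zeta>.\<close>
  define W1 W20 W2 where "W1 p =j * (1 - \<zeta> p)" and "W20 p =j * (1 + q p) * (1 + \<zeta> p)"
    and "W2 p =j * (1 + q p) * (1 + \<zeta>1 p)" for p
  \<comment> \<open>\<open>h p * D1 p\<close> is the exact increment of the coordinate in the first
    shear; \<open>R1\<close> and \<open>R2\<close> come from the remainders of the geometric series
    for the two denominators.\<close>
  define D1 R1 R2 where "D1 p = W1 p * (1 - \<zeta> p) * inverse (1 + w1 p)"
    and "R1 p = - (W1 p)\<^sup>2 * (1 - \<zeta> p) * inverse (1 + w1 p)"
    and "R2 p = (W2 p)\<^sup>2 * (1 + \<zeta>1 p) * inverse (1 + w2 p)" for p
  define l1 l2 where "l1 p = (Ln (1 + w1 p) - w1 p + (w1 p)\<^sup>2 / 2) / h p ^ 3"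
    and "l2 p = (Ln (1 + w2 p) - w2 p + (w2 p)\<^sup>2 / 2) / h p ^ 3" for p
  have inv: "bounded_fun_on S (\<lambda>p. inverse (1 + w1 p))" "bounded_fun_on S (\<lambda>p. inverse (1 + w2 p))"
    using w1(2) w2(2) by (blast intro: bounded_fun_on_inverse)+
  have bW: "bounded_fun_on S W1" "bounded_fun_on S W20" "bounded_fun_on S W2"
    unfolding W1_def W20_def W2_def by (intro bounded_fun_on_intros bd)+
  have bDR: "bounded_fun_on S D1" "bounded_fun_on S R1" "bounded_fun_on S R2"
    unfolding D1_def R1_def R2_def by (intro bounded_fun_on_intros bd bW inv)+
  have bl: "bounded_fun_on S (\<lambda>p. (Ln (1 + w p) - w p + (w p)\<^sup>2 / 2) / h p ^ 3)"
    if w: "\<And>p. p \<in> S \<Longrightarrow> w p = h p * W p" "\<And>p. p \<in> S \<Longrightarrow> cmod (w p) \<le> 1 / 2" and W: "bounded_fun_on S W" for w W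
  proof -
    obtain C where C: "\<And>p. p \<in> S \<Longrightarrow> cmod (W p) \<le> C" using W by (auto simp: bounded_fun_on_def)
    show ?thesis
    proof (rule bounded_fun_onI)
      fix p assume p: "p \<in> S"
      have "cmod (Ln (1 + w p) - w p + (w p)\<^sup>2 / 2) \<le> 2 * (cmod (h p) ^ 3 * cmod (W p) ^ 3)"
        using Ln_remainder_cubic[OF w(2)[OF p]] w(1)[OF p] by (simp add: norm_mult power_mult_distrib)
      also have "\<dots> \<le> 2 * (cmod (h p) ^ 3 * C ^ 3)"
        using C[OF p] by (intro mult_left_mono power_mono) auto
      finally show "cmod ((Ln (1 + w p) - w p + (w p)\<^sup>2 / 2) / h p ^ 3) \<le> 2 * C ^ 3"
        using h[OF p] by (simp add: norm_divide norm_power divide_le_eq mult_ac)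
    qed
  qed
  have bL: "bounded_fun_on S l1" "bounded_fun_on S l2"
    unfolding l1_def l2_def
    by (rule bl[where W = W1], simp add: w1 W1_def j_def, rule w1(2), assumption, rule bW)
      (rule bl[where W = W2], simp add: w2 W2_def j_def, rule w2(2), assumption, rule bW)
  define T where "T p =j * (1 + q p) * D1 p * (W2 p + W20 p)" for p
  define R where "R p = R1 p + R2 p -j * (1 + q p) * D1 p * (2 + 2 * \<zeta> p + h p * D1 p)" for p
  \<comment> \<open>The velocity of the coordinate, to leading order. For \<open>q = 0\<close> it is
    \<open>- 2 * \<i> * \<zeta>\<close>, a rotation.\<close>
  define s where "s p = W1 p * (1 - \<zeta> p) - W20 p * (1 + \<zeta> p)" for p
  define U where "U p = s p + h p * R p" for p
  \<comment> \<open>Collects all terms with the factor \<open>h p ^ 3\<close>. The identities below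
    are exact, so the expansion is settled once \<open>X\<close> is bounded.\<close>
  define X where "X p = (j * (1 + q p) * R1 p - T p / 2 + l1 p + l2 p)
    + \<i> / 2 * (g p - A) * R p - \<i> * D / 4 * (2 * \<zeta> p * R p + (U p)\<^sup>2)
    + (k1 p * U p + k2 p * (U p * (2 * \<zeta> p + h p * U p))
      + k3 p * (U p * (3 * (\<zeta> p)\<^sup>2 + 3 * \<zeta> p * (h p * U p) + (h p * U p)\<^sup>2)))" for p
  have bR: "bounded_fun_on S R" "bounded_fun_on S T" "bounded_fun_on S s"
    unfolding R_def T_def s_def by (intro bounded_fun_on_intros bd bW bDR)+
  have bU: "bounded_fun_on S U" unfolding U_def by (intro bounded_fun_on_intros bd bR)
  have half: "bounded_fun_on S (\<lambda>p. f p / c)" if "bounded_fun_on S f" for f c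
    using bounded_fun_on_mult[OF that bounded_fun_on_const[of S "inverse c"]] by (simp add: divide_inverse)
  have bX: "bounded_fun_on S X"
    unfolding X_def by (intro bounded_fun_on_intros half bd bW bDR bL bR bU)
  show thesis
  proof (rule that[OF bX])
    fix p assume p: "p \<in> S"
    have "1 + w \<noteq> 0" if "cmod w \<le> 1 / 2" for w
      using norm_triangle_ineq2[of 1 "- w"] that by auto
    then have nz: "1 + w1 p \<noteq> 0" "1 + w2 p \<noteq> 0" using w1(2)[OF p] w2(2)[OF p] by blast+
    have hW: "w1 p = h p * W1 p" "w2 p = h p * W2 p"
      using w1(1)[OF p] w2(1)[OF p] by (auto simp: W1_def W2_def j_def)
    have d1: "\<zeta>1 p = \<zeta> p + h p * D1 p"
    proof -
      have "\<zeta>1 p = (\<zeta> p + w1 p) / (1 + w1 p)" using \<zeta>1[OF p] nz by (simp add: field_simps)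
      also have "\<dots> = \<zeta> p + w1 p * (1 - \<zeta> p) * inverse (1 + w1 p)" using nz by (simp add: field_simps)
      finally show ?thesis by (simp add: D1_def hW)
    qed
    have D1: "D1 p = W1 p * (1 - \<zeta> p) + h p * R1 p"
    proof -
      have "inverse (1 + w1 p) = 1 - w1 p * inverse (1 + w1 p)" using nz by (simp add: field_simps)
      then have "D1 p = W1 p * (1 - \<zeta> p) * (1 - w1 p * inverse (1 + w1 p))" unfolding D1_def by metis
      then show ?thesis by (simp add: R1_def hW power2_eq_square algebra_simps)
    qed
    have W2a: "W2 p = W20 p + h p * (j * (1 + q p) * D1 p)"
      unfolding W2_def W20_def d1 by (simp add: algebra_simps)
    have W2b: "W2 p = W20 p + h p * (j * (1 + q p) * (W1 p * (1 - \<zeta> p))) + (h p)\<^sup>2 * (j * (1 + q p) * R1 p)"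
      unfolding W2a unfolding D1 by (simp add: algebra_simps power2_eq_square)
    have W2sq: "(W2 p)\<^sup>2 = (W20 p)\<^sup>2 + h p * T p"
    proof -
      have "(W2 p)\<^sup>2 - (W20 p)\<^sup>2 = (W2 p - W20 p) * (W2 p + W20 p)" by (simp add: power2_eq_square algebra_simps)
      also have "W2 p - W20 p = h p * (j * (1 + q p) * D1 p)" unfolding W2a by simp
      finally show ?thesis by (simp add: T_def algebra_simps)
    qed
    have z2: "\<zeta>2 p = \<zeta> p + h p * U p"
    proof -
      have "\<zeta>2 p = (\<zeta>1 p - w2 p) / (1 + w2 p)" using \<zeta>2[OF p] nz by (simp add: field_simps)
      also have "\<dots> = \<zeta>1 p - w2 p * (1 + \<zeta>1 p) + (w2 p)\<^sup>2 * (1 + \<zeta>1 p) * inverse (1 + w2 p)"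
        using nz by (simp add: field_simps power2_eq_square)
      also have "\<dots> = \<zeta>1 p - h p * (W2 p * (1 + \<zeta>1 p)) + (h p)\<^sup>2 * R2 p"
        by (simp add: hW R2_def power_mult_distrib)
      also have "W2 p * (1 + \<zeta>1 p) = W20 p * (1 + \<zeta> p) + h p * (j * (1 + q p) * D1 p * (2 + 2 * \<zeta> p + h p * D1 p))"
        unfolding W2_def W20_def d1 by (simp add: algebra_simps)
      also have "\<zeta>1 p = \<zeta> p + h p * (W1 p * (1 - \<zeta> p)) + (h p)\<^sup>2 * R1 p"
        unfolding d1 unfolding D1 by (simp add: algebra_simps power2_eq_square)
      finally show ?thesis
        unfolding U_def s_def R_def by (simp add: algebra_simps power2_eq_square)
    qed
    have "Ln (1 + w1 p) = w1 p - (w1 p)\<^sup>2 / 2 + h p ^ 3 * l1 p"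
      "Ln (1 + w2 p) = w2 p - (w2 p)\<^sup>2 / 2 + h p ^ 3 * l2 p"
      using h[OF p] by (simp_all add: l1_def l2_def)
    then have "Ln (1 + w1 p) + Ln (1 + w2 p) =
        (w1 p - (w1 p)\<^sup>2 / 2 + h p ^ 3 * l1 p) + (w2 p - (w2 p)\<^sup>2 / 2 + h p ^ 3 * l2 p)"
      by (simp only:)
    also have "\<dots> = h p * W1 p + h p * W2 p - (h p)\<^sup>2 * (W1 p)\<^sup>2 / 2 - (h p)\<^sup>2 * (W2 p)\<^sup>2 / 2 + h p ^ 3 * (l1 p + l2 p)"
      unfolding hW by (simp add: power_mult_distrib algebra_simps)
    also have "\<dots> = h p * (W1 p + W20 p)
        + (h p)\<^sup>2 * (j * (1 + q p) * (W1 p * (1 - \<zeta> p)) - (W1 p)\<^sup>2 / 2 - (W20 p)\<^sup>2 / 2)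
        + h p ^ 3 * (j * (1 + q p) * R1 p - T p / 2 + l1 p + l2 p)"
      unfolding W2sq unfolding W2b by (simp add: algebra_simps power2_eq_square power3_eq_cube)
    finally have LL: "Ln (1 + w1 p) + Ln (1 + w2 p) = h p * (W1 p + W20 p)
        + (h p)\<^sup>2 * (j * (1 + q p) * (W1 p * (1 - \<zeta> p)) - (W1 p)\<^sup>2 / 2 - (W20 p)\<^sup>2 / 2)
        + h p ^ 3 * (j * (1 + q p) * R1 p - T p / 2 + l1 p + l2 p)" .
    have lin: "\<i> / 2 * (g p - A) * \<zeta>2 p - \<i> * D / 4 * (\<zeta>2 p)\<^sup>2 =
        (\<i> / 2 * (g p - A) * \<zeta> p - \<i> * D / 4 * (\<zeta> p)\<^sup>2)
        + h p * (\<i> / 2 * (g p - A) * s p - \<i> * D / 2 * \<zeta> p * s p)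
        + (h p)\<^sup>2 * (\<i> / 2 * (g p - A) * R p - \<i> * D / 4 * (2 * \<zeta> p * R p + (U p)\<^sup>2))"
    proof -
      have "(\<zeta> + h * U)\<^sup>2 = \<zeta>\<^sup>2 + h * (2 * \<zeta> * s) + h\<^sup>2 * (2 * \<zeta> * R + U\<^sup>2)" if "U = s + h * R" for \<zeta> h U s R :: complex
        by (simp add: that power2_eq_square algebra_simps)
      from this[of "U p" "s p" "h p" "R p" "\<zeta> p"] have "(\<zeta>2 p)\<^sup>2 = (\<zeta> p)\<^sup>2 + h p * (2 * \<zeta> p * s p) + (h p)\<^sup>2 * (2 * \<zeta> p * R p + (U p)\<^sup>2)"
        by (simp add: z2 U_def)
      moreover have "\<zeta>2 p = \<zeta> p + h p * s p + (h p)\<^sup>2 * R p"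
        by (simp add: z2 U_def algebra_simps power2_eq_square)
      moreover have "a * (\<zeta> + h * s + h\<^sup>2 * R) - b * (\<zeta>2 + h * (2 * \<zeta> * s) + h\<^sup>2 * T) =
        (a * \<zeta> - b * \<zeta>2) + h * (a * s - 2 * b * \<zeta> * s) + h\<^sup>2 * (a * R - b * T)" for a b h \<zeta> \<zeta>2 s R T :: complex
        by (simp add: algebra_simps)
      moreover have "2 * (\<i> * D / 4) * \<zeta> p * s p = \<i> * D / 2 * \<zeta> p * s p" by simp
      ultimately show ?thesis by (simp only:)
    qed
    have quad: "k0 p + k1 p * \<zeta>2 p + k2 p * (\<zeta>2 p)\<^sup>2 + k3 p * \<zeta>2 p ^ 3 =
        (k0 p + k1 p * \<zeta> p + k2 p * (\<zeta> p)\<^sup>2 + k3 p * \<zeta> p ^ 3)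
        + h p * (k1 p * U p + k2 p * (U p * (2 * \<zeta> p + h p * U p))
          + k3 p * (U p * (3 * (\<zeta> p)\<^sup>2 + 3 * \<zeta> p * (h p * U p) + (h p * U p)\<^sup>2)))"
      unfolding z2 by (simp add: power2_eq_square power3_eq_cube algebra_simps)
    have first: "W1 p + W20 p = \<i> / 2 * (2 + q p) + \<i> / 2 * q p * \<zeta> p"
      by (simp add: W1_def W20_def j_def field_simps)
    have second: "j * (1 + q p) * (W1 p * (1 - \<zeta> p)) - (W1 p)\<^sup>2 / 2 - (W20 p)\<^sup>2 / 2
        + (\<i> / 2 * (g p - A) * s p - \<i> * D / 2 * \<zeta> p * s p) =
        ((q p)\<^sup>2 / 8 + (g p - A) * q p / 4)
        + (1 / 2 + q p + (q p)\<^sup>2 / 4 + (g p - A) * (1 + q p / 2) - D * q p / 4) * \<zeta> p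
        + ((q p)\<^sup>2 / 8 + (g p - A) * q p / 4 - D * (1 + q p / 2)) * (\<zeta> p)\<^sup>2
        + (- D * q p / 4) * \<zeta> p ^ 3"
    proof -
      have jj: "j * j = - (1 / 4)" by (simp add: j_def)
      have ids: "\<i> / 2 = j" "\<i> * D / 2 = j * D" by (simp_all add: j_def)
      \<comment> \<open>The factor 8 clears denominators; \<open>j * j\<close> stays symbolic until
        its value \<open>- (1 / 4)\<close> is inserted.\<close>
      have "8 * (j * (1 + q) * (j * (1 - \<zeta>) * (1 - \<zeta>)) - (j * (1 - \<zeta>))\<^sup>2 / 2 - (j * (1 + q) * (1 + \<zeta>))\<^sup>2 / 2
          + (j * G * (j * (1 - \<zeta>) * (1 - \<zeta>) - j * (1 + q) * (1 + \<zeta>) * (1 + \<zeta>))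
            - j * D * \<zeta> * (j * (1 - \<zeta>) * (1 - \<zeta>) - j * (1 + q) * (1 + \<zeta>) * (1 + \<zeta>)))) =
        (j * j) * (4 * (2 * (1 + q) * (1 - \<zeta>)\<^sup>2 - (1 - \<zeta>)\<^sup>2 - (1 + q)\<^sup>2 * (1 + \<zeta>)\<^sup>2
          + 2 * (G - D * \<zeta>) * ((1 - \<zeta>)\<^sup>2 - (1 + q) * (1 + \<zeta>)\<^sup>2)))" for q \<zeta> G
        by (simp add: power2_eq_square field_simps)
      moreover have "(j * j) * (4 * (2 * (1 + q) * (1 - \<zeta>)\<^sup>2 - (1 - \<zeta>)\<^sup>2 - (1 + q)\<^sup>2 * (1 + \<zeta>)\<^sup>2
          + 2 * (G - D * \<zeta>) * ((1 - \<zeta>)\<^sup>2 - (1 + q) * (1 + \<zeta>)\<^sup>2))) =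
        8 * ((q\<^sup>2 / 8 + G * q / 4)
        + (1 / 2 + q + q\<^sup>2 / 4 + G * (1 + q / 2) - D * q / 4) * \<zeta>
        + (q\<^sup>2 / 8 + G * q / 4 - D * (1 + q / 2)) * \<zeta>\<^sup>2
        + (- D * q / 4) * \<zeta> ^ 3)" for q \<zeta> G
        unfolding jj by (simp add: field_simps power2_eq_square power3_eq_cube)
      ultimately have "8 * (j * (1 + q) * (j * (1 - \<zeta>) * (1 - \<zeta>)) - (j * (1 - \<zeta>))\<^sup>2 / 2 - (j * (1 + q) * (1 + \<zeta>))\<^sup>2 / 2
          + (j * G * (j * (1 - \<zeta>) * (1 - \<zeta>) - j * (1 + q) * (1 + \<zeta>) * (1 + \<zeta>))
            - j * D * \<zeta> * (j * (1 - \<zeta>) * (1 - \<zeta>) - j * (1 + q) * (1 + \<zeta>) * (1 + \<zeta>)))) =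
        8 * ((q\<^sup>2 / 8 + G * q / 4)
        + (1 / 2 + q + q\<^sup>2 / 4 + G * (1 + q / 2) - D * q / 4) * \<zeta>
        + (q\<^sup>2 / 8 + G * q / 4 - D * (1 + q / 2)) * \<zeta>\<^sup>2
        + (- D * q / 4) * \<zeta> ^ 3)" for q \<zeta> G by (simp only:)
      then show ?thesis unfolding W1_def W20_def s_def ids by (simp only: mult_cancel_left) simp
    qed
    have alg: "(h * F + h\<^sup>2 * P + h ^ 3 * E) + h * (L0 + h * L1 + h\<^sup>2 * L2) + h\<^sup>2 * (Z + h * Y) =
        h * (F + L0) + h\<^sup>2 * (Z + (P + L1)) + h ^ 3 * (E + L2 + Y)" for h F P E L0 L1 L2 Z Y :: complex
      by (simp add: algebra_simps power2_eq_square power3_eq_cube)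
    show "Ln (1 + w1 p) + Ln (1 + w2 p) + h p * (\<i> / 2 * (g p - A) * \<zeta>2 p - \<i> * D / 4 * (\<zeta>2 p)\<^sup>2)
      + (h p)\<^sup>2 * (k0 p + k1 p * \<zeta>2 p + k2 p * (\<zeta>2 p)\<^sup>2 + k3 p * \<zeta>2 p ^ 3)
    = h p * (\<i> / 2 * (2 + q p) + \<i> / 2 * (q p + g p - A) * \<zeta> p - \<i> * D / 4 * (\<zeta> p)\<^sup>2)
      + (h p)\<^sup>2 * ((k0 p + ((q p)\<^sup>2 / 8 + (g p - A) * q p / 4))
        + (k1 p + (1 / 2 + q p + (q p)\<^sup>2 / 4 + (g p - A) * (1 + q p / 2) - D * q p / 4)) * \<zeta> p
        + (k2 p + ((q p)\<^sup>2 / 8 + (g p - A) * q p / 4 - D * (1 + q p / 2))) * (\<zeta> p)\<^sup>2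
        + (k3 p + - D * q p / 4) * \<zeta> p ^ 3)
      + h p ^ 3 * X p"
      unfolding LL lin quad alg second first unfolding X_def j_def[symmetric]
      by (rule arg_cong2[where f = "(+)"], rule arg_cong2[where f = "(+)"]; rule arg_cong2[where f = "(*)"])
        (simp_all add: algebra_simps)
  qed
qed

text \<open>Each shear multiplies the vector, seen as a complex number, by \<open>1 + w\<close>, so
  \<open>cnj z / z\<close> is multiplied by \<open>(1 + cnj w) / (1 + w)\<close>. On the unit circle
  \<open>cnj w\<close> can be eliminated, which gives the fractional linear formulas that
  \<open>step_expansion\<close> asks for.\<close>

lemma hstep_log_expansion_data:
  assumes z: "z \<noteq> 0" and c: "0 \<le> c" and e: "0 \<le> e"
  defines "\<zeta> \<equiv> cnj z / z" and "z1 \<equiv> - \<i> * shear e (\<i> * z)"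
  defines "\<zeta>1 \<equiv> cnj z1 / z1" and "\<zeta>2 \<equiv> cnj (hstep e c z) / hstep e c z"
  defines "w1 \<equiv> complex_of_real e * (\<i> / 2 * (1 - \<zeta>))"
    and "w2 \<equiv> complex_of_real c * (\<i> / 2 * (1 + \<zeta>1))"
  shows "hstep_log e c z = Ln (1 + w1) + Ln (1 + w2)"
    and "\<zeta>1 * (1 + w1) = \<zeta> + w1" and "\<zeta>2 * (1 + w2) = \<zeta>1 - w2"
    and "cmod w1 \<le> e" and "cmod w2 \<le> c" and "cmod \<zeta> = 1" and "cmod \<zeta>1 = 1"
proof -
  have z1: "z1 \<noteq> 0" and z2: "hstep e c z \<noteq> 0" using z by (auto simp: z1_def)
  have n: "cmod \<zeta> = 1" "cmod \<zeta>1 = 1" using z z1 by (simp_all add: \<zeta>_def \<zeta>1_def norm_divide)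
  then show "cmod \<zeta> = 1" "cmod \<zeta>1 = 1" by auto
  have q1: "shear e (\<i> * z) / (\<i> * z) = 1 + w1"
    using shear_quotient[of "\<i> * z" e] z by (simp add: w1_def \<zeta>_def)
  have q2: "hstep e c z / z1 = 1 + w2"
    using shear_quotient[OF z1, of c] by (simp only: hstep_def z1_def w2_def \<zeta>1_def) (simp add: mult_ac)
  show "hstep_log e c z = Ln (1 + w1) + Ln (1 + w2)"
    using q1 q2 by (simp add: hstep_log_def shear_log_def hstep_def z1_def)
  have m1: "z1 = z * (1 + w1)"
    using q1 z by (simp add: z1_def field_simps)
  have m2: "hstep e c z = z1 * (1 + w2)" using q2 z1 by (simp add: field_simps)
  have inv: "u * cnj u = 1" if "cmod u = 1" for u using that by (simp add: complex_mult_cnj flip: cmod_power2)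
  have c1: "\<zeta> * cnj w1 = w1"
  proof -
    have "\<zeta> * cnj w1 = complex_of_real e * (\<i> / 2 * (\<zeta> * cnj \<zeta> - \<zeta>))" by (simp add: w1_def field_simps)
    then show ?thesis unfolding inv[OF n(1)] w1_def .
  qed
  have c2: "\<zeta>1 * cnj w2 = - w2"
  proof -
    have "\<zeta>1 * cnj w2 = - (complex_of_real c * (\<i> / 2 * (\<zeta>1 * cnj \<zeta>1 + \<zeta>1)))" by (simp add: w2_def field_simps)
    then show ?thesis unfolding inv[OF n(2)] w2_def .
  qed
  have a1: "1 + w1 \<noteq> 0" using z1 m1 by auto
  have a2: "1 + w2 \<noteq> 0" using z2 m2 by auto
  have "\<zeta>1 * (1 + w1) = \<zeta> * (1 + cnj w1)"
    using z a1 by (simp add: \<zeta>1_def m1 \<zeta>_def)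
  then show "\<zeta>1 * (1 + w1) = \<zeta> + w1" using c1 by (simp add: algebra_simps)
  have "\<zeta>2 * (1 + w2) = \<zeta>1 * (1 + cnj w2)"
    using z1 a2 by (simp add: \<zeta>2_def m2 \<zeta>1_def)
  then show "\<zeta>2 * (1 + w2) = \<zeta>1 - w2" using c2 by (simp add: algebra_simps)
  have "cmod (1 - \<zeta>) \<le> 2" "cmod (1 + \<zeta>1) \<le> 2"
    using norm_triangle_ineq4[of 1 \<zeta>] norm_triangle_ineq[of 1 \<zeta>1] n by auto
  then have "e * (cmod (1 - \<zeta>) / 2) \<le> e * 1" "c * (cmod (1 + \<zeta>1) / 2) \<le> c * 1"
    using c e by (intro mult_left_mono; simp)+
  then show "cmod w1 \<le> e" "cmod w2 \<le> c"
    using c e by (simp_all add: w1_def w2_def norm_mult norm_divide)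
qed

text \<open>At first order the \<open>G\<close> term cancels the fluctuation of the growth over the
  base points. The terms with \<open>A\<close> and \<open>D\<close> do not depend on
  \<open>y\<close>; as the coordinate turns with velocity about \<open>- 2 * \<i> * \<zeta>\<close>,
  they reappear at second order as \<open>- A * \<zeta>\<close> and
  \<open>- D * \<zeta>\<^sup>2\<close> and balance the mean dependence on the direction. The
  functions \<open>k j\<close> cancel the fluctuations of second order.\<close>

definition corrector :: "(real \<Rightarrow> real) \<Rightarrow> real \<Rightarrow> real \<Rightarrow> (nat \<Rightarrow> real \<Rightarrow> real) \<Rightarrow> real \<Rightarrow> real \<Rightarrow> complex \<Rightarrow> real" where
  "corrector G A D k \<eta> y z = (let \<zeta> = cnj z / z in
     \<eta> * ((G y - A) * Re (\<i> / 2 * \<zeta>) - D * Re (\<i> / 4 * \<zeta>\<^sup>2)) +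
     \<eta>\<^sup>2 * (k 0 y + k 1 y * Re \<zeta> + k 2 y * Re (\<zeta>\<^sup>2) + k 3 y * Re (\<zeta> ^ 3)))"

text \<open>The real part of \<open>step_expansion\<close>, with a remainder \<open>C\<close>
  uniform in scale, base point and direction. The bound on \<eta> keeps both relative increments
  below \<open>1 / 2\<close> in modulus, where \<open>Ln\<close> can be expanded.\<close>

lemma corrector_step:
  fixes Q G :: "real \<Rightarrow> real" and k :: "nat \<Rightarrow> real \<Rightarrow> real"
  assumes Q: "\<And>x. \<bar>Q x\<bar> \<le> M" "\<And>x. -1 \<le> Q x" and G: "\<And>x. \<bar>G x\<bar> \<le> M" and k: "\<And>j x. \<bar>k j x\<bar> \<le> M"
  obtains C where "\<And>\<eta> t z. 0 < \<eta> \<Longrightarrow> \<eta> \<le> 1 / (2 * (1 + M)) \<Longrightarrow> z \<noteq> 0 \<Longrightarrow>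
    (let \<zeta> = cnj z / z in
      \<eta> * ((Q t + G t - A) * Re (\<i> / 2 * \<zeta>) - D * Re (\<i> / 4 * \<zeta>\<^sup>2)) +
      \<eta>\<^sup>2 * ((k 0 t + ((Q t)\<^sup>2 / 8 + (G t - A) * Q t / 4))
        + (k 1 t + (1 / 2 + Q t + (Q t)\<^sup>2 / 4 + (G t - A) * (1 + Q t / 2) - D * Q t / 4)) * Re \<zeta>
        + (k 2 t + ((Q t)\<^sup>2 / 8 + (G t - A) * Q t / 4 - D * (1 + Q t / 2))) * Re (\<zeta>\<^sup>2)
        + (k 3 t + - D * Q t / 4) * Re (\<zeta> ^ 3))) - C * \<eta> ^ 3
    \<le> ln (cmod (hstep \<eta> (\<eta> * (1 + Q t)) z)) - ln (cmod z)
      + corrector G A D k \<eta> t (hstep \<eta> (\<eta> * (1 + Q t)) z)"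
proof -
  have M: "0 \<le> M" using Q(1)[of 0] by linarith
  define S :: "(real \<times> real \<times> complex) set"
    where "S = {p. 0 < fst p \<and> fst p \<le> 1 / (2 * (1 + M)) \<and> snd (snd p) \<noteq> 0}"
  define h q g :: "real \<times> real \<times> complex \<Rightarrow> complex" where "h p = complex_of_real (fst p)"
    and "q p = complex_of_real (Q (fst (snd p)))" and "g p = complex_of_real (G (fst (snd p)))" for p
  define kk :: "nat \<Rightarrow> real \<times> real \<times> complex \<Rightarrow> complex" where "kk j p = complex_of_real (k j (fst (snd p)))" for j p
  define \<zeta> z1 z2 :: "real \<times> real \<times> complex \<Rightarrow> complex" where "\<zeta> p = cnj (snd (snd p)) / snd (snd p)"
    and "z1 p = - \<i> * shear (fst p) (\<i> * snd (snd p))"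
    and "z2 p = hstep (fst p) (fst p * (1 + Q (fst (snd p)))) (snd (snd p))" for p
  define \<zeta>1 \<zeta>2 where "\<zeta>1 p = cnj (z1 p) / z1 p" and "\<zeta>2 p = cnj (z2 p) / z2 p" for p
  define w1 w2 where "w1 p = h p * (\<i> / 2 * (1 - \<zeta> p))" and "w2 p = h p * (\<i> / 2 * (1 + q p) * (1 + \<zeta>1 p))" for p
  have data: "hstep_log \<eta> (\<eta> * (1 + Q t)) z = Ln (1 + w1 p) + Ln (1 + w2 p)"
      "\<zeta>1 p * (1 + w1 p) = \<zeta> p + w1 p" "\<zeta>2 p * (1 + w2 p) = \<zeta>1 p - w2 p"
      "cmod (w1 p) \<le> 1 / 2" "cmod (w2 p) \<le> 1 / 2" "cmod (\<zeta> p) = 1" "cmod (\<zeta>1 p) = 1" "\<eta> \<le> 1"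
    if p: "p = (\<eta>, t, z)" "p \<in> S" for p \<eta> t z
  proof -
    have \<eta>: "0 < \<eta>" "\<eta> \<le> 1 / (2 * (1 + M))" "z \<noteq> 0" using p by (auto simp: S_def)
    have c: "0 \<le> \<eta> * (1 + Q t)" using \<eta> Q(2)[of t] by simp
    have "1 / (2 * (1 + M)) \<le> 1 / 2" using M by (simp add: field_simps)
    then have e2: "\<eta> \<le> 1 / 2" using \<eta> by linarith
    have "\<eta> * (1 + Q t) \<le> 1 / (2 * (1 + M)) * (1 + M)"
      using \<eta> Q(1)[of t] Q(2)[of t] M by (intro mult_mono) (auto simp: abs_le_iff)
    also have "1 / (2 * (1 + M)) * (1 + M) = 1 / 2" using M by (simp add: field_simps)
    finally have c2: "\<eta> * (1 + Q t) \<le> 1 / 2" .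
    have w: "w1 p = complex_of_real \<eta> * (\<i> / 2 * (1 - cnj z / z))"
      "w2 p = complex_of_real (\<eta> * (1 + Q t)) * (\<i> / 2 * (1 + cnj (- \<i> * shear \<eta> (\<i> * z)) / (- \<i> * shear \<eta> (\<i> * z))))"
      by (simp_all add: w1_def w2_def p h_def q_def \<zeta>_def \<zeta>1_def z1_def)
    note d = hstep_log_expansion_data[OF \<eta>(3) c less_imp_le[OF \<eta>(1)]]
    have \<zeta>: "\<zeta> p = cnj z / z" "\<zeta>1 p = cnj (- \<i> * shear \<eta> (\<i> * z)) / (- \<i> * shear \<eta> (\<i> * z))"
      "\<zeta>2 p = cnj (hstep \<eta> (\<eta> * (1 + Q t)) z) / hstep \<eta> (\<eta> * (1 + Q t)) z"
      by (simp_all add: p \<zeta>_def \<zeta>1_def \<zeta>2_def z1_def z2_def)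
    show "hstep_log \<eta> (\<eta> * (1 + Q t)) z = Ln (1 + w1 p) + Ln (1 + w2 p)" unfolding w by (rule d)
    show "\<zeta>1 p * (1 + w1 p) = \<zeta> p + w1 p" unfolding w \<zeta> by (rule d)
    show "\<zeta>2 p * (1 + w2 p) = \<zeta>1 p - w2 p" unfolding w \<zeta> by (rule d)
    show "cmod (w1 p) \<le> 1 / 2" unfolding w by (rule order_trans[OF d(4) e2])
    show "cmod (w2 p) \<le> 1 / 2" unfolding w by (rule order_trans[OF d(5) c2])
    show "cmod (\<zeta> p) = 1" unfolding \<zeta> by (rule d)
    show "cmod (\<zeta>1 p) = 1" unfolding \<zeta> by (rule d)
    show "\<eta> \<le> 1" using e2 by simp
  qed
  have bd: "bounded_fun_on S h" "bounded_fun_on S q" "bounded_fun_on S g" "bounded_fun_on S \<zeta>"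
      "bounded_fun_on S \<zeta>1" "bounded_fun_on S (kk 0)" "bounded_fun_on S (kk 1)" "bounded_fun_on S (kk 2)" "bounded_fun_on S (kk 3)"
  proof -
    show "bounded_fun_on S h"
      by (rule bounded_fun_onI[where C = 1]) (use data(8) in \<open>auto simp: h_def S_def\<close>)
    show "bounded_fun_on S q" "bounded_fun_on S g"
      by (rule bounded_fun_onI[where C = M], use Q G in \<open>auto simp: q_def g_def\<close>)+
    show "bounded_fun_on S \<zeta>" by (rule bounded_fun_onI[where C = 1]) (metis data(6) order_refl prod_cases3)
    show "bounded_fun_on S \<zeta>1" by (rule bounded_fun_onI[where C = 1]) (metis data(7) order_refl prod_cases3)
    have "bounded_fun_on S (kk j)" for j
      by (rule bounded_fun_onI[where C = M]) (use k in \<open>auto simp: kk_def\<close>)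
    then show "bounded_fun_on S (kk 0)" "bounded_fun_on S (kk 1)" "bounded_fun_on S (kk 2)" "bounded_fun_on S (kk 3)" by auto
  qed
  have h0: "\<And>p. p \<in> S \<Longrightarrow> h p \<noteq> 0" by (auto simp: h_def S_def)
  have dd: "\<And>p. p \<in> S \<Longrightarrow> cmod (w1 p) \<le> 1 / 2" "\<And>p. p \<in> S \<Longrightarrow> cmod (w2 p) \<le> 1 / 2"
    "\<And>p. p \<in> S \<Longrightarrow> \<zeta>1 p * (1 + w1 p) = \<zeta> p + w1 p" "\<And>p. p \<in> S \<Longrightarrow> \<zeta>2 p * (1 + w2 p) = \<zeta>1 p - w2 p"
    by (metis data prod_cases3)+
  obtain X where X: "bounded_fun_on S X" "\<And>p. p \<in> S \<Longrightarrow>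
    Ln (1 + w1 p) + Ln (1 + w2 p) + h p * (\<i> / 2 * (g p - complex_of_real A) * \<zeta>2 p - \<i> * complex_of_real D / 4 * (\<zeta>2 p)\<^sup>2)
      + (h p)\<^sup>2 * (kk 0 p + kk 1 p * \<zeta>2 p + kk 2 p * (\<zeta>2 p)\<^sup>2 + kk 3 p * \<zeta>2 p ^ 3)
    = h p * (\<i> / 2 * (2 + q p) + \<i> / 2 * (q p + g p - complex_of_real A) * \<zeta> p - \<i> * complex_of_real D / 4 * (\<zeta> p)\<^sup>2)
      + (h p)\<^sup>2 * ((kk 0 p + ((q p)\<^sup>2 / 8 + (g p - complex_of_real A) * q p / 4))
        + (kk 1 p + (1 / 2 + q p + (q p)\<^sup>2 / 4 + (g p - complex_of_real A) * (1 + q p / 2) - complex_of_real D * q p / 4)) * \<zeta> p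
        + (kk 2 p + ((q p)\<^sup>2 / 8 + (g p - complex_of_real A) * q p / 4 - complex_of_real D * (1 + q p / 2))) * (\<zeta> p)\<^sup>2
        + (kk 3 p + - complex_of_real D * q p / 4) * \<zeta> p ^ 3)
      + h p ^ 3 * X p"
    by (rule step_expansion[OF bd h0 w1_def dd(1) dd(3) w2_def dd(2) dd(4)]) (rule that | assumption)+
  obtain C where C: "\<And>p. p \<in> S \<Longrightarrow> cmod (X p) \<le> C" using X(1) by (auto simp: bounded_fun_on_def)
  show thesis
  proof (rule that[of C])
    fix \<eta> t :: real and z :: complex assume H: "0 < \<eta>" "\<eta> \<le> 1 / (2 * (1 + M))" "z \<noteq> 0"
    define p where "p = (\<eta>, t, z)"
    have p: "p \<in> S" using H by (simp add: S_def p_def)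
    have comp: "h p = complex_of_real \<eta>" "q p = complex_of_real (Q t)" "g p = complex_of_real (G t)"
      "\<And>j. kk j p = complex_of_real (k j t)"
      by (simp_all add: p_def h_def q_def g_def kk_def)
    define a where "a = \<zeta> p"
    define b where "b = \<zeta>2 p"
    have a: "a = cnj z / z" by (simp add: a_def p_def \<zeta>_def)
    have b: "b = cnj (hstep \<eta> (\<eta> * (1 + Q t)) z) / hstep \<eta> (\<eta> * (1 + Q t)) z"
      by (simp add: b_def p_def \<zeta>2_def z2_def)
    have ln: "ln (cmod (hstep \<eta> (\<eta> * (1 + Q t)) z)) - ln (cmod z) = Re (Ln (1 + w1 p) + Ln (1 + w2 p))"
    proof -
      have "cmod (hstep \<eta> (\<eta> * (1 + Q t)) z) = cmod z * exp (Re (hstep_log \<eta> (\<eta> * (1 + Q t)) z))"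
        using exp_hstep_log[OF H(3), of \<eta> "\<eta> * (1 + Q t)"] by (metis norm_exp_eq_Re norm_mult)
      then show ?thesis using H(3) data(1)[OF p_def p] by (simp add: ln_mult)
    qed
    have lin: "Re (complex_of_real \<eta> * (\<i> / 2 * (complex_of_real x - A) * u - \<i> * D / 4 * v)) =
        \<eta> * ((x - A) * Re (\<i> / 2 * u) - D * Re (\<i> / 4 * v))" for x u v
      by (simp add: field_simps)
    \<comment> \<open>The constant \<open>\<i> / 2 * (2 + y)\<close> is imaginary: it is the
      rotation of the vector and contributes nothing to its growth.\<close>
    have lin': "Re (complex_of_real \<eta> * (\<i> / 2 * (2 + complex_of_real y) + \<i> / 2 * (complex_of_real y + complex_of_real x - A) * u - \<i> * D / 4 * v)) =
        \<eta> * ((y + x - A) * Re (\<i> / 2 * u) - D * Re (\<i> / 4 * v))" for x y u v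
      by (simp add: field_simps)
    have quad: "Re ((complex_of_real \<eta>)\<^sup>2 * (complex_of_real x0 + complex_of_real x1 * u + complex_of_real x2 * v + complex_of_real x3 * w)) =
        \<eta>\<^sup>2 * (x0 + x1 * Re u + x2 * Re v + x3 * Re w)" for x0 x1 x2 x3 u v w
      by (simp flip: of_real_power)
    have cor: "corrector G A D k \<eta> t (hstep \<eta> (\<eta> * (1 + Q t)) z) =
      Re (h p * (\<i> / 2 * (g p - A) * b - \<i> * D / 4 * b\<^sup>2)
        + (h p)\<^sup>2 * (kk 0 p + kk 1 p * b + kk 2 p * b\<^sup>2 + kk 3 p * b ^ 3))"
      unfolding corrector_def Let_def b[symmetric] plus_complex.sel comp lin quad ..
    have 3: "- C * \<eta> ^ 3 \<le> Re (h p ^ 3 * X p)"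
    proof -
      have "\<bar>Re (h p ^ 3 * X p)\<bar> \<le> cmod (h p ^ 3 * X p)" by (rule abs_Re_le_cmod)
      also have "\<dots> = \<eta> ^ 3 * cmod (X p)" using H by (simp add: comp norm_mult norm_power)
      also have "\<dots> \<le> \<eta> ^ 3 * C" using C[OF p] H by (intro mult_left_mono) auto
      finally show ?thesis by (simp add: abs_le_iff mult.commute)
    qed
    have Qc: "(complex_of_real k0 + ((complex_of_real x)\<^sup>2 / 8 + (complex_of_real y - complex_of_real A) * complex_of_real x / 4)) =
        complex_of_real (k0 + (x\<^sup>2 / 8 + (y - A) * x / 4))"
      "(complex_of_real k0 + (1 / 2 + complex_of_real x + (complex_of_real x)\<^sup>2 / 4 + (complex_of_real y - complex_of_real A) * (1 + complex_of_real x / 2) - complex_of_real D * complex_of_real x / 4)) =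
        complex_of_real (k0 + (1 / 2 + x + x\<^sup>2 / 4 + (y - A) * (1 + x / 2) - D * x / 4))"
      "(complex_of_real k0 + ((complex_of_real x)\<^sup>2 / 8 + (complex_of_real y - complex_of_real A) * complex_of_real x / 4 - complex_of_real D * (1 + complex_of_real x / 2))) =
        complex_of_real (k0 + (x\<^sup>2 / 8 + (y - A) * x / 4 - D * (1 + x / 2)))"
      "(complex_of_real k0 + - complex_of_real D * complex_of_real x / 4) = complex_of_real (k0 + - D * x / 4)" for k0 x y
      by simp_all
    have "ln (cmod (hstep \<eta> (\<eta> * (1 + Q t)) z)) - ln (cmod z) + corrector G A D k \<eta> t (hstep \<eta> (\<eta> * (1 + Q t)) z)
      = Re (Ln (1 + w1 p) + Ln (1 + w2 p) + h p * (\<i> / 2 * (g p - A) * b - \<i> * D / 4 * b\<^sup>2)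
        + (h p)\<^sup>2 * (kk 0 p + kk 1 p * b + kk 2 p * b\<^sup>2 + kk 3 p * b ^ 3))"
      unfolding ln cor by simp
    also have "\<dots> = \<eta> * ((Q t + G t - A) * Re (\<i> / 2 * a) - D * Re (\<i> / 4 * a\<^sup>2)) +
      \<eta>\<^sup>2 * ((k 0 t + ((Q t)\<^sup>2 / 8 + (G t - A) * Q t / 4))
        + (k 1 t + (1 / 2 + Q t + (Q t)\<^sup>2 / 4 + (G t - A) * (1 + Q t / 2) - D * Q t / 4)) * Re a
        + (k 2 t + ((Q t)\<^sup>2 / 8 + (G t - A) * Q t / 4 - D * (1 + Q t / 2))) * Re (a\<^sup>2)
        + (k 3 t + - D * Q t / 4) * Re (a ^ 3)) + Re (h p ^ 3 * X p)"
      unfolding b_def X(2)[OF p] a_def[symmetric] unfolding comp Qc unfolding plus_complex.sel(1) lin' quad ..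
    finally show "(let \<zeta> = cnj z / z in
      \<eta> * ((Q t + G t - A) * Re (\<i> / 2 * \<zeta>) - D * Re (\<i> / 4 * \<zeta>\<^sup>2)) +
      \<eta>\<^sup>2 * ((k 0 t + ((Q t)\<^sup>2 / 8 + (G t - A) * Q t / 4))
        + (k 1 t + (1 / 2 + Q t + (Q t)\<^sup>2 / 4 + (G t - A) * (1 + Q t / 2) - D * Q t / 4)) * Re \<zeta>
        + (k 2 t + ((Q t)\<^sup>2 / 8 + (G t - A) * Q t / 4 - D * (1 + Q t / 2))) * Re (\<zeta>\<^sup>2)
        + (k 3 t + - D * Q t / 4) * Re (\<zeta> ^ 3))) - C * \<eta> ^ 3
    \<le> ln (cmod (hstep \<eta> (\<eta> * (1 + Q t)) z)) - ln (cmod z)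
      + corrector G A D k \<eta> t (hstep \<eta> (\<eta> * (1 + Q t)) z)"
      using 3 unfolding Let_def a[symmetric] by linarith
  qed
qed

text \<open>
  The constants \<open>A\<close>, \<open>D\<close> make the averages of the coefficients of \<open>\<zeta>\<close>, \<open>\<zeta>\<^sup>2\<close>, \<open>\<zeta>\<^sup>3\<close> vanish, and the
  Poisson solutions \<open>G\<close>, \<open>k j\<close> remove the fluctuations; what remains is the mean \<open>\<sigma> / 8\<close> of the
  constant coefficient.
\<close>

theorem uniform_drift_small_energy:
  fixes Q G :: "real \<Rightarrow> real"
  defines "\<sigma> \<equiv> circle_mean (\<lambda>x. (Q x)\<^sup>2) + 2 * circle_mean (\<lambda>x. Q x * G x)"
  assumes Q: "circle_lipschitz L Q" "circle_mean Q = 0" "\<And>x. -1 \<le> Q x"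
    and G: "circle_lipschitz L' G" "circle_mean G = 0" "\<And>y. G y - branch_avg G y = branch_avg Q y"
    and \<sigma>: "0 < \<sigma>"
  obtains \<eta>0 where "0 < \<eta>0" "\<And>\<eta>. 0 < \<eta> \<Longrightarrow> \<eta> < \<eta>0 \<Longrightarrow> \<exists>\<delta> M v. uniform_drift \<eta> (\<lambda>t. \<eta> * (1 + Q t)) \<delta> M v"
proof -
  \<comment> \<open>Forced by the means: \<open>Q\<close> and \<open>G\<close> have mean zero, so
    the mean of \<open>K 1\<close> is \<open>1 / 2 + \<sigma> / 4 - A\<close> and that of
    \<open>K 2\<close> is \<open>\<sigma> / 8 - D\<close>.\<close>
  define A D where "A = 1 / 2 + \<sigma> / 4" and "D = \<sigma> / 8"
  define K where "K j t = (if j = (0::nat) then (Q t)\<^sup>2 / 8 + (G t - A) * Q t / 4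
    else if j = 1 then 1 / 2 + Q t + (Q t)\<^sup>2 / 4 + (G t - A) * (1 + Q t / 2) - D * Q t / 4
    else if j = 2 then (Q t)\<^sup>2 / 8 + (G t - A) * Q t / 4 - D * (1 + Q t / 2)
    else - D * Q t / 4)" for j t
  obtain L1 where QQ: "circle_lipschitz L1 (\<lambda>x. Q x * Q x)" using circle_lipschitz_mult[OF Q(1) Q(1)] by blast
  obtain L2 where QG: "circle_lipschitz L2 (\<lambda>x. Q x * G x)" using circle_lipschitz_mult[OF Q(1) G(1)] by blast
  \<comment> \<open>All coefficients are combinations of \<open>1\<close>, \<open>Q\<close>,
    \<open>G\<close>, \<open>Q * Q\<close> and \<open>Q * G\<close>, so Lipschitz property and mean
    are settled for all of them at once.\<close>
  have Kform: "\<exists>a b c d f. \<forall>t. K j t = a + b * Q t + c * G t + d * (Q t * Q t) + f * (Q t * G t)" for j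
  proof -
    consider "j = 0" | "j = 1" | "j = 2" | "j \<noteq> 0" "j \<noteq> 1" "j \<noteq> 2" by blast
    then show ?thesis
    proof cases
      case 1
      then show ?thesis
        by (intro exI[of _ 0] exI[of _ "- A / 4"] exI[of _ 0] exI[of _ "1 / 8"] exI[of _ "1 / 4"] allI)
          (simp add: K_def power2_eq_square algebra_simps add_divide_distrib diff_divide_distrib)
    next
      case 2
      then show ?thesis
        by (intro exI[of _ "1 / 2 - A"] exI[of _ "1 - A / 2 - D / 4"] exI[of _ 1] exI[of _ "1 / 4"] exI[of _ "1 / 2"] allI)
          (simp add: K_def power2_eq_square algebra_simps add_divide_distrib diff_divide_distrib)
    next
      case 3
      then show ?thesis
        by (intro exI[of _ "- D"] exI[of _ "- A / 4 - D / 2"] exI[of _ 0] exI[of _ "1 / 8"] exI[of _ "1 / 4"] allI)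
          (simp add: K_def power2_eq_square algebra_simps add_divide_distrib diff_divide_distrib)
    next
      case 4
      have "K j t = 0 + - D / 4 * Q t + 0 * G t + 0 * (Q t * Q t) + 0 * (Q t * G t)" for t
        unfolding K_def if_not_P[OF 4(1)] if_not_P[OF 4(2)] if_not_P[OF 4(3)] by simp
      then show ?thesis by (intro exI allI)
    qed
  qed
  have form_lip: "\<exists>L. circle_lipschitz L (\<lambda>t. a + b * Q t + c * G t + d * (Q t * Q t) + f * (Q t * G t))" for a b c d f
    by (rule exI, rule circle_lipschitz_add[OF circle_lipschitz_add[OF circle_lipschitz_add[OF
          circle_lipschitz_add[OF circle_lipschitz_const circle_lipschitz_cmult[OF Q(1)]]
          circle_lipschitz_cmult[OF G(1)]] circle_lipschitz_cmult[OF QQ]] circle_lipschitz_cmult[OF QG]])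
  have cQ: "continuous_on UNIV Q" and cG: "continuous_on UNIV G"
    by (rule circle_lipschitz_continuous[OF Q(1)] circle_lipschitz_continuous[OF G(1)])+
  have form_mean: "circle_mean (\<lambda>t. a + b * Q t + c * G t + d * (Q t * Q t) + f * (Q t * G t)) =
      a + d * circle_mean (\<lambda>x. Q x * Q x) + f * circle_mean (\<lambda>x. Q x * G x)" for a b c d f
  proof -
    have "circle_mean (\<lambda>t. a + b * Q t + c * G t + d * (Q t * Q t) + f * (Q t * G t)) =
        circle_mean (\<lambda>t. a) + circle_mean (\<lambda>t. b * Q t) + circle_mean (\<lambda>t. c * G t)
        + circle_mean (\<lambda>t. d * (Q t * Q t)) + circle_mean (\<lambda>t. f * (Q t * G t))"
      by (subst circle_mean_add, (intro continuous_intros cQ cG)+)+ (rule refl)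
    then show ?thesis by (simp only: circle_mean_cmult circle_mean_const Q(2) G(2) mult_zero_right add_0_right)
  qed
  have Klip: "\<exists>L. circle_lipschitz L (K j)" for j
  proof -
    obtain a b c d f where "\<forall>t. K j t = a + b * Q t + c * G t + d * (Q t * Q t) + f * (Q t * G t)"
      using Kform[of j] by (elim exE)
    then have "K j = (\<lambda>t. a + b * Q t + c * G t + d * (Q t * Q t) + f * (Q t * G t))" by (intro ext) simp
    then show ?thesis using form_lip by simp
  qed
  have \<sigma>': "\<sigma> = circle_mean (\<lambda>x. Q x * Q x) + 2 * circle_mean (\<lambda>x. Q x * G x)"
    by (simp add: \<sigma>_def power2_eq_square)
  have Kmean: "circle_mean (K 0) = \<sigma> / 8" "circle_mean (K 1) = 0" "circle_mean (K 2) = 0" "circle_mean (K 3) = 0"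
  proof -
    have eq: "K 0 = (\<lambda>t. 0 + - A / 4 * Q t + 0 * G t + 1 / 8 * (Q t * Q t) + 1 / 4 * (Q t * G t))"
      "K 1 = (\<lambda>t. (1 / 2 - A) + (1 - A / 2 - D / 4) * Q t + 1 * G t + 1 / 4 * (Q t * Q t) + 1 / 2 * (Q t * G t))"
      "K 2 = (\<lambda>t. - D + (- A / 4 - D / 2) * Q t + 0 * G t + 1 / 8 * (Q t * Q t) + 1 / 4 * (Q t * G t))"
      "K 3 = (\<lambda>t. 0 + - D / 4 * Q t + 0 * G t + 0 * (Q t * Q t) + 0 * (Q t * G t))"
      by (simp_all add: K_def fun_eq_iff power2_eq_square algebra_simps add_divide_distrib diff_divide_distrib)
    show "circle_mean (K 0) = \<sigma> / 8" unfolding eq form_mean \<sigma>' by (simp add: field_simps)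
    show "circle_mean (K 1) = 0" unfolding eq form_mean A_def \<sigma>' by (simp add: field_simps)
    show "circle_mean (K 2) = 0" unfolding eq form_mean D_def \<sigma>' by (simp add: field_simps)
    show "circle_mean (K 3) = 0" unfolding eq form_mean by simp
  qed
  \<comment> \<open>In the drift inequality \<open>K j\<close> occurs under one
    \<open>branch_avg\<close>, so the Poisson equation is solved for
    \<open>branch_avg (K j)\<close>.\<close>
  have "\<exists>k. (\<exists>L. circle_lipschitz L k) \<and> (\<forall>y. branch_avg k y + branch_avg (K j) y = k y + circle_mean (K j))" for j
  proof -
    obtain L where L: "circle_lipschitz L (K j)" using Klip by blast
    obtain g where g: "circle_lipschitz (2 * (L / 2)) g"
        "\<And>y. g y - branch_avg g y = branch_avg (K j) y - circle_mean (branch_avg (K j))"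
      by (rule poisson_equation[OF circle_lipschitz_branch_avg[OF L]]) (rule that)
    have "branch_avg g y + branch_avg (K j) y = g y + circle_mean (K j)" for y
      using g(2)[of y] circle_mean_branch_avg[OF circle_lipschitz_continuous[OF L]] by simp
    then show ?thesis using g(1) by blast
  qed
  then have "\<exists>k0. \<forall>j. (\<exists>L. circle_lipschitz L (k0 j)) \<and>
      (\<forall>y. branch_avg (k0 j) y + branch_avg (K j) y = k0 j y + circle_mean (K j))"
    by (intro choice allI)
  then obtain k0 where k0': "\<forall>j. (\<exists>L. circle_lipschitz L (k0 j)) \<and>
      (\<forall>y. branch_avg (k0 j) y + branch_avg (K j) y = k0 j y + circle_mean (K j))" ..
  have k0: "\<exists>L. circle_lipschitz L (k0 j)"
      "branch_avg (k0 j) y + branch_avg (K j) y = k0 j y + circle_mean (K j)" for j y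
    using k0' by auto
  \<comment> \<open>\<open>corrector_step\<close> wants one bound for all indices; beyond 3 the
    functions are set to zero.\<close>
  define k where "k j = (if j \<le> 3 then k0 j else (\<lambda>_. 0))" for j
  have "\<exists>B. \<forall>x. \<bar>k0 j x\<bar> \<le> B" for j using k0(1)[of j] circle_lipschitz_bounded[of _ "k0 j"] by (elim exE) (rule exI, rule allI, assumption)
  then have "\<exists>B. \<forall>j x. \<bar>k0 j x\<bar> \<le> B j" by (intro choice allI)
  then obtain B where "\<forall>j x. \<bar>k0 j x\<bar> \<le> B j" ..
  then have B: "\<bar>k0 j x\<bar> \<le> B j" for j x by blast
  define M where "M = (\<bar>circle_mean Q\<bar> + L) + (\<bar>circle_mean G\<bar> + L') + (\<Sum>j\<le>3. B j)"
  have B0: "0 \<le> B j" for j using B[of j 0] by linarith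
  have "0 \<le> L" "0 \<le> L'" using Q(1) G(1) by (auto intro: circle_lipschitz_nonneg)
  then have MQ: "\<bar>Q x\<bar> \<le> M" and MG: "\<bar>G x\<bar> \<le> M" and M0: "0 \<le> M" for x
    using circle_lipschitz_bounded[OF Q(1), of x] circle_lipschitz_bounded[OF G(1), of x] sum_nonneg[of "{..3}" B] B0
    by (auto simp: M_def)
  have Mk: "\<bar>k j x\<bar> \<le> M" for j x
  proof (cases "j \<le> 3")
    case True
    have "B j \<le> (\<Sum>j\<le>3. B j)" using True B0 by (intro member_le_sum) auto
    then show ?thesis using B[of j x] True \<open>0 \<le> L\<close> \<open>0 \<le> L'\<close> by (simp add: k_def M_def)
  qed (simp add: k_def M0)
  obtain C where C: "\<And>\<eta> t z. 0 < \<eta> \<Longrightarrow> \<eta> \<le> 1 / (2 * (1 + M)) \<Longrightarrow> z \<noteq> 0 \<Longrightarrow>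
    (let \<zeta> = cnj z / z in
      \<eta> * ((Q t + G t - A) * Re (\<i> / 2 * \<zeta>) - D * Re (\<i> / 4 * \<zeta>\<^sup>2)) +
      \<eta>\<^sup>2 * ((k 0 t + ((Q t)\<^sup>2 / 8 + (G t - A) * Q t / 4))
        + (k 1 t + (1 / 2 + Q t + (Q t)\<^sup>2 / 4 + (G t - A) * (1 + Q t / 2) - D * Q t / 4)) * Re \<zeta>
        + (k 2 t + ((Q t)\<^sup>2 / 8 + (G t - A) * Q t / 4 - D * (1 + Q t / 2))) * Re (\<zeta>\<^sup>2)
        + (k 3 t + - D * Q t / 4) * Re (\<zeta> ^ 3))) - C * \<eta> ^ 3
    \<le> ln (cmod (hstep \<eta> (\<eta> * (1 + Q t)) z)) - ln (cmod z)
      + corrector G A D k \<eta> t (hstep \<eta> (\<eta> * (1 + Q t)) z)"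
    by (rule corrector_step[OF MQ Q(3) MG Mk]) (rule that)
  \<comment> \<open>The second bound makes the cubic error at most half of the gain
    \<open>\<eta>\<^sup>2 * \<sigma> / 8\<close>.\<close>
  define \<eta>0 where "\<eta>0 = min (1 / (2 * (1 + M))) (\<sigma> / (16 * (\<bar>C\<bar> + 1)))"
  have \<eta>0: "0 < \<eta>0" using M0 \<sigma> by (simp add: \<eta>0_def)
  show thesis
  proof (rule that[OF \<eta>0])
    fix \<eta> assume \<eta>: "0 < \<eta>" "\<eta> < \<eta>0"
    have \<eta>1: "\<eta> \<le> 1 / (2 * (1 + M))" using \<eta> by (simp add: \<eta>0_def)
    have "\<eta> \<le> \<sigma> / (16 * (\<bar>C\<bar> + 1))" using \<eta> by (simp add: \<eta>0_def)
    then have "16 * (\<bar>C\<bar> + 1) * \<eta> \<le> \<sigma>" by (simp add: pos_le_divide_eq mult.commute)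
    moreover have "C * \<eta> \<le> (\<bar>C\<bar> + 1) * \<eta>" using \<eta> by (intro mult_right_mono) auto
    ultimately have C\<eta>: "C * \<eta> \<le> \<sigma> / 16" by linarith
    define v where "v = corrector G A D k \<eta>"
    define m where "m = \<eta> * ((M + \<bar>A\<bar>) * 1 + \<bar>D\<bar> * 1) + \<eta>\<^sup>2 * (M + M * 1 + M * 1 + M * 1)"
    have vm: "\<bar>v y z\<bar> \<le> m" if "z \<noteq> 0" for y z
    proof -
      define \<zeta> where "\<zeta> = cnj z / z"
      have n: "cmod \<zeta> = 1" using that by (simp add: \<zeta>_def norm_divide)
      have re: "\<bar>Re (\<i> / 2 * \<zeta>)\<bar> \<le> 1" "\<bar>Re (\<i> / 4 * \<zeta>\<^sup>2)\<bar> \<le> 1" "\<bar>Re \<zeta>\<bar> \<le> 1" "\<bar>Re (\<zeta>\<^sup>2)\<bar> \<le> 1" "\<bar>Re (\<zeta> ^ 3)\<bar> \<le> 1"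
        by (rule order_trans[OF abs_Re_le_cmod], simp add: norm_mult norm_power norm_divide n)+
      have "\<bar>v y z\<bar> \<le> \<eta> * \<bar>(G y - A) * Re (\<i> / 2 * \<zeta>) - D * Re (\<i> / 4 * \<zeta>\<^sup>2)\<bar>
          + \<eta>\<^sup>2 * \<bar>k 0 y + k 1 y * Re \<zeta> + k 2 y * Re (\<zeta>\<^sup>2) + k 3 y * Re (\<zeta> ^ 3)\<bar>"
        unfolding v_def corrector_def Let_def \<zeta>_def[symmetric]
        using \<eta> by (intro order_trans[OF abs_triangle_ineq]) (simp only: abs_mult abs_power2 abs_of_pos order_refl)
      also have "\<dots> \<le> m"
        unfolding m_def
      proof (intro add_mono mult_left_mono)
        have "\<bar>(G y - A) * Re (\<i> / 2 * \<zeta>)\<bar> \<le> (M + \<bar>A\<bar>) * 1"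
          unfolding abs_mult using re MG[of y] by (intro mult_mono) auto
        moreover have "\<bar>D * Re (\<i> / 4 * \<zeta>\<^sup>2)\<bar> \<le> \<bar>D\<bar> * 1"
          unfolding abs_mult using re by (intro mult_mono) auto
        ultimately show "\<bar>(G y - A) * Re (\<i> / 2 * \<zeta>) - D * Re (\<i> / 4 * \<zeta>\<^sup>2)\<bar> \<le> (M + \<bar>A\<bar>) * 1 + \<bar>D\<bar> * 1" by linarith
        have "\<bar>k 1 y * Re \<zeta>\<bar> \<le> M * 1" "\<bar>k 2 y * Re (\<zeta>\<^sup>2)\<bar> \<le> M * 1" "\<bar>k 3 y * Re (\<zeta> ^ 3)\<bar> \<le> M * 1"
          unfolding abs_mult by (intro mult_mono Mk re M0 abs_ge_zero)+
        then show "\<bar>k 0 y + k 1 y * Re \<zeta> + k 2 y * Re (\<zeta>\<^sup>2) + k 3 y * Re (\<zeta> ^ 3)\<bar> \<le> M + M * 1 + M * 1 + M * 1"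
          using Mk[of 0 y] by linarith
      qed (use \<eta> in auto)
      finally show ?thesis .
    qed
    have drift: "ln (cmod z) + v y z + \<eta>\<^sup>2 * (\<sigma> / 16) \<le>
        branch_avg (\<lambda>t. ln (cmod (hstep \<eta> (\<eta> * (1 + Q t)) z)) + v t (hstep \<eta> (\<eta> * (1 + Q t)) z)) y"
      if z: "z \<noteq> 0" for y z
    proof -
      define \<zeta> where "\<zeta> = cnj z / z"
      define r where "r = Re (\<i> / 2 * \<zeta>)"
      define r2 where "r2 = Re (\<i> / 4 * \<zeta>\<^sup>2)"
      define f where "f t = ln (cmod z) - C * \<eta> ^ 3 - \<eta> * (A * r + D * r2) + \<eta> * r * (Q t + G t)
        + \<eta>\<^sup>2 * ((k0 0 t + K 0 t) + (k0 1 t + K 1 t) * Re \<zeta> + (k0 2 t + K 2 t) * Re (\<zeta>\<^sup>2) + (k0 3 t + K 3 t) * Re (\<zeta> ^ 3))" for t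
      have "f t \<le> ln (cmod (hstep \<eta> (\<eta> * (1 + Q t)) z)) + v t (hstep \<eta> (\<eta> * (1 + Q t)) z)" for t
        using C[OF \<eta>(1) \<eta>1 z, of t]
        unfolding Let_def \<zeta>_def[symmetric] r_def[symmetric] r2_def[symmetric] v_def[symmetric]
        by (simp add: f_def K_def k_def algebra_simps)
      then have "branch_avg f y \<le> branch_avg (\<lambda>t. ln (cmod (hstep \<eta> (\<eta> * (1 + Q t)) z)) + v t (hstep \<eta> (\<eta> * (1 + Q t)) z)) y"
        by (rule branch_avg_mono)
      moreover have bf: "branch_avg f y = ln (cmod z) - C * \<eta> ^ 3 - \<eta> * (A * r + D * r2) + \<eta> * r * (branch_avg Q y + branch_avg G y)
        + \<eta>\<^sup>2 * ((branch_avg (k0 0) y + branch_avg (K 0) y) + (branch_avg (k0 1) y + branch_avg (K 1) y) * Re \<zeta>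
          + (branch_avg (k0 2) y + branch_avg (K 2) y) * Re (\<zeta>\<^sup>2) + (branch_avg (k0 3) y + branch_avg (K 3) y) * Re (\<zeta> ^ 3))"
        unfolding f_def branch_avg_def by (simp add: field_simps)
      \<comment> \<open>First-order cancellation: the branch average of \<open>Q + G\<close> is
        \<open>G\<close> again, so the averaged first-order term reproduces the one in
        \<open>v\<close>.\<close>
      moreover have pg: "branch_avg Q y + branch_avg G y = G y" using G(3)[of y] by simp
      moreover have vv: "v y z = \<eta> * ((G y - A) * r - D * r2)
          + \<eta>\<^sup>2 * (k0 0 y + k0 1 y * Re \<zeta> + k0 2 y * Re (\<zeta>\<^sup>2) + k0 3 y * Re (\<zeta> ^ 3))"
        unfolding v_def corrector_def Let_def \<zeta>_def[symmetric] r_def[symmetric] r2_def[symmetric] by (simp add: k_def)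
      moreover have "C * \<eta> ^ 3 \<le> \<eta>\<^sup>2 * (\<sigma> / 16)"
        using mult_left_mono[OF C\<eta>, of "\<eta>\<^sup>2"] by (simp add: power2_eq_square power3_eq_cube mult_ac)
      moreover have "branch_avg f y = ln (cmod z) - C * \<eta> ^ 3 + v y z + \<eta>\<^sup>2 * (\<sigma> / 8)"
        unfolding bf pg k0(2) Kmean vv by (simp add: algebra_simps)
      ultimately show ?thesis by linarith
    qed
    have "uniform_drift \<eta> (\<lambda>t. \<eta> * (1 + Q t)) (\<eta>\<^sup>2 * (\<sigma> / 16)) m v"
      unfolding uniform_drift_def using \<eta> \<sigma> vm drift by simp
    then show "\<exists>\<delta> M v. uniform_drift \<eta> (\<lambda>t. \<eta> * (1 + Q t)) \<delta> M v" by blast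
  qed
qed

subsection \<open>Birkhoff averages and the rotation number\<close>

text \<open>Borel-Cantelli by integration: the sum of the functions has a finite integral, hence is
  finite almost everywhere, and then its terms tend to zero.\<close>

lemma AE_tendsto_0_of_summable_mean:
  fixes u :: "nat \<Rightarrow> real \<Rightarrow> real"
  assumes cont: "\<And>n. continuous_on UNIV (u n)" and nonneg: "\<And>n x. 0 \<le> u n x"
    and sum: "summable (\<lambda>n. circle_mean (u n))"
  shows "AE x in circle. (\<lambda>n. u n x) \<longlonglongrightarrow> 0"
proof -
  have int: "integrable circle (u n)" for n by (rule integrable_circle_continuous(1)[OF cont])
  have mu: "(\<lambda>x. ennreal (u n x)) \<in> borel_measurable circle" for n
    by (rule measurable_compose[OF borel_measurable_integrable[OF int] measurable_ennreal])
  have m0: "0 \<le> circle_mean (u n)" for n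
    unfolding circle_mean_def by (intro Bochner_Integration.integral_nonneg nonneg)
  have "(\<integral>\<^sup>+x. (\<Sum>n. ennreal (u n x)) \<partial>circle) = (\<Sum>n. \<integral>\<^sup>+x. ennreal (u n x) \<partial>circle)"
    by (rule nn_integral_suminf[OF mu])
  also have "\<dots> = (\<Sum>n. ennreal (circle_mean (u n)))"
    unfolding circle_mean_def by (simp only: nn_integral_eq_integral[OF int AE_I2[OF nonneg]])
  also have "\<dots> \<noteq> \<infinity>"
    using suminf_ennreal2[OF m0 sum] by simp
  finally have "(\<integral>\<^sup>+x. (\<Sum>n. ennreal (u n x)) \<partial>circle) \<noteq> \<infinity>" .
  moreover have "(\<lambda>x. \<Sum>n. ennreal (u n x)) \<in> borel_measurable circle"
    by (rule borel_measurable_suminf_order[OF mu])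
  ultimately have "AE x in circle. (\<Sum>n. ennreal (u n x)) \<noteq> \<infinity>"
    by (intro nn_integral_PInf_AE)
  then show ?thesis
  proof eventually_elim
    case (elim x)
    then have "summable (\<lambda>n. u n x)"
      by (intro summable_suminf_not_top nonneg) (simp add: top_ennreal_def)
    then show ?case by (rule summable_LIMSEQ_zero)
  qed
qed

text \<open>Correlations at index distance \<open>d\<close> are at most
  \<open>L\<^sup>2 / 2 ^ d\<close>. One more summand adds its own square and twice a geometric sum
  of value at most one, which explains the factor 3.\<close>

lemma birkhoff_sum_variance:
  assumes f: "circle_lipschitz L f" "circle_mean f = 0" and m: "1 \<le> m"
  shows "circle_mean (\<lambda>x. (\<Sum>j<k. f (2 ^ (m * j) * x))\<^sup>2) \<le> 3 * L\<^sup>2 * real k"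
proof -
  have L: "0 \<le> L" by (rule circle_lipschitz_nonneg[OF f(1)])
  have per: "circle_periodic f" by (rule circle_lipschitz_periodic[OF f(1)])
  have cf: "continuous_on UNIV f" by (rule circle_lipschitz_continuous[OF f(1)])
  have c: "continuous_on UNIV (\<lambda>x. f (2 ^ n * x))" for n
    by (intro continuous_on_compose2[OF cf] continuous_intros) auto
  have bound: "\<bar>f x\<bar> \<le> L" for x using circle_lipschitz_dist_mean[OF f(1), of x] f(2) by simp
  have corr: "circle_mean (\<lambda>x. f (2 ^ (m * i) * x) * f (2 ^ (m * k) * x)) \<le> L\<^sup>2 * (1 / 2) ^ (k - i)" if "i \<le> k" for i k
  proof -
    let ?h = "\<lambda>y. f y * f (2 ^ (m * (k - i)) * y)"
    have "m * k = m * (k - i) + m * i" using that by (simp flip: add_mult_distrib2)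
    then have "(2::real) ^ (m * k) = 2 ^ (m * (k - i)) * 2 ^ (m * i)" by (simp only: power_add)
    then have eq: "f (2 ^ (m * i) * x) * f (2 ^ (m * k) * x) = ?h (2 ^ (m * i) * x)" for x
      by (simp add: mult.assoc)
    have "circle_periodic ?h"
      using per circle_periodic_power2[OF per, where n = "m * (k - i)"] by (simp add: circle_periodic_def)
    then have "circle_mean (\<lambda>x. f (2 ^ (m * i) * x) * f (2 ^ (m * k) * x)) = circle_mean ?h"
      unfolding eq by (intro circle_mean_pullback continuous_on_mult cf c)
    also have "\<dots> = circle_mean (\<lambda>x. (branch_avg ^^ (m * (k - i))) f x * f x)"
      by (rule circle_mean_mult_pullback[OF cf cf per])
    also have "\<dots> \<le> L\<^sup>2 * (1 / 2) ^ (k - i)"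
    proof -
      have "\<bar>(branch_avg ^^ (m * (k - i))) f x * f x\<bar> \<le> L\<^sup>2 * (1 / 2) ^ (k - i)" for x
      proof -
        have "\<bar>(branch_avg ^^ (m * (k - i))) f x\<bar> \<le> L / 2 ^ (m * (k - i))"
          using branch_iter_lipschitz_dist_mean[OF f(1), of "m * (k - i)" x] f(2) by simp
        also have "\<dots> \<le> L / 2 ^ (k - i)"
          using m L by (intro divide_left_mono power_increasing) auto
        finally have "\<bar>(branch_avg ^^ (m * (k - i))) f x * f x\<bar> \<le> L / 2 ^ (k - i) * L"
          unfolding abs_mult using bound[of x] L by (intro mult_mono) auto
        also have "L / 2 ^ (k - i) * L = L\<^sup>2 * (1 / 2) ^ (k - i)"
          by (simp add: power2_eq_square power_divide)
        finally show ?thesis .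
      qed
      then have "\<bar>circle_mean (\<lambda>x. (branch_avg ^^ (m * (k - i))) f x * f x)\<bar> \<le> L\<^sup>2 * (1 / 2) ^ (k - i)"
        by (intro abs_circle_mean_le continuous_on_mult continuous_branch_iter cf)
      then show ?thesis by simp
    qed
    finally show ?thesis .
  qed
  show ?thesis
  proof (induction k)
    case 0
    show ?case by simp
  next
    case (Suc k)
    let ?S = "\<lambda>x. \<Sum>j<k. f (2 ^ (m * j) * x)" and ?f = "\<lambda>x. f (2 ^ (m * k) * x)"
    have cS: "continuous_on UNIV ?S" by (intro continuous_on_sum c)
    have "circle_mean (\<lambda>x. (\<Sum>j<Suc k. f (2 ^ (m * j) * x))\<^sup>2)
        = circle_mean (\<lambda>x. (?S x)\<^sup>2 + 2 * (\<Sum>i<k. f (2 ^ (m * i) * x) * ?f x) + ?f x * ?f x)"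
    proof -
      have "(s + t)\<^sup>2 = s\<^sup>2 + 2 * (s * t) + t * t" for s t :: real
        by (simp add: power2_eq_square algebra_simps)
      then show ?thesis by (simp only: sum.lessThan_Suc sum_distrib_right)
    qed
    also have "\<dots> = circle_mean (\<lambda>x. (?S x)\<^sup>2) + 2 * (\<Sum>i<k. circle_mean (\<lambda>x. f (2 ^ (m * i) * x) * ?f x))
        + circle_mean (\<lambda>x. ?f x * ?f x)"
    proof -
      have c1: "continuous_on UNIV (\<lambda>x. (?S x)\<^sup>2)" and c2: "continuous_on UNIV (\<lambda>x. ?f x * ?f x)"
        and c3: "continuous_on UNIV (\<lambda>x. f (2 ^ (m * i) * x) * ?f x)" for i
        by (intro continuous_on_power continuous_on_mult c cS)+
      have c4: "continuous_on UNIV (\<lambda>x. 2 * (\<Sum>i<k. f (2 ^ (m * i) * x) * ?f x))"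
        by (intro continuous_on_mult continuous_on_const continuous_on_sum c)
      show ?thesis
        unfolding circle_mean_add[OF continuous_on_add[OF c1 c4] c2] circle_mean_add[OF c1 c4] circle_mean_cmult
        by (subst circle_mean_sum[OF c3]) (rule refl)
    qed
    also have "\<dots> \<le> 3 * L\<^sup>2 * real k + 2 * (\<Sum>i<k. L\<^sup>2 * (1 / 2) ^ (k - i)) + L\<^sup>2 * (1 / 2) ^ (k - k)"
      by (intro add_mono Suc mult_left_mono sum_mono corr) auto
    also have "(\<Sum>i<k. L\<^sup>2 * (1 / 2) ^ (k - i)) \<le> L\<^sup>2"
    proof -
      have "(\<Sum>i<k. (1 / 2 :: real) ^ (k - i)) = 1 - (1 / 2) ^ k"
      proof (induction k)
        case (Suc k)
        have "(\<Sum>i<Suc k. (1 / 2 :: real) ^ (Suc k - i)) = (\<Sum>i<k. 1 / 2 * (1 / 2) ^ (k - i)) + 1 / 2"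
          by (simp add: Suc_diff_le)
        then show ?case unfolding sum_distrib_left[symmetric] Suc by simp
      qed simp
      then show ?thesis unfolding sum_distrib_left[symmetric] by (simp add: mult_left_le)
    qed
    finally show ?case by (simp add: algebra_simps)
  qed
qed

text \<open>The gap after \<open>n\<^sup>2\<close> has length of order \<open>n\<close>, negligible
  against \<open>n\<^sup>2\<close>, so bounded increments cannot spoil the limit between
  squares.\<close>

lemma tendsto_ratio_of_squares:
  fixes S :: "nat \<Rightarrow> real"
  assumes lim: "(\<lambda>n. S (n\<^sup>2) / real (n\<^sup>2)) \<longlonglongrightarrow> 0" and inc: "\<And>k. \<bar>S (Suc k) - S k\<bar> \<le> L"
  shows "(\<lambda>k. S k / real k) \<longlonglongrightarrow> 0"
proof -
  have L: "0 \<le> L" using inc[of 0] by linarith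
  have diff: "\<bar>S (j + i) - S j\<bar> \<le> real i * L" for i j
  proof (induction i)
    case (Suc i)
    then show ?case using inc[of "j + i"] by (simp add: algebra_simps)
  qed simp
  define r where "r k = nat \<lfloor>sqrt (real k)\<rfloor>" for k
  have r_le: "(r k)\<^sup>2 \<le> k" and r_gt: "k \<le> (r k)\<^sup>2 + 2 * r k" for k
  proof -
    have 1: "real (r k) \<le> sqrt (real k)" "sqrt (real k) < real (r k) + 1"
      by (simp_all add: r_def)
    have "(real (r k))\<^sup>2 \<le> (sqrt (real k))\<^sup>2" using 1 by (intro power_mono) auto
    then have "real ((r k)\<^sup>2) \<le> real k" by simp
    then show "(r k)\<^sup>2 \<le> k" by (simp only: of_nat_le_iff)
    have "(sqrt (real k))\<^sup>2 < (real (r k) + 1)\<^sup>2" using 1 by (intro power_strict_mono) auto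
    then have "real k < real ((r k + 1)\<^sup>2)" by (simp add: add.commute)
    then have "k < (r k + 1)\<^sup>2" by (simp only: of_nat_less_iff)
    then show "k \<le> (r k)\<^sup>2 + 2 * r k" by (simp add: power2_eq_square)
  qed
  have rlim: "filterlim r at_top sequentially"
    unfolding r_def
    by (rule filterlim_compose[OF filterlim_nat_sequentially filterlim_compose[OF filterlim_floor_sequentially
        filterlim_compose[OF sqrt_at_top filterlim_real_sequentially]]])
  have "(\<lambda>k. \<bar>S ((r k)\<^sup>2) / real ((r k)\<^sup>2)\<bar> + 2 * L / real (r k)) \<longlonglongrightarrow> 0"
  proof -
    have "(\<lambda>n. \<bar>S (n\<^sup>2) / real (n\<^sup>2)\<bar> + 2 * L / real n) \<longlonglongrightarrow> \<bar>0\<bar> + 0"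
      by (intro tendsto_add tendsto_rabs lim lim_const_over_n)
    then have "(\<lambda>n. \<bar>S (n\<^sup>2) / real (n\<^sup>2)\<bar> + 2 * L / real n) \<longlonglongrightarrow> 0" by simp
    from filterlim_compose[OF this rlim] show ?thesis .
  qed
  moreover have "\<forall>\<^sub>F k in sequentially. norm (S k / real k) \<le> \<bar>S ((r k)\<^sup>2) / real ((r k)\<^sup>2)\<bar> + 2 * L / real (r k)"
  proof -
    have "\<forall>\<^sub>F k in sequentially. 1 \<le> r k" using rlim by (auto simp: filterlim_at_top)
    then show ?thesis
    proof eventually_elim
      case (elim k)
      have pos: "0 < real ((r k)\<^sup>2)" "0 < real (r k)" using elim by auto
      have le: "real ((r k)\<^sup>2) \<le> real k" using r_le[of k] by (simp only: of_nat_le_iff)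
      have "\<bar>S ((r k)\<^sup>2 + (k - (r k)\<^sup>2)) - S ((r k)\<^sup>2)\<bar> \<le> real (k - (r k)\<^sup>2) * L" by (rule diff)
      also have "\<dots> \<le> real (2 * r k) * L"
        using r_gt[of k] L by (intro mult_right_mono) auto
      finally have "\<bar>S k\<bar> \<le> \<bar>S ((r k)\<^sup>2)\<bar> + 2 * real (r k) * L"
        using r_le[of k] by simp
      then have "\<bar>S k\<bar> / real k \<le> (\<bar>S ((r k)\<^sup>2)\<bar> + 2 * real (r k) * L) / real ((r k)\<^sup>2)"
        using pos le L by (intro frac_le) auto
      also have "\<dots> = \<bar>S ((r k)\<^sup>2) / real ((r k)\<^sup>2)\<bar> + 2 * L / real (r k)"
        using pos by (simp add: add_divide_distrib power2_eq_square)
      finally show ?case by simp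
    qed
  qed
  ultimately show ?thesis by (rule Lim_null_comparison[rotated])
qed

text \<open>Along squares the mean square of the centred average is at most
  \<open>3 * L\<^sup>2 / n\<^sup>2\<close>, which is summable; the gaps are filled by bounded
  increments. The parameter \<open>m\<close> allows averages over consecutive orbit blocks of that
  length.\<close>

theorem birkhoff_average_tendsto:
  assumes g: "circle_lipschitz L g" and m: "1 \<le> m"
  shows "AE x in circle. (\<lambda>k. (\<Sum>j<k. g (2 ^ (m * j) * x)) / real k) \<longlonglongrightarrow> circle_mean g"
proof -
  define f where "f x = g x - circle_mean g" for x
  have f: "circle_lipschitz L f" using g by (simp add: circle_lipschitz_def circle_periodic_def f_def)
  have f0: "circle_mean f = 0"
    unfolding f_def by (simp add: circle_mean_diff circle_lipschitz_continuous[OF g])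
  define S where "S k x = (\<Sum>j<k. f (2 ^ (m * j) * x))" for k x
  have cf: "continuous_on UNIV f" by (rule circle_lipschitz_continuous[OF f])
  have cS: "continuous_on UNIV (S k)" for k
    unfolding S_def by (intro continuous_on_sum continuous_on_compose2[OF cf] continuous_intros) auto
  have "AE x in circle. (\<lambda>n. (S (n\<^sup>2) x / real (n\<^sup>2))\<^sup>2) \<longlonglongrightarrow> 0"
  proof (rule AE_tendsto_0_of_summable_mean)
    have "circle_mean (\<lambda>x. (S (n\<^sup>2) x / real (n\<^sup>2))\<^sup>2) \<le> 3 * L\<^sup>2 * inverse (real n ^ 2)"
      and "0 \<le> circle_mean (\<lambda>x. (S (n\<^sup>2) x / real (n\<^sup>2))\<^sup>2)" for n
    proof -
      have eq: "circle_mean (\<lambda>x. (S (n\<^sup>2) x / real (n\<^sup>2))\<^sup>2) = inverse ((real (n\<^sup>2))\<^sup>2) * circle_mean (\<lambda>x. (S (n\<^sup>2) x)\<^sup>2)"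
      proof -
        have "(s / r)\<^sup>2 = inverse (r\<^sup>2) * s\<^sup>2" for s r :: real
          by (simp add: power_mult_distrib power_inverse divide_inverse mult.commute)
        then show ?thesis by (simp only: circle_mean_cmult)
      qed
      have "circle_mean (\<lambda>x. (S (n\<^sup>2) x)\<^sup>2) \<le> 3 * L\<^sup>2 * real (n\<^sup>2)"
        unfolding S_def by (rule birkhoff_sum_variance[OF f f0 m])
      then have "inverse ((real (n\<^sup>2))\<^sup>2) * circle_mean (\<lambda>x. (S (n\<^sup>2) x)\<^sup>2) \<le> inverse ((real (n\<^sup>2))\<^sup>2) * (3 * L\<^sup>2 * real (n\<^sup>2))"
        by (intro mult_left_mono) auto
      also have "\<dots> = 3 * L\<^sup>2 * inverse (real n ^ 2)"
        by (cases "n = 0") (simp_all add: field_simps power2_eq_square)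
      finally show "circle_mean (\<lambda>x. (S (n\<^sup>2) x / real (n\<^sup>2))\<^sup>2) \<le> 3 * L\<^sup>2 * inverse (real n ^ 2)"
        unfolding eq .
      show "0 \<le> circle_mean (\<lambda>x. (S (n\<^sup>2) x / real (n\<^sup>2))\<^sup>2)"
        unfolding circle_mean_def by (intro Bochner_Integration.integral_nonneg) auto
    qed
    then show "summable (\<lambda>n. circle_mean (\<lambda>x. (S (n\<^sup>2) x / real (n\<^sup>2))\<^sup>2))"
      by (intro summable_comparison_test'[OF summable_mult[OF inverse_power_summable[of 2]], where N = 0]) auto
  qed (auto intro!: continuous_intros cS simp: divide_inverse)
  then show ?thesis
  proof eventually_elim
    case (elim x)
    then have "(\<lambda>n. S (n\<^sup>2) x / real (n\<^sup>2)) \<longlonglongrightarrow> 0"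
      using tendsto_real_sqrt[OF elim] by (simp add: tendsto_rabs_zero_iff)
    moreover have "\<bar>S (Suc k) x - S k x\<bar> \<le> L" for k
      using circle_lipschitz_dist_mean[OF f, of "2 ^ (m * k) * x"] f0 by (simp add: S_def)
    ultimately have "(\<lambda>k. S k x / real k) \<longlonglongrightarrow> 0" by (rule tendsto_ratio_of_squares)
    then have "(\<lambda>k. S k x / real k + circle_mean g) \<longlonglongrightarrow> 0 + circle_mean g" by (intro tendsto_intros)
    then have "(\<lambda>k. S k x / real k + circle_mean g) \<longlonglongrightarrow> circle_mean g" by simp
    moreover have "\<forall>\<^sub>F k in sequentially. S k x / real k + circle_mean g = (\<Sum>j<k. g (2 ^ (m * j) * x)) / real k"
      using eventually_gt_at_top[of 0]
      by eventually_elim (simp add: S_def f_def sum_subtractf field_simps)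
    ultimately show ?case by (rule Lim_transform_eventually)
  qed
qed

text \<open>Reading \<open>I (k * m)\<close> both as \<open>k\<close> blocks and as \<open>m\<close>
  blocks gives \<open>\<bar>I k / k - I m / m\<bar> \<le> C / m + C / k\<close>, a Cauchy condition
  with a rate.\<close>

lemma near_additive_convergent:
  fixes I :: "nat \<Rightarrow> real"
  assumes add: "\<And>k m. \<bar>I (k * m) - real k * I m\<bar> \<le> C * real k"
  obtains l where "(\<lambda>n. I n / real n) \<longlonglongrightarrow> l" "\<And>m. 0 < m \<Longrightarrow> \<bar>I m / real m - l\<bar> \<le> C / real m"
proof -
  have close: "\<bar>I k / real k - I m / real m\<bar> \<le> C / real m + C / real k" if "0 < k" "0 < m" for k m
  proof -
    have "\<bar>real k * I m - real m * I k\<bar> \<le> C * real k + C * real m"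
      using add[of k m] add[of m k] by (simp add: mult.commute)
    then have "\<bar>real k * I m - real m * I k\<bar> / (real k * real m) \<le> (C * real k + C * real m) / (real k * real m)"
      by (intro divide_right_mono) auto
    moreover have "\<bar>real k * I m - real m * I k\<bar> / (real k * real m) = \<bar>I k / real k - I m / real m\<bar>"
    proof -
      have "I m / real m - I k / real k = (real k * I m - real m * I k) / (real k * real m)"
        using that by (simp add: field_simps)
      then have "\<bar>I m / real m - I k / real k\<bar> = \<bar>real k * I m - real m * I k\<bar> / (real k * real m)"
        using that by (simp only: abs_divide abs_mult abs_of_nat)
      then show ?thesis by (simp only: abs_minus_commute)
    qed
    moreover have "(C * real k + C * real m) / (real k * real m) = C / real m + C / real k"
      using that by (simp add: field_simps)
    ultimately show ?thesis by simp
  qed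
  have C0: "0 \<le> C" using add[of 1 1] abs_ge_zero[of "I (1 * 1) - real 1 * I 1"] by linarith
  have lim0: "(\<lambda>n. C / real n) \<longlonglongrightarrow> 0" by (rule lim_const_over_n)
  have "Cauchy (\<lambda>n. I n / real n)"
  proof (rule metric_CauchyI)
    fix e :: real assume "0 < e"
    then have "0 < e / 2" by simp
    from order_tendstoD(2)[OF lim0 this] eventually_gt_at_top[of 0]
    have "\<forall>\<^sub>F n in sequentially. C / real n < e / 2 \<and> 0 < n" by (rule eventually_conj)
    then obtain N where N: "\<And>n. n \<ge> N \<Longrightarrow> C / real n < e / 2 \<and> 0 < n"
      by (auto simp: eventually_sequentially)
    show "\<exists>N. \<forall>m\<ge>N. \<forall>n\<ge>N. dist (I m / real m) (I n / real n) < e"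
    proof (intro exI allI impI)
      fix m n assume "N \<le> m" "N \<le> n"
      then have "C / real m < e / 2" "C / real n < e / 2" "0 < m" "0 < n" using N by auto
      then show "dist (I m / real m) (I n / real n) < e"
        unfolding dist_real_def using close[of m n] by linarith
    qed
  qed
  then obtain l where l: "(\<lambda>n. I n / real n) \<longlonglongrightarrow> l"
    using Cauchy_convergent convergent_def by blast
  have "\<bar>I m / real m - l\<bar> \<le> C / real m" if "0 < m" for m
  proof (rule LIMSEQ_le)
    show "(\<lambda>k. \<bar>I m / real m - I k / real k\<bar>) \<longlonglongrightarrow> \<bar>I m / real m - l\<bar>" by (intro tendsto_intros l)
    have "(\<lambda>k. C / real m + C / real k) \<longlonglongrightarrow> C / real m + 0" by (intro tendsto_intros lim0)
    then show "(\<lambda>k. C / real m + C / real k) \<longlonglongrightarrow> C / real m" by simp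
    show "\<exists>N. \<forall>k\<ge>N. \<bar>I m / real m - I k / real k\<bar> \<le> C / real m + C / real k"
    proof (intro exI[of _ 1] allI impI)
      fix k :: nat assume "1 \<le> k"
      then show "\<bar>I m / real m - I k / real k\<bar> \<le> C / real m + C / real k"
        using close[of k m] that by (simp add: abs_minus_commute)
    qed
  qed
  then show thesis using that l by blast
qed

text \<open>The deterministic half of an ergodic theorem for almost additive sequences: block sums
  average correctly for each block length \<open>m\<close>, and a defect \<open>C\<close> per block
  is only \<open>C / m\<close> per site.\<close>

lemma block_average_tendsto:
  fixes \<theta> :: "nat \<Rightarrow> real" and s :: "nat \<Rightarrow> nat \<Rightarrow> real"
  assumes blocks: "\<And>m k. \<bar>\<theta> (k * m) - s m k\<bar> \<le> C * real k"
    and rest: "\<And>m k r. r < m \<Longrightarrow> \<bar>\<theta> (k * m + r) - \<theta> (k * m)\<bar> \<le> C * real (m + 1)"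
    and avg: "\<And>m. 1 \<le> m \<Longrightarrow> (\<lambda>k. s m k / real k) \<longlonglongrightarrow> I m"
    and I: "\<And>m. 0 < m \<Longrightarrow> \<bar>I m / real m - l\<bar> \<le> C / real m"
  shows "(\<lambda>n. \<theta> n / real n) \<longlonglongrightarrow> l"
proof (rule tendstoI)
  fix e :: real assume e: "0 < e"
  have C0: "0 \<le> C" using blocks[of 1 1] abs_ge_zero[of "\<theta> (1 * 1) - s 1 1"] by linarith
  have "(\<lambda>n. C / real n) \<longlonglongrightarrow> 0" by (rule lim_const_over_n)
  from order_tendstoD(2)[OF this, of "e / 4"] e eventually_gt_at_top[of 0]
  have "\<forall>\<^sub>F n in sequentially. C / real n < e / 4 \<and> 0 < n" by (intro eventually_conj) simp_all
  \<comment> \<open>The error \<open>e\<close> is split into four: the defect per block, the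
    deviation of \<open>I m / m\<close> from \<open>l\<close>, the convergence of the block
    averages, and the incomplete last block.\<close>
  then obtain m where m: "C / real m < e / 4" "0 < m" by (auto simp: eventually_sequentially)
  have divlim: "filterlim (\<lambda>n. n div m) at_top sequentially"
    unfolding filterlim_at_top
  proof
    fix Z
    show "\<forall>\<^sub>F n in sequentially. Z \<le> n div m"
      using eventually_ge_at_top[of "Z * m"]
      by eventually_elim (use m in \<open>simp add: less_eq_div_iff_mult_less_eq\<close>)
  qed
  have s1: "(\<lambda>n. s m (n div m) / real (n div m)) \<longlonglongrightarrow> I m"
    using filterlim_compose[OF avg divlim] m by simp
  have r1: "(\<lambda>n. real (n div m) / real n) \<longlonglongrightarrow> 1 / real m"
  proof -
    have "(\<lambda>n. 1 / real m - real (n mod m) / real m / real n) \<longlonglongrightarrow> 1 / real m - 0"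
    proof (intro tendsto_intros)
      show "(\<lambda>n. real (n mod m) / real m / real n) \<longlonglongrightarrow> 0"
      proof (rule Lim_null_comparison)
        show "\<forall>\<^sub>F n in sequentially. norm (real (n mod m) / real m / real n) \<le> 1 / real n"
        proof (rule always_eventually, rule allI)
          fix n
          have "real (n mod m) / real m \<le> 1" using m by (simp add: less_imp_le)
          then have "real (n mod m) / real m / real n \<le> 1 / real n" by (intro divide_right_mono) auto
          moreover have "0 \<le> real (n mod m) / real m / real n" by simp
          ultimately show "norm (real (n mod m) / real m / real n) \<le> 1 / real n"
            by (simp only: real_norm_def abs_of_nonneg)
        qed
        show "(\<lambda>n. 1 / real n) \<longlonglongrightarrow> 0" by (rule lim_const_over_n)
      qed
    qed
    moreover have "\<forall>\<^sub>F n in sequentially. 1 / real m - real (n mod m) / real m / real n = real (n div m) / real n"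
      using eventually_gt_at_top[of 0]
    proof eventually_elim
      case (elim n)
      have "real n = real (n div m) * real m + real (n mod m)"
        by (metis of_nat_add of_nat_mult div_mult_mod_eq)
      then have "real (n mod m) = real n - real (n div m) * real m" by simp
      then have "real (n mod m) / real m / real n = 1 / real m - real (n div m) / real n"
        using m elim by (simp add: diff_divide_distrib)
      then show ?case by simp
    qed
    ultimately show ?thesis by (auto intro: Lim_transform_eventually)
  qed
  have "(\<lambda>n. s m (n div m) / real (n div m) * (real (n div m) / real n)) \<longlonglongrightarrow> I m * (1 / real m)"
    by (intro tendsto_mult s1 r1)
  then have "(\<lambda>n. s m (n div m) / real (n div m) * (real (n div m) / real n)) \<longlonglongrightarrow> I m / real m"
    by simp
  from tendstoD[OF this, of "e / 4"] e
  have e1: "\<forall>\<^sub>F n in sequentially. \<bar>s m (n div m) / real (n div m) * (real (n div m) / real n) - I m / real m\<bar> < e / 4"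
    unfolding dist_real_def by simp
  have "(\<lambda>n. C * (real (m + 1)) / real n) \<longlonglongrightarrow> 0" by (rule lim_const_over_n)
  then have e2: "\<forall>\<^sub>F n in sequentially. C * (real (m + 1)) / real n < e / 4"
    using e by (auto dest!: order_tendstoD(2)[where a = "e / 4"])
  show "\<forall>\<^sub>F n in sequentially. dist (\<theta> n / real n) l < e"
    using e1 e2 eventually_ge_at_top[of m] eventually_gt_at_top[of 0]
  proof eventually_elim
    case (elim n)
    have k: "0 < n div m" using elim m by (simp add: div_greater_zero_iff)
    have "\<bar>\<theta> (n div m * m + n mod m) - \<theta> (n div m * m)\<bar> \<le> C * real (m + 1)"
      by (rule rest) (use m in simp)
    then have "\<bar>\<theta> n - s m (n div m)\<bar> \<le> C * real (m + 1) + C * real (n div m)"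
      using blocks[of "n div m" m] by simp
    then have "\<bar>\<theta> n - s m (n div m)\<bar> / real n \<le> (C * real (m + 1) + C * real (n div m)) / real n"
      by (intro divide_right_mono) auto
    also have "\<dots> = C * real (m + 1) / real n + C * (real (n div m) / real n)"
      by (simp add: add_divide_distrib)
    also have "C * (real (n div m) / real n) \<le> C * (1 / real m)"
    proof (intro mult_left_mono C0)
      have "real (n div m * m) \<le> real n" by (simp only: of_nat_le_iff) simp
      then show "real (n div m) / real n \<le> 1 / real m" using m elim by (simp add: field_simps)
    qed
    also have "\<bar>\<theta> n - s m (n div m)\<bar> / real n = \<bar>\<theta> n / real n - s m (n div m) / real n\<bar>"
      using elim by (simp add: diff_divide_distrib[symmetric])
    finally have "\<bar>\<theta> n / real n - s m (n div m) / real n\<bar> \<le> C * real (m + 1) / real n + C / real m" by simp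
    moreover have "s m (n div m) / real (n div m) * (real (n div m) / real n) = s m (n div m) / real n"
      using k by simp
    ultimately show ?case
      using elim(1,2) m(1) I[OF m(2)] by (simp only: dist_real_def)
  qed
qed

text \<open>By \<open>Im_log_cocycle_diff\<close> the lifted angle is additive along the orbit up to
  \<open>2 * pi\<close>, whatever direction the second piece starts from. Birkhoff averages over
  blocks therefore suffice, for all of the countably many block lengths outside one null
  set.\<close>

theorem rotation_number_exists:
  assumes c: "circle_lipschitz L c" "\<And>x. 0 \<le> c x" "\<And>x. c x \<le> B" and e: "0 \<le> e" "e \<le> B"
  obtains l where "AE x in circle. (\<lambda>n. Im (log_cocycle e c n x 1) / real n) \<longlonglongrightarrow> l"
    "(\<lambda>n. circle_mean (\<lambda>x. Im (log_cocycle e c n x 1)) / real n) \<longlonglongrightarrow> l"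
proof -
  define \<theta> where "\<theta> n x = Im (log_cocycle e c n x 1)" for n x
  define C where "C = 2 * pi"
  have add: "\<bar>\<theta> (n + m) x - (\<theta> n (2 ^ m * x) + \<theta> m x)\<bar> \<le> C" for n m x
    using Im_log_cocycle_diff[OF c e, of "cocycle e c n (2 ^ m * x) 1" 1 m x]
    by (simp add: \<theta>_def log_cocycle_add C_def)
  have pos: "0 \<le> \<theta> n x" "\<theta> n x \<le> C * real n" for n x
    using Im_log_cocycle[of 1 e c n x] c(2) e by (simp_all add: \<theta>_def C_def)
  have lip: "\<exists>K. circle_lipschitz K (\<theta> n)" for n
  proof -
    obtain K where K: "0 \<le> K" "\<And>e e' x x' z w. 0 \<le> e \<Longrightarrow> e \<le> B \<Longrightarrow> 0 \<le> e' \<Longrightarrow> e' \<le> B \<Longrightarrow> z \<noteq> 0 \<Longrightarrow> w \<noteq> 0 \<Longrightarrow>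
      cmod (log_cocycle e c n x z - log_cocycle e' c n x' w) \<le> K * (\<bar>e - e'\<bar> + \<bar>x - x'\<bar> + line_dist z w)"
      by (rule log_cocycle_lipschitz[OF c]) (rule that)
    have "norm (\<theta> n x - \<theta> n y) \<le> K * \<bar>x - y\<bar>" for x y
      using K(2)[of e e 1 1 x y] e abs_Im_le_cmod[of "log_cocycle e c n x 1 - log_cocycle e c n y 1"]
      by (simp add: \<theta>_def line_dist_def)
    moreover have "circle_periodic (\<theta> n)"
      using circle_periodic_cocycle(2)[OF circle_lipschitz_periodic[OF c(1)]]
      by (simp add: circle_periodic_def \<theta>_def)
    ultimately show ?thesis by (auto simp: circle_lipschitz_def)
  qed
  have per: "circle_periodic (\<theta> n)" and cont: "continuous_on UNIV (\<theta> n)" for n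
    using lip[of n] circle_lipschitz_periodic circle_lipschitz_continuous by blast+
  define I where "I n = circle_mean (\<theta> n)" for n
  define s where "s x m k = (\<Sum>j<k. \<theta> m (2 ^ (m * j) * x))" for x m k
  have blocks: "\<bar>\<theta> (k * m) x - s x m k\<bar> \<le> C * real k" for k m x
  proof (induction k arbitrary: x)
    case 0
    show ?case by (simp add: s_def \<theta>_def)
  next
    case (Suc k)
    have "s x m (Suc k) = \<theta> m x + s (2 ^ m * x) m k"
      unfolding s_def by (subst sum.lessThan_Suc_shift) (simp add: power_add mult_ac)
    moreover have "\<bar>\<theta> (k * m + m) x - (\<theta> (k * m) (2 ^ m * x) + \<theta> m x)\<bar> \<le> C" by (rule add)
    moreover have "C * real (Suc k) = C * real k + C" by (simp add: distrib_left)
    ultimately show ?case using Suc[of "2 ^ m * x"] by (simp only: mult_Suc add.commute[of m])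
  qed
  have rest: "\<bar>\<theta> (k * m + r) x - \<theta> (k * m) x\<bar> \<le> C * real (m + 1)" if "r < m" for k m r x
  proof -
    have "\<bar>\<theta> (r + k * m) x - (\<theta> r (2 ^ (k * m) * x) + \<theta> (k * m) x)\<bar> \<le> C" by (rule add)
    moreover have "C * real r \<le> C * real m" using that by (intro mult_left_mono) (auto simp: C_def)
    moreover have "C * real (m + 1) = C * real m + C" by (simp add: distrib_left)
    ultimately show ?thesis using pos[of r "2 ^ (k * m) * x"] by (simp only: add.commute[of r])
  qed
  have "\<bar>I (k * m) - real k * I m\<bar> \<le> C * real k" for k m
  proof -
    have cs: "continuous_on UNIV (\<lambda>x. \<theta> m (2 ^ (m * j) * x))" for j
      by (intro continuous_on_compose2[OF cont] continuous_intros) auto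
    have "circle_mean (\<lambda>x. s x m k) = (\<Sum>j<k. circle_mean (\<lambda>x. \<theta> m (2 ^ (m * j) * x)))"
      unfolding s_def by (rule circle_mean_sum[OF cs])
    also have "\<dots> = real k * I m" by (simp add: circle_mean_pullback[OF cont per] I_def)
    finally have "I (k * m) - real k * I m = circle_mean (\<lambda>x. \<theta> (k * m) x - s x m k)"
      unfolding I_def s_def by (subst circle_mean_diff) (auto intro!: cont continuous_on_sum cs)
    also have "\<bar>\<dots>\<bar> \<le> C * real k"
      unfolding s_def by (intro abs_circle_mean_le blocks[unfolded s_def] continuous_on_diff cont continuous_on_sum cs)
    finally show ?thesis .
  qed
  then obtain l where l: "(\<lambda>n. I n / real n) \<longlonglongrightarrow> l" "\<And>m. 0 < m \<Longrightarrow> \<bar>I m / real m - l\<bar> \<le> C / real m"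
    by (rule near_additive_convergent) (rule that)
  have "AE x in circle. (\<lambda>k. s x m k / real k) \<longlonglongrightarrow> I m" if "1 \<le> m" for m
  proof -
    obtain K where "circle_lipschitz K (\<theta> m)" using lip by blast
    from birkhoff_average_tendsto[OF this that] show ?thesis unfolding s_def I_def .
  qed
  then have "AE x in circle. \<forall>m\<in>{1..}. (\<lambda>k. s x m k / real k) \<longlonglongrightarrow> I m"
    by (subst AE_ball_countable) auto
  then have "AE x in circle. (\<lambda>n. \<theta> n x / real n) \<longlonglongrightarrow> l"
  proof eventually_elim
    case (elim x)
    show ?case
      by (rule block_average_tendsto[where s = "s x" and C = C and I = I]) (use blocks rest elim l in auto)
  qed
  then show thesis using l(1) unfolding \<theta>_def I_def by (rule that)
qed

subsection \<open>Counting eigenvalues\<close>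

lemma Im_eq_Arg_diff:
  assumes "z \<noteq> 0" "w = z * exp l"
  obtains k :: int where "Im l = Im (Ln w) - Im (Ln z) + 2 * pi * of_int k"
proof -
  have "w \<noteq> 0" using assms by simp
  then have "exp (Ln w) = exp (Ln z + l)" using assms by (simp add: exp_add)
  then obtain n :: int where "Ln w = Ln z + l + complex_of_real (of_int (2 * n) * pi) * \<i>"
    using exp_eq[of "Ln w" "Ln z + l"] by auto
  then have "Im (Ln w) = Im (Ln z) + Im l + of_int (2 * n) * pi" by simp
  then show thesis by (intro that[of "- n"]) (simp add: algebra_simps)
qed

lemma Im_eq_Arg_diff_unique:
  assumes "z \<noteq> 0" "w = z * exp l" "\<bar>Im l - (Im (Ln w) - Im (Ln z))\<bar> < 2 * pi"
  shows "Im l = Im (Ln w) - Im (Ln z)"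
proof -
  obtain k :: int where k: "Im l = Im (Ln w) - Im (Ln z) + 2 * pi * of_int k"
    by (rule Im_eq_Arg_diff[OF assms(1,2)]) (rule that)
  then have "2 * pi * \<bar>of_int k\<bar> < 2 * pi * 1" using assms(3) by (simp add: abs_mult)
  then have "\<bar>of_int k :: real\<bar> < 1" using pi_gt_zero by (simp only: mult_less_cancel_left_pos mult_pos_pos zero_less_numeral)
  then have "k = 0" by linarith
  then show ?thesis using k by simp
qed

lemma hstep_log_zero: "z \<noteq> 0 \<Longrightarrow> hstep_log 0 c z = shear_log c z"
  by (simp add: hstep_log_def shear_log_def shear_def)

lemma hstep_zero: "hstep 0 c z = shear c z"
  by (simp add: hstep_def shear_def)

text \<open>At energy zero a step is a shear that fixes the real part. The orbit stays in the right
  half plane, where the lifted angle is the change of the principal argument.\<close>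

lemma Im_log_cocycle_zero_energy:
  assumes "0 < Re z" "\<And>x. 0 \<le> c x"
  shows "Im (log_cocycle 0 c n x z) < pi / 2 - Im (Ln z)"
  using assms(1)
proof (induction n arbitrary: z)
  case 0
  have "\<bar>Im (Ln z)\<bar> < pi / 2" using Re_Ln_pos_lt[of z] 0 by (auto simp: complex_eq_iff)
  then show ?case by simp
next
  case (Suc n)
  let ?t = "c (2 ^ n * x)"
  have z: "z \<noteq> 0" using Suc.prems by auto
  have w: "0 < Re (shear ?t z)" using Suc.prems by simp
  then have w0: "shear ?t z \<noteq> 0" using z by simp
  have "\<bar>Im (Ln z)\<bar> < pi / 2" "\<bar>Im (Ln (shear ?t z))\<bar> < pi / 2"
    using Re_Ln_pos_lt[OF z] Re_Ln_pos_lt[OF w0] Suc.prems w by auto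
  then have "Im (shear_log ?t z) = Im (Ln (shear ?t z)) - Im (Ln z)"
    using Im_shear_log[OF z, of ?t] assms(2)[of "2 ^ n * x"] z
    by (intro Im_eq_Arg_diff_unique) (auto simp: exp_shear_log abs_less_iff)
  then show ?case using Suc.IH[OF w] by (simp add: hstep_log_zero[OF z] hstep_zero)
qed

lemma shear_minus: "shear t (- z) = - shear t z"
  by (simp add: complex_eq_iff)

lemma hstep_minus: "hstep e c (- z) = - hstep e c z"
  by (simp add: hstep_def shear_minus)

lemma hstep_log_minus: "hstep_log e c (- z) = hstep_log e c z"
  by (simp add: hstep_log_def shear_log_def shear_minus)

lemma log_cocycle_minus: "log_cocycle e c n x (- z) = log_cocycle e c n x z"
  by (induction n arbitrary: z) (simp_all add: hstep_log_minus hstep_minus)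

text \<open>For large \<open>e\<close> every step is a half turn up to a bounded error that does not accumulate.\<close>

lemma Im_log_cocycle_large_energy:
  assumes z: "0 < Re z" "b / 2 * Re z \<le> Im z" and b: "0 < b" "\<And>x. b \<le> c x" and e: "4 / b \<le> e"
  shows "real n * pi - Im (Ln z) \<le> Im (log_cocycle e c n x z)"
  using z
proof (induction n arbitrary: z)
  case 0
  have "0 < Im z" using 0 b by (smt (verit) divide_pos_pos mult_pos_pos)
  then show ?case using Im_Ln_pos_lt[of z] 0 by (auto simp: complex_eq_iff)
next
  case (Suc n)
  define t where "t = c (2 ^ n * x)"
  \<comment> \<open>The negative of a step preserves the cone \<open>b / 2 * Re z \<le> Im z\<close>
    in the right half plane as soon as \<open>4 \<le> e * b\<close>; the sign is the half
    turn.\<close>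
  define w where "w = - hstep e t z"
  have t: "b \<le> t" "0 \<le> t" using b(2)[of "2 ^ n * x"] b(1) by (auto simp: t_def)
  have e0: "0 < e" using e b(1) by (smt (verit) divide_pos_pos)
  have eb: "4 \<le> e * b" using e b(1) by (simp add: pos_divide_le_eq)
  define p q where "p = Re z" and "q = Im z"
  have p: "0 < p" and q: "b / 2 * p \<le> q" using Suc.prems by (auto simp: p_def q_def)
  have q0: "0 < q" using p q b(1) by (smt (verit) divide_pos_pos mult_pos_pos)
  have eq: "2 * p \<le> e * q"
  proof -
    have "4 * p \<le> e * b * p" using eb p by (intro mult_right_mono) auto
    also have "\<dots> = 2 * (e * (b / 2 * p))" by simp
    also have "\<dots> \<le> 2 * (e * q)" using q e0 by (intro mult_left_mono) auto
    finally show ?thesis by simp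
  qed
  have Rw: "Re w = e * q - p" and Iw: "Im w = t * (e * q - p) - q"
    by (simp_all add: w_def hstep_components p_def q_def algebra_simps)
  have Rw0: "0 < Re w" using eq p by (simp add: Rw)
  have qle: "q \<le> b / 2 * (e * q - p)"
  proof -
    have "4 * q \<le> e * b * q" using eb q0 by (intro mult_right_mono) auto
    also have "\<dots> = b * (e * q)" by simp
    also have "\<dots> \<le> b * (2 * (e * q - p))" using eq b(1) by (intro mult_left_mono) auto
    also have "\<dots> = 4 * (b / 2 * (e * q - p))" by simp
    finally show ?thesis by linarith
  qed
  have "b * (e * q - p) \<le> t * (e * q - p)" using t Rw0 by (intro mult_right_mono) (auto simp: Rw)
  then have ww: "b / 2 * Re w \<le> Im w" using qle unfolding Rw Iw by linarith
  then have Iw0: "0 < Im w" using Rw0 b(1) by (smt (verit) divide_pos_pos mult_pos_pos)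
  have nz: "z \<noteq> 0" "w \<noteq> 0" using Rw0 p by (auto simp: p_def)
  have Ln: "0 < Im (Ln z)" "Im (Ln z) < pi / 2" "0 < Im (Ln w)" "Im (Ln w) < pi / 2"
    using Re_Ln_pos_lt[OF nz(1)] Re_Ln_pos_lt[OF nz(2)] Im_Ln_pos_lt[OF nz(1)] Im_Ln_pos_lt[OF nz(2)]
      Rw0 p Iw0 q0 by (auto simp: p_def q_def)
  let ?l = "hstep_log e t z"
  have "w = z * exp (?l - \<i> * pi)"
    using exp_hstep_log[OF nz(1), of e t] by (simp add: w_def exp_diff)
  moreover have "0 \<le> Im ?l" "Im ?l < 2 * pi"
    using Im_hstep_log[OF nz(1), of e t] e0 t by auto
  ultimately have "Im (?l - \<i> * pi) = Im (Ln w) - Im (Ln z)"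
    using Ln by (intro Im_eq_Arg_diff_unique nz) (auto simp: abs_less_iff)
  then have "Im ?l = pi + Im (Ln w) - Im (Ln z)" by simp
  moreover have "real n * pi - Im (Ln w) \<le> Im (log_cocycle e c n x (- w))"
    unfolding log_cocycle_minus using Suc.IH[OF Rw0 ww] .
  ultimately show ?case by (simp add: t_def w_def algebra_simps)
qed

text \<open>With continuity in the energy, these bounds force the angle to cross \<open>pi\<close>,
  ..., \<open>(n - 1) * pi\<close>; each crossing will be an eigenvalue. The extra step takes
  \<open>1\<close> into the cone where the large-energy estimate starts.\<close>

lemma rotation_endpoints:
  assumes b: "0 < b" "\<And>x. b \<le> c x"
  shows "Im (log_cocycle 0 c n x 1) < pi"
    and "4 / b \<le> e \<Longrightarrow> real n * pi - pi / 2 \<le> Im (log_cocycle e c (Suc n) x 1)"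
proof -
  have c0: "0 \<le> c x" for x using b by (meson less_imp_le order_trans)
  show "Im (log_cocycle 0 c n x 1) < pi"
    using Im_log_cocycle_zero_energy[of 1 c n x] c0 pi_gt_zero by (simp del: pi_gt_zero)
  assume e: "4 / b \<le> e"
  then have e0: "0 \<le> e" using b(1) by (smt (verit) divide_nonneg_nonneg)
  let ?w = "hstep e (c (2 ^ n * x)) 1"
  have w: "Re ?w = 1" "Im ?w = c (2 ^ n * x)" by (simp_all add: hstep_components)
  have "?w \<noteq> 0" by simp
  then have "Im (Ln ?w) < pi / 2" using Re_Ln_pos_lt[of ?w] w by auto
  moreover have "real n * pi - Im (Ln ?w) \<le> Im (log_cocycle e c n x ?w)"
    using w b(1) b(2)[of "2 ^ n * x"] by (intro Im_log_cocycle_large_energy[OF _ _ b e]) auto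
  moreover have "0 \<le> Im (hstep_log e (c (2 ^ n * x)) 1)"
    using Im_hstep_log[of 1 e "c (2 ^ n * x)"] e0 c0 by simp
  ultimately show "real n * pi - pi / 2 \<le> Im (log_cocycle e c (Suc n) x 1)" by simp
qed

section \<open>Dirichlet eigenvalues as crossings of multiples of \<open>pi\<close>\<close>

lemma dirichlet_matrix_carrier: "dirichlet_matrix a x N \<in> carrier_mat N N"
  by (simp add: dirichlet_matrix_def)

text \<open>The condition \<open>u N = 0\<close> is the Dirichlet condition on the right, which
  makes the truncated last row agree with the operator; the left one is built into
  \<open>hamiltonian\<close>.\<close>

lemma dirichlet_matrix_mult_vec:
  assumes i: "i < N" and u: "u N = 0"
  shows "vec_index (mult_mat_vec (dirichlet_matrix a x N) (Matrix.vec N u)) i = hamiltonian a x u i"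
proof -
  have d: "(\<Sum>j<N. (if k = j then 1 else 0) * u j) = (if k < N then u k else 0)" for k
    by (simp add: if_distrib[of "\<lambda>t. t * _"] sum.delta' cong: if_cong)
  have "vec_index (mult_mat_vec (dirichlet_matrix a x N) (Matrix.vec N u)) i =
      (\<Sum>j<N. hamiltonian a x (\<lambda>k. if k = j then 1 else 0) i * u j)"
    using i by (simp add: dirichlet_matrix_def scalar_prod_def atLeast0LessThan)
  also have "\<dots> = - coef a x (i + 1) * (\<Sum>j<N. (if i + 1 = j then 1 else 0) * u j)
      + (coef a x i + coef a x (i + 1)) * (\<Sum>j<N. (if i = j then 1 else 0) * u j)
      - coef a x i * (if i = 0 then 0 else (\<Sum>j<N. (if i - 1 = j then 1 else 0) * u j))"
    unfolding hamiltonian_def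
    by (cases "i = 0") (simp_all only: if_True if_False left_diff_distrib distrib_right sum_subtractf sum.distrib
        mult.assoc sum_distrib_left mult_zero_right mult_zero_left sum.neutral_const refl diff_zero)
  also have "\<dots> = hamiltonian a x u i"
    unfolding d hamiltonian_def using i u by (cases "i + 1 = N") auto
  finally show ?thesis .
qed

text \<open>
  Read backwards from the site \<open>N\<close>, the imaginary parts of the orbit of \<open>1\<close> solve the eigenvalue
  equation; they vanish at the site \<open>-1\<close> exactly when the boundary condition holds.
\<close>

lemma root_of_real_cocycle:
  assumes per: "circle_periodic a" and a: "\<And>x. 0 < a x" and s: "0 < s" and N: "1 \<le> N"
    and real: "Im (cocycle e (\<lambda>y. s / a y) (Suc N) x 1) = 0"
  shows "poly (char_poly (dirichlet_matrix a x N)) (s * e) = 0"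
proof -
  have coef: "coef a x n = a (2 ^ n * x)" for n
    unfolding coef_def by (rule circle_periodic_frac[OF per])
  define c where "c n = s / a (2 ^ n * x)" for n
  \<comment> \<open>\<open>z k\<close> is the state at the site \<open>N - k\<close>:
    \<open>z 0\<close> sits at the site \<open>N\<close>, where the solution vanishes, and
    \<open>z (Suc N)\<close> at the site \<open>-1\<close>.\<close>
  define z where "z = rec_nat 1 (\<lambda>k w. hstep e (c (N - k)) w)"
  have z0: "z 0 = 1" and zS: "z (Suc k) = hstep e (c (N - k)) (z k)" for k
    by (simp_all add: z_def)
  have orbit: "cocycle e (\<lambda>y. s / a y) (Suc N - k) x (z k) = cocycle e (\<lambda>y. s / a y) (Suc N) x 1" if "k \<le> Suc N" for k
    using that
  proof (induction k)
    case 0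
    show ?case by (simp add: z0)
  next
    case (Suc k)
    then have "Suc N - k = Suc (N - k)" by simp
    then show ?case using Suc by (simp add: zS c_def)
  qed
  have end0: "Im (z (Suc N)) = 0" using orbit[of "Suc N"] real by simp
  define u where "u n = Im (z (N - n))" for n
  have uN: "u N = 0" by (simp add: u_def z0)
  \<comment> \<open>The real part is the flux in units of \<open>s\<close>. Its decrease by
    \<open>e\<close> times the imaginary part in each step becomes the eigenvalue equation with
    energy \<open>s * e\<close>.\<close>
  have flux: "a (2 ^ (N - k) * x) * (Im (z (Suc k)) - Im (z k)) = s * Re (z (Suc k))" for k
    using a[of "2 ^ (N - k) * x"] by (simp add: zS hstep_components c_def)
  have ReS: "Re (z (Suc k)) = Re (z k) - e * Im (z k)" for k by (simp add: zS hstep_components)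
  have H: "hamiltonian a x u n = s * e * u n" if n: "n < N" for n
  proof -
    define k where "k = N - Suc n"
    have k: "N - n = Suc k" "N - k = Suc n" "N - Suc k = n" using n by (auto simp: k_def)
    have un: "u n = Im (z (Suc k))" "u (n + 1) = Im (z k)" using n by (auto simp: u_def k k_def)
    have um: "(if n = 0 then 0 else u (n - 1)) = Im (z (Suc (Suc k)))"
    proof (cases "n = 0")
      case True
      then show ?thesis using end0 k by simp
    next
      case False
      then have "N - (n - 1) = Suc (Suc k)" using k n by simp
      then show ?thesis using False by (simp add: u_def)
    qed
    have "hamiltonian a x u n = a (2 ^ Suc n * x) * (Im (z (Suc k)) - Im (z k))
        - a (2 ^ n * x) * (Im (z (Suc (Suc k))) - Im (z (Suc k)))"
      unfolding hamiltonian_def um coef un by (simp add: algebra_simps)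
    also have "\<dots> = s * Re (z (Suc k)) - s * Re (z (Suc (Suc k)))"
      using flux[of k] flux[of "Suc k"] by (simp only: k)
    also have "\<dots> = s * e * u n" unfolding ReS[of "Suc k"] un by (simp add: algebra_simps)
    finally show ?thesis .
  qed
  let ?A = "dirichlet_matrix a x N" and ?v = "Matrix.vec N u"
  have "mult_mat_vec ?A ?v = smult_vec (s * e) ?v"
    using dirichlet_matrix_carrier[of a x N]
    by (intro eq_vecI) (simp_all add: dirichlet_matrix_mult_vec[where u = u and N = N] uN H del: index_mult_mat_vec)
  moreover have "?v \<noteq> zero_vec N"
  proof
    assume "?v = zero_vec N"
    then have "vec_index ?v (N - 1) = 0" using N by simp
    \<comment> \<open>The orbit starts at \<open>N\<close> with unit flux, so the next value of the
      solution is nonzero.\<close>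
    moreover have "u (N - 1) = c N" using N zS[of 0] by (simp add: u_def z0 hstep_components)
    then have "vec_index ?v (N - 1) = c N" using N by simp
    ultimately show False using s a[of "2 ^ N * x"] by (simp add: c_def)
  qed
  ultimately have "eigenvector ?A ?v (s * e)"
    using dirichlet_matrix_carrier[of a x N] by (simp add: eigenvector_def)
  then show ?thesis
    by (subst eigenvalue_root_char_poly[OF dirichlet_matrix_carrier, symmetric]) (auto simp: eigenvalue_def)
qed

lemma eigenvalue_count_eq:
  "eigenvalue_count a x N E = size (filter_mset (\<lambda>r. r \<le> E) (proots (char_poly (dirichlet_matrix a x N))))"
proof -
  let ?M = "proots (char_poly (dirichlet_matrix a x N))"
  have "eigenvalue_count a x N E = length (filter (\<lambda>r. r \<le> E) (sorted_list_of_multiset ?M))"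
    unfolding eigenvalue_count_def dirichlet_eigenvalues_def by (simp only: length_filter_conv_card)
  also have "\<dots> = size (mset (filter (\<lambda>r. r \<le> E) (sorted_list_of_multiset ?M)))"
    by (rule size_mset[symmetric])
  also have "\<dots> = size (filter_mset (\<lambda>r. r \<le> E) ?M)"
    by (simp only: mset_filter mset_sorted_list_of_multiset)
  finally show ?thesis .
qed

lemma card_le_size_filter_proots:
  fixes p :: "real poly"
  assumes "p \<noteq> 0" "finite K" "inj_on f K" "\<And>k. k \<in> K \<Longrightarrow> poly p (f k) = 0 \<and> P (f k)"
  shows "card K \<le> size (filter_mset P (proots p))"
proof -
  have "f ` K \<subseteq> set_mset (filter_mset P (proots p))" using assms by auto
  then have "card (f ` K) \<le> card (set_mset (filter_mset P (proots p)))" by (intro card_mono) auto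
  also have "card (set_mset M) \<le> size M" for M :: "real multiset"
    by (induction M) (auto simp: card_insert_if)
  finally show ?thesis by (simp add: card_image assms(3))
qed

text \<open>
  Every multiple of \<open>\<pi>\<close> that the lifted angle passes between energy \<open>0\<close> and \<open>E\<close> gives an eigenvalue
  below \<open>E\<close>, and every multiple between \<open>E\<close> and a large energy gives one above.
\<close>

lemma eigenvalue_count_rotation:
  fixes a :: "real \<Rightarrow> real"
  assumes a: "circle_lipschitz L a" "0 < m" "\<And>x. m \<le> a x" "\<And>x. a x \<le> M" and s: "0 < s" and N: "1 \<le> N" and e: "0 \<le> e"
  shows "\<bar>real (eigenvalue_count a x N (s * e)) - Im (log_cocycle e (\<lambda>y. s / a y) (Suc N) x 1) / pi\<bar> \<le> 2"
proof -
  define c where "c y = s / a y" for y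
  define \<theta> where "\<theta> e = Im (log_cocycle e c (Suc N) x 1)" for e
  have per: "circle_periodic a" by (rule circle_lipschitz_periodic[OF a(1)])
  have apos: "0 < a y" for y using a(2,3) by (meson less_le_trans)
  have M: "0 < M" using apos[of 0] a(4)[of 0] by linarith
  define b where "b = s / M"
  have b: "0 < b" "b \<le> c y" for y
    using s M a(4)[of y] apos[of y] by (auto simp: b_def c_def intro!: divide_left_mono)
  have cu: "c y \<le> s / m" for y
    using s a(2) a(3)[of y] apos[of y] by (auto simp: c_def intro!: divide_left_mono)
  have cl: "circle_lipschitz (\<bar>s\<bar> * (L / m\<^sup>2)) c"
    using circle_lipschitz_cmult[OF circle_lipschitz_inverse[OF a(1-3)], of s]
    by (simp add: c_def[abs_def] divide_inverse)
  have c0: "0 \<le> c y" for y using b(1) b(2)[of y] by linarith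
  define e1 where "e1 = max e (4 / b)"
  define B where "B = max (s / m) e1"
  have cB: "c y \<le> B" for y using cu[of y] by (simp add: B_def)
  obtain K where K: "0 \<le> K" "\<And>e e' x x' z w. 0 \<le> e \<Longrightarrow> e \<le> B \<Longrightarrow> 0 \<le> e' \<Longrightarrow> e' \<le> B \<Longrightarrow> z \<noteq> 0 \<Longrightarrow> w \<noteq> 0 \<Longrightarrow>
    cmod (log_cocycle e c (Suc N) x z - log_cocycle e' c (Suc N) x' w) \<le> K * (\<bar>e - e'\<bar> + \<bar>x - x'\<bar> + line_dist z w)"
    by (rule log_cocycle_lipschitz[OF cl c0 cB]) (rule that)
  have cont: "continuous_on {0..B} \<theta>"
  proof -
    have "K-lipschitz_on {0..B} \<theta>"
    proof (rule lipschitz_onI[OF _ K(1)])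
      fix r t assume "r \<in> {0..B}" "t \<in> {0..B}"
      then show "dist (\<theta> r) (\<theta> t) \<le> K * dist r t"
        using K(2)[of r t 1 1 x x] abs_Im_le_cmod[of "log_cocycle r c (Suc N) x 1 - log_cocycle t c (Suc N) x 1"]
        unfolding \<theta>_def dist_real_def by (simp add: line_dist_def)
    qed
    then show ?thesis by (rule lipschitz_on_continuous_on)
  qed
  have e1: "e \<le> e1" "4 / b \<le> e1" "e1 \<le> B" "0 \<le> e1" using e by (auto simp: e1_def B_def)
  have t0: "\<theta> 0 < pi" unfolding \<theta>_def by (rule rotation_endpoints(1)[OF b])
  have t1: "real N * pi - pi / 2 \<le> \<theta> e1" unfolding \<theta>_def by (rule rotation_endpoints(2)[OF b e1(2)])
  have tpos: "0 \<le> \<theta> e" unfolding \<theta>_def using Im_log_cocycle(1)[of 1 e c "Suc N" x] e c0 by (simp del: log_cocycle.simps)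
  define p where "p = char_poly (dirichlet_matrix a x N)"
  have deg: "degree p = N" and p0: "p \<noteq> 0"
    using degree_monic_char_poly[OF dirichlet_matrix_carrier[of a x N]] N by (auto simp: p_def)
  have root: "poly p (s * r) = 0" if "\<theta> r = real k * pi" for r k
  proof -
    have "Im (cocycle r c (Suc N) x 1) = exp (Re (log_cocycle r c (Suc N) x 1)) * sin (\<theta> r)"
      unfolding \<theta>_def Im_exp[symmetric]
      using exp_log_cocycle[of 1 r c "Suc N" x] by (simp del: log_cocycle.simps cocycle.simps)
    then show ?thesis
      unfolding p_def using root_of_real_cocycle[OF per apos s N, of r x] that by (simp add: c_def[abs_def] mult.commute)
  qed
  \<comment> \<open>The number of positive multiples of \<open>pi\<close> up to
    \<open>\<theta> e\<close>. Each of them is attained at an energy up to \<open>e\<close>, and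
    each further one below \<open>N * pi\<close> at a larger energy.\<close>
  define k0 where "k0 = nat \<lfloor>\<theta> e / pi\<rfloor>"
  have k0: "real k0 \<le> \<theta> e / pi" "\<theta> e / pi < real k0 + 1"
    using tpos by (simp_all add: k0_def)
  have low: "\<exists>r. 0 \<le> r \<and> r \<le> e \<and> \<theta> r = real k * pi" if k: "k \<in> {1..k0}" for k
  proof (rule IVT')
    have "1 * pi \<le> real k * pi" using k by (intro mult_right_mono) auto
    then show "\<theta> 0 \<le> real k * pi" using t0 by linarith
    have "real k * pi \<le> real k0 * pi" using k by (intro mult_right_mono) auto
    also have "\<dots> \<le> \<theta> e" using k0(1) by (simp add: pos_le_divide_eq)
    finally show "real k * pi \<le> \<theta> e" .
    show "continuous_on {0..e} \<theta>" by (rule continuous_on_subset[OF cont]) (use e1 in auto)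
  qed (use e in simp)
  have high: "\<exists>r. e < r \<and> \<theta> r = real k * pi" if k: "k \<in> {Suc k0..<N}" for k
  proof -
    have lt: "\<theta> e < real k * pi"
    proof -
      have "\<theta> e < (real k0 + 1) * pi" using k0(2) by (simp add: pos_divide_less_eq)
      also have "\<dots> \<le> real k * pi" using k by (intro mult_right_mono) auto
      finally show ?thesis .
    qed
    have "\<exists>r. e \<le> r \<and> r \<le> e1 \<and> \<theta> r = real k * pi"
    proof (rule IVT')
      have "real k * pi \<le> (real N - 1) * pi" using k by (intro mult_right_mono) auto
      then show "real k * pi \<le> \<theta> e1" using t1 pi_gt_zero by (simp add: algebra_simps del: pi_gt_zero)
      show "continuous_on {e..e1} \<theta>" by (rule continuous_on_subset[OF cont]) (use e1 e in auto)
    qed (use lt e1 in auto)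
    then obtain r where "e \<le> r" "\<theta> r = real k * pi" by blast
    moreover have "r \<noteq> e" using lt calculation(2) by auto
    ultimately show ?thesis by (intro exI[of _ r]) auto
  qed
  have "\<forall>k\<in>{1..k0}. \<exists>r. r \<le> e \<and> \<theta> r = real k * pi" using low by blast
  from bchoice[OF this] obtain f where "\<forall>k\<in>{1..k0}. f k \<le> e \<and> \<theta> (f k) = real k * pi" ..
  then have f: "f k \<le> e \<and> \<theta> (f k) = real k * pi" if "k \<in> {1..k0}" for k using that by blast
  have "\<forall>k\<in>{Suc k0..<N}. \<exists>r. e < r \<and> \<theta> r = real k * pi" using high by blast
  from bchoice[OF this] obtain g where "\<forall>k\<in>{Suc k0..<N}. e < g k \<and> \<theta> (g k) = real k * pi" ..
  then have g: "e < g k \<and> \<theta> (g k) = real k * pi" if "k \<in> {Suc k0..<N}" for k using that by blast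
  let ?lo = "size (filter_mset (\<lambda>r. r \<le> s * e) (proots p))" and ?hi = "size (filter_mset (\<lambda>r. \<not> r \<le> s * e) (proots p))"
  have "card {1..k0} \<le> ?lo"
  proof (rule card_le_size_filter_proots[OF p0, where f = "\<lambda>k. s * f k"])
    show "inj_on (\<lambda>k. s * f k) {1..k0}"
    proof (rule inj_onI)
      fix i j assume i: "i \<in> {1..k0}" and j: "j \<in> {1..k0}" and eq: "s * f i = s * f j"
      have "f i = f j" using eq s by simp
      then have "real i * pi = real j * pi" using conjunct2[OF f[OF i]] conjunct2[OF f[OF j]] by (simp only:)
      then show "i = j" by simp
    qed
    show "poly p (s * f k) = 0 \<and> s * f k \<le> s * e" if "k \<in> {1..k0}" for k
      using conjunct1[OF f[OF that]] root[OF conjunct2[OF f[OF that]]] s by simp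
  qed simp
  moreover have "card {Suc k0..<N} \<le> ?hi"
  proof (rule card_le_size_filter_proots[OF p0, where f = "\<lambda>k. s * g k"])
    show "inj_on (\<lambda>k. s * g k) {Suc k0..<N}"
    proof (rule inj_onI)
      fix i j assume i: "i \<in> {Suc k0..<N}" and j: "j \<in> {Suc k0..<N}" and eq: "s * g i = s * g j"
      have "g i = g j" using eq s by simp
      then have "real i * pi = real j * pi" using conjunct2[OF g[OF i]] conjunct2[OF g[OF j]] by (simp only:)
      then show "i = j" by simp
    qed
    show "poly p (s * g k) = 0 \<and> \<not> s * g k \<le> s * e" if "k \<in> {Suc k0..<N}" for k
      using conjunct1[OF g[OF that]] root[OF conjunct2[OF g[OF that]]] s by simp
  qed simp
  \<comment> \<open>There are at most \<open>N\<close> roots in all, so the lower bounds for the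
    roots on either side of \<open>s * e\<close> confine the count to \<open>k0\<close> or
    \<open>k0 + 1\<close>.\<close>
  moreover have "?lo + ?hi \<le> N"
  proof -
    have "size (proots p) = ?lo + ?hi"
      using arg_cong[OF multiset_partition[of "proots p" "\<lambda>r. r \<le> s * e"], of size] by (simp only: size_union)
    then show ?thesis using size_proots_le[of p] deg by simp
  qed
  ultimately have "k0 \<le> ?lo" "?lo \<le> k0 + 1" by auto
  then show ?thesis
    using k0 unfolding eigenvalue_count_eq p_def[symmetric] \<theta>_def c_def[abs_def] by linarith
qed

subsection \<open>Norms of transfer matrices\<close>

text \<open>Gives the continuity of the operator norm in the matrix. The factor 2 is the number of
  components in the crude bound by their sum.\<close>

lemma onorm_matrix_lipschitz:
  fixes A B :: "real^2^2"
  shows "\<bar>onorm ((*v) A) - onorm ((*v) B)\<bar> \<le> 2 * norm (A - B)"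
proof -
  have bl: "bounded_linear ((*v) A)" for A :: "real^2^2" by (rule matrix_vector_mul_bounded_linear)
  have le: "onorm ((*v) D) \<le> 2 * norm D" for D :: "real^2^2"
  proof (rule onorm_bound)
    fix v :: "real^2"
    have "norm (D *v v) \<le> (\<Sum>i\<in>UNIV. \<bar>vec_nth (D *v v) i\<bar>)" by (rule norm_le_l1_cart)
    also have "\<dots> \<le> (\<Sum>i\<in>(UNIV :: 2 set). norm D * norm v)"
    proof (rule sum_mono)
      fix i :: 2
      have "\<bar>vec_nth (D *v v) i\<bar> \<le> norm (vec_nth D i) * norm v"
        unfolding matrix_vector_mul_component by (rule Cauchy_Schwarz_ineq2)
      also have "\<dots> \<le> norm D * norm v" by (intro mult_right_mono Finite_Cartesian_Product.norm_nth_le) auto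
      finally show "\<bar>vec_nth (D *v v) i\<bar> \<le> norm D * norm v" .
    qed
    finally show "norm (D *v v) \<le> 2 * norm D * norm v" by simp
  qed simp
  have tri: "onorm ((*v) A) \<le> onorm ((*v) B) + 2 * norm (A - B)" for A B :: "real^2^2"
  proof -
    have "(*v) A = (\<lambda>v. B *v v + (A - B) *v v)"
      by (simp add: fun_eq_iff matrix_vector_mult_diff_rdistrib)
    then have "onorm ((*v) A) \<le> onorm ((*v) B) + onorm ((*v) (A - B))"
      using onorm_triangle[OF bl[of B] bl[of "A - B"]] by simp
    then show ?thesis using le[of "A - B"] by linarith
  qed
  show ?thesis using tri[of A B] tri[of B A] by (simp add: norm_minus_commute abs_le_iff)
qed

text \<open>The row action is adjoint to the column action and has the same operator norm. This is
  one inequality; \<open>onorm_le_vector_matrix\<close> is the other.\<close>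

lemma norm_vector_matrix_le_onorm:
  fixes A :: "real^2^2"
  shows "norm (w v* A) \<le> onorm ((*v) A) * norm w"
proof (cases "w v* A = 0")
  case False
  have "norm (w v* A) * norm (w v* A) = inner (w v* A) (w v* A)"
    by (simp add: power2_norm_eq_inner[symmetric] power2_eq_square)
  also have "\<dots> = inner w (A *v (w v* A))" by (rule dot_lmul_matrix)
  also have "\<dots> \<le> norm w * norm (A *v (w v* A))" by (rule norm_cauchy_schwarz)
  also have "\<dots> \<le> norm w * (onorm ((*v) A) * norm (w v* A))"
    by (intro mult_left_mono onorm matrix_vector_mul_bounded_linear) auto
  finally have "norm (w v* A) * norm (w v* A) \<le> (onorm ((*v) A) * norm w) * norm (w v* A)"
    by (simp add: mult_ac)
  then show ?thesis using False by (simp add: mult_le_cancel_right)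
next
  case True
  have "0 \<le> onorm ((*v) A) * norm w"
    by (intro mult_nonneg_nonneg onorm_pos_le matrix_vector_mul_bounded_linear) auto
  then show ?thesis using True by simp
qed

lemma onorm_le_vector_matrix:
  fixes A :: "real^2^2"
  assumes "\<And>w. norm (w v* A) \<le> C * norm w" "0 \<le> C"
  shows "onorm ((*v) A) \<le> C"
proof (rule onorm_bound[OF assms(2)])
  fix v
  show "norm (A *v v) \<le> C * norm v"
  proof (cases "A *v v = 0")
    case False
    have "norm (A *v v) * norm (A *v v) = inner (A *v v) (A *v v)"
      by (simp add: power2_norm_eq_inner[symmetric] power2_eq_square)
    also have "\<dots> = inner ((A *v v) v* A) v" by (rule dot_lmul_matrix[symmetric])
    also have "\<dots> \<le> norm ((A *v v) v* A) * norm v" by (rule norm_cauchy_schwarz)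
    also have "\<dots> \<le> (C * norm (A *v v)) * norm v" by (intro mult_right_mono assms) auto
    finally have "norm (A *v v) * norm (A *v v) \<le> (C * norm v) * norm (A *v v)" by (simp add: mult_ac)
    then show ?thesis using False by (simp add: mult_le_cancel_right)
  qed (use assms(2) in simp)
qed

section \<open>Transfer matrices in the coordinates of the cocycle\<close>

lemma cocycle_add_right: "cocycle e c n x (z + w) = cocycle e c n x z + cocycle e c n x w"
proof -
  have "hstep e t (z + w) = hstep e t z + hstep e t w" for t z w
    by (simp add: complex_eq_iff hstep_components algebra_simps)
  then show ?thesis by (induction n arbitrary: z w) simp_all
qed

lemma cocycle_scaleR: "cocycle e c n x (r *\<^sub>R z) = r *\<^sub>R cocycle e c n x z"
proof -
  have "hstep e t (r *\<^sub>R z) = r *\<^sub>R hstep e t z" for t z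
    by (simp add: complex_eq_iff hstep_components algebra_simps)
  then show ?thesis by (induction n arbitrary: z) simp_all
qed

lemma norm_cocycle_le:
  "cmod (cocycle e c n x z) \<le> cmod z * (cmod (cocycle e c n x 1) + cmod (cocycle e c n x \<i>))"
proof -
  have "z = Re z *\<^sub>R 1 + Im z *\<^sub>R \<i>" by (simp add: complex_eq_iff)
  then have "cocycle e c n x z = Re z *\<^sub>R cocycle e c n x 1 + Im z *\<^sub>R cocycle e c n x \<i>"
    by (metis cocycle_add_right cocycle_scaleR)
  then have "cmod (cocycle e c n x z) \<le> \<bar>Re z\<bar> * cmod (cocycle e c n x 1) + \<bar>Im z\<bar> * cmod (cocycle e c n x \<i>)"
    by (metis norm_scaleR norm_triangle_ineq)
  also have "\<dots> \<le> cmod z * cmod (cocycle e c n x 1) + cmod z * cmod (cocycle e c n x \<i>)"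
    by (intro add_mono mult_right_mono abs_Re_le_cmod abs_Im_le_cmod) auto
  finally show ?thesis by (simp add: distrib_left)
qed

text \<open>
  Passing to the transposed matrices reverses the order of the product. In these coordinates, which
  combine the dual of \<open>(u\<^sub>n, a\<^sub>n (u\<^sub>n - u\<^sub>n\<^sub>-\<^sub>1))\<close> with a shear, the transposed product is the cocycle.
\<close>

definition dual_coord :: "real \<Rightarrow> real \<Rightarrow> real \<Rightarrow> real^2 \<Rightarrow> complex" where
  "dual_coord s E \<alpha> w = Complex (\<alpha> * vec_nth w 1 + vec_nth w 2 - E * vec_nth w 2 / \<alpha>) (- s * vec_nth w 2 / \<alpha>)"

lemma step_matrix_entries:
  "vec_nth (vec_nth (step_matrix a E x n) 1) 1 = (coef a x (Suc n) + coef a x n - E) / coef a x n"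
  "vec_nth (vec_nth (step_matrix a E x n) 1) 2 = - (coef a x n)\<^sup>2 / coef a x n"
  "vec_nth (vec_nth (step_matrix a E x n) 2) 1 = 1 / coef a x n"
  "vec_nth (vec_nth (step_matrix a E x n) 2) 2 = 0"
  by (simp_all add: step_matrix_def)

lemma dual_coord_step:
  assumes "0 < s" "coef a x n \<noteq> 0" "coef a x (Suc n) \<noteq> 0"
  shows "dual_coord s E (coef a x n) (w v* step_matrix a E x n) =
    hstep (E / s) (s / coef a x (Suc n)) (dual_coord s E (coef a x (Suc n)) w)"
proof -
  define \<alpha> \<beta> where "\<alpha> = coef a x n" and "\<beta> = coef a x (Suc n)"
  have nz: "\<alpha> \<noteq> 0" "\<beta> \<noteq> 0" using assms by (auto simp: \<alpha>_def \<beta>_def)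
  have v: "vec_nth (w v* step_matrix a E x n) 1 = ((\<beta> + \<alpha> - E) * vec_nth w 1 + vec_nth w 2) / \<alpha>"
    "vec_nth (w v* step_matrix a E x n) 2 = - \<alpha> * vec_nth w 1"
    using nz unfolding \<alpha>_def \<beta>_def
    by (simp_all add: vector_matrix_mult_def sum_2 step_matrix_entries add_divide_distrib power2_eq_square)
  show ?thesis
    unfolding dual_coord_def v \<alpha>_def[symmetric] \<beta>_def[symmetric]
    using nz assms(1) by (simp add: complex_eq_iff hstep_components field_simps)
qed

text \<open>A row vector meets the newest factor first, which is the order of
  \<open>cocycle\<close>. The factor with index \<open>n\<close> contributes the coefficient at
  \<open>n + 1\<close>, whence the base point \<open>2 * x\<close>; the coefficient at
  \<open>n\<close> is absorbed by the coordinates.\<close>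

lemma dual_coord_transfer_matrix:
  assumes s: "0 < s" and per: "circle_periodic a" and a: "\<And>x. 0 < a x"
  shows "dual_coord s E (coef a x 0) (w v* transfer_matrix a E x n) =
    cocycle (E / s) (\<lambda>y. s / a y) n (2 * x) (dual_coord s E (coef a x n) w)"
proof (induction n arbitrary: w)
  case 0
  show ?case by simp
next
  case (Suc n)
  have coef: "coef a x n = a (2 ^ n * x)" for n
    unfolding coef_def by (rule circle_periodic_frac[OF per])
  have nz: "coef a x n \<noteq> 0" for n unfolding coef using a[of "2 ^ n * x"] by simp
  have "dual_coord s E (coef a x 0) (w v* transfer_matrix a E x (Suc n))
      = dual_coord s E (coef a x 0) ((w v* step_matrix a E x n) v* transfer_matrix a E x n)"
    by (simp add: vector_matrix_mul_assoc)
  also have "\<dots> = cocycle (E / s) (\<lambda>y. s / a y) n (2 * x)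
      (hstep (E / s) (s / coef a x (Suc n)) (dual_coord s E (coef a x (Suc n)) w))"
    unfolding Suc by (simp only: dual_coord_step[OF s nz nz])
  also have "s / coef a x (Suc n) = s / a (2 ^ n * (2 * x))" by (simp add: coef mult_ac)
  finally show ?case by simp
qed

text \<open>\<open>K1\<close> bounds the change of coordinates and \<open>K2\<close> its inverse,
  for all coefficients between \<open>m\<close> and \<open>M\<close>. Passing to the cocycle thus
  costs a bounded factor at either end of the product.\<close>

lemma dual_coord_bounds:
  assumes "0 < s" "0 < m" "m \<le> M" "0 \<le> E"
  obtains K where "1 \<le> K" "\<And>\<alpha> w. m \<le> \<alpha> \<Longrightarrow> \<alpha> \<le> M \<Longrightarrow> cmod (dual_coord s E \<alpha> w) \<le> K * norm w"
    "\<And>\<alpha> w. m \<le> \<alpha> \<Longrightarrow> \<alpha> \<le> M \<Longrightarrow> norm w \<le> K * cmod (dual_coord s E \<alpha> w)"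
proof -
  define K1 where "K1 = M + 1 + E / m + s / m"
  define K2 where "K2 = (1 + (1 + E / m) * (M / s)) / m + M / s"
  define K where "K = K1 + K2 + 1"
  have nn: "0 \<le> K1" "0 \<le> K2" using assms by (auto simp: K1_def K2_def)
  show thesis
  proof (rule that[of K])
    show "1 \<le> K" using nn by (simp add: K_def)
    fix \<alpha> :: real and w :: "real^2" assume \<alpha>: "m \<le> \<alpha>" "\<alpha> \<le> M"
    define p q where "p = vec_nth w 1" and "q = vec_nth w 2"
    define z where "z = dual_coord s E \<alpha> w"
    have pos: "0 < \<alpha>" using assms \<alpha> by linarith
    have pq: "\<bar>p\<bar> \<le> norm w" "\<bar>q\<bar> \<le> norm w" unfolding p_def q_def by (rule component_le_norm_cart)+
    have Rz: "Re z = \<alpha> * p + q - E / \<alpha> * q" and Iz: "Im z = - (s / \<alpha>) * q"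
      by (simp_all add: z_def dual_coord_def p_def q_def)
    have E\<alpha>: "0 \<le> E / \<alpha>" "E / \<alpha> \<le> E / m" "0 \<le> s / \<alpha>" "s / \<alpha> \<le> s / m"
      using assms \<alpha> pos by (auto intro!: divide_left_mono)
    have "cmod z \<le> \<bar>Re z\<bar> + \<bar>Im z\<bar>" by (rule cmod_le)
    also have "\<dots> \<le> (\<alpha> * \<bar>p\<bar> + \<bar>q\<bar> + E / \<alpha> * \<bar>q\<bar>) + s / \<alpha> * \<bar>q\<bar>"
    proof (intro add_mono)
      have "\<bar>Re z\<bar> \<le> \<bar>\<alpha> * p\<bar> + \<bar>q\<bar> + \<bar>E / \<alpha> * q\<bar>" unfolding Rz by linarith
      then show "\<bar>Re z\<bar> \<le> \<alpha> * \<bar>p\<bar> + \<bar>q\<bar> + E / \<alpha> * \<bar>q\<bar>" using pos assms by (simp add: abs_mult)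
      show "\<bar>Im z\<bar> \<le> s / \<alpha> * \<bar>q\<bar>" unfolding Iz using pos assms by (simp add: abs_mult)
    qed
    also have "\<dots> \<le> (M * norm w + norm w + E / m * norm w) + s / m * norm w"
      using pq E\<alpha> \<alpha> pos assms by (intro add_mono mult_mono) auto
    also have "\<dots> = K1 * norm w" by (simp add: K1_def algebra_simps)
    also have "\<dots> \<le> K * norm w" using nn by (intro mult_right_mono) (auto simp: K_def)
    finally show "cmod (dual_coord s E \<alpha> w) \<le> K * norm w" unfolding z_def .
    have q: "\<bar>q\<bar> \<le> M / s * cmod z"
    proof -
      have "q = - (\<alpha> / s) * Im z" unfolding Iz using pos assms by simp
      then have "\<bar>q\<bar> = \<alpha> / s * \<bar>Im z\<bar>" using pos assms by (simp add: abs_mult)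
      also have "\<dots> \<le> M / s * cmod z"
        using \<alpha> assms pos by (intro mult_mono divide_right_mono abs_Im_le_cmod) auto
      finally show ?thesis .
    qed
    have "\<alpha> * p = Re z - q + E / \<alpha> * q" unfolding Rz by simp
    then have "\<alpha> * \<bar>p\<bar> = \<bar>Re z - q + E / \<alpha> * q\<bar>" using pos by (metis abs_mult abs_of_pos)
    also have "\<dots> \<le> \<bar>Re z\<bar> + \<bar>q\<bar> + \<bar>E / \<alpha> * q\<bar>" by linarith
    also have "\<dots> = \<bar>Re z\<bar> + \<bar>q\<bar> + E / \<alpha> * \<bar>q\<bar>"
      unfolding abs_mult[of "E / \<alpha>"] abs_of_nonneg[OF E\<alpha>(1)] ..
    also have "\<dots> \<le> cmod z + M / s * cmod z + E / m * (M / s * cmod z)"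
      using q E\<alpha> assms by (intro add_mono mult_mono abs_Re_le_cmod) auto
    also have "\<dots> = (1 + (1 + E / m) * (M / s)) * cmod z" by (simp add: algebra_simps)
    finally have ap: "\<alpha> * \<bar>p\<bar> \<le> (1 + (1 + E / m) * (M / s)) * cmod z" .
    have "m * \<bar>p\<bar> \<le> \<alpha> * \<bar>p\<bar>" using \<alpha> by (intro mult_right_mono) auto
    then have "m * \<bar>p\<bar> \<le> (1 + (1 + E / m) * (M / s)) * cmod z" using ap by linarith
    then have p: "\<bar>p\<bar> \<le> (1 + (1 + E / m) * (M / s)) / m * cmod z"
      using assms(2) by (simp add: pos_le_divide_eq mult.commute)
    have "norm w \<le> (\<Sum>i\<in>UNIV. \<bar>vec_nth w i\<bar>)" by (rule norm_le_l1_cart)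
    then have "norm w \<le> \<bar>p\<bar> + \<bar>q\<bar>" by (simp add: sum_2 p_def q_def)
    also have "\<dots> \<le> K2 * cmod z" using p q by (simp add: K2_def algebra_simps)
    also have "\<dots> \<le> K * cmod z" using nn by (intro mult_right_mono) (auto simp: K_def)
    finally show "norm w \<le> K * cmod (dual_coord s E \<alpha> w)" unfolding z_def .
  qed
qed

lemma dual_coord_surj:
  assumes "0 < s" "\<alpha> \<noteq> 0"
  obtains w where "dual_coord s E \<alpha> w = 1"
proof (rule that[of "vector [1 / \<alpha>, 0]"])
  show "dual_coord s E \<alpha> (vector [1 / \<alpha>, 0]) = 1"
    using assms by (simp add: dual_coord_def complex_eq_iff)
qed

text \<open>From below, the norm is tested on the row vector with coordinate \<open>1\<close>. From
  above, the images of \<open>1\<close> and \<open>\<i>\<close> control every vector, and replacing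
  \<open>\<i>\<close> by \<open>1\<close> costs the difference of their logarithms, whose mean a
  drift will bound.\<close>

lemma ln_onorm_transfer_matrix:
  fixes a :: "real \<Rightarrow> real"
  assumes per: "circle_periodic a" and a: "0 < m" "\<And>x. m \<le> a x" "\<And>x. a x \<le> M" and s: "0 < s" and E: "0 \<le> E"
  obtains C where "\<And>n x. 0 < onorm ((*v) (transfer_matrix a E x n))"
    "\<And>n x. \<bar>ln (onorm ((*v) (transfer_matrix a E x n))) - Re (log_cocycle (E / s) (\<lambda>y. s / a y) n (2 * x) 1)\<bar>
      \<le> C + cmod (log_cocycle (E / s) (\<lambda>y. s / a y) n (2 * x) 1 - log_cocycle (E / s) (\<lambda>y. s / a y) n (2 * x) \<i>)"
proof -
  have apos: "0 < a x" for x using a by (meson less_le_trans)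
  have coef: "coef a x n = a (2 ^ n * x)" for n x
    unfolding coef_def by (rule circle_periodic_frac[OF per])
  have mM: "m \<le> M" using a(2,3)[of 0] by linarith
  obtain K where K: "1 \<le> K" "\<And>\<alpha> w. m \<le> \<alpha> \<Longrightarrow> \<alpha> \<le> M \<Longrightarrow> cmod (dual_coord s E \<alpha> w) \<le> K * norm w"
    "\<And>\<alpha> w. m \<le> \<alpha> \<Longrightarrow> \<alpha> \<le> M \<Longrightarrow> norm w \<le> K * cmod (dual_coord s E \<alpha> w)"
    by (rule dual_coord_bounds[OF s a(1) mM E]) (rule that)
  have cb: "m \<le> coef a x n" "coef a x n \<le> M" for x n unfolding coef using a by auto
  note dc = dual_coord_transfer_matrix[OF s per apos, of E]
  let ?e = "E / s" and ?c = "\<lambda>y. s / a y"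
  {
    fix n x
    define T where "T = transfer_matrix a E x n"
    define Z Y where "Z = cmod (cocycle ?e ?c n (2 * x) 1)" and "Y = cmod (cocycle ?e ?c n (2 * x) \<i>)"
    define l r where "l = log_cocycle ?e ?c n (2 * x) 1" and "r = log_cocycle ?e ?c n (2 * x) \<i>"
    have Zl: "Z = exp (Re l)" and Yr: "Y = exp (Re r)"
      using norm_cocycle[of 1 ?e ?c n "2 * x"] norm_cocycle[of \<i> ?e ?c n "2 * x"]
      by (simp_all add: Z_def Y_def l_def r_def)
    have lower: "Z \<le> K * (onorm ((*v) T) * K)"
    proof -
      obtain w where w: "dual_coord s E (coef a x n) w = 1"
        using dual_coord_surj[OF s, of "coef a x n"] cb(1)[of x n] a(1) by (metis less_irrefl less_le_trans)
      have "Z = cmod (dual_coord s E (coef a x 0) (w v* T))" unfolding Z_def T_def dc w ..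
      also have "\<dots> \<le> K * norm (w v* T)" by (rule K(2)[OF cb])
      also have "\<dots> \<le> K * (onorm ((*v) T) * norm w)"
        using K(1) by (intro mult_left_mono norm_vector_matrix_le_onorm) auto
      also have "\<dots> \<le> K * (onorm ((*v) T) * K)"
        using K(1) K(3)[OF cb, of w x n] w
        by (intro mult_left_mono onorm_pos_le matrix_vector_mul_bounded_linear) auto
      finally show ?thesis .
    qed
    have Z0: "0 < Z" "0 < Y" by (simp_all add: Zl Yr)
    then have pos: "0 < onorm ((*v) T)"
    proof -
      have "0 < (K * K) * onorm ((*v) T)" using lower Z0(1) by (simp add: mult_ac)
      then show ?thesis using K(1) by (simp add: zero_less_mult_iff)
    qed
    have upper: "onorm ((*v) T) \<le> K * K * (Z + Y)"
    proof (rule onorm_le_vector_matrix)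
      fix w
      have "norm (w v* T) \<le> K * cmod (dual_coord s E (coef a x 0) (w v* T))" by (rule K(3)[OF cb])
      also have "\<dots> \<le> K * (cmod (dual_coord s E (coef a x n) w) * (Z + Y))"
        unfolding T_def dc Z_def Y_def using K(1) by (intro mult_left_mono norm_cocycle_le) auto
      also have "\<dots> \<le> K * ((K * norm w) * (Z + Y))"
        using K(1) K(2)[OF cb] Z0 by (intro mult_left_mono mult_right_mono) auto
      finally show "norm (w v* T) \<le> K * K * (Z + Y) * norm w" by (simp add: mult_ac)
    qed (use K(1) Z0 in auto)
    have lnK: "0 \<le> ln K" using K(1) by simp
    have "Re l \<le> ln (K * (onorm ((*v) T) * K))"
      using lower pos K(1) by (subst ln_ge_iff) (auto simp: Zl)
    also have "\<dots> = 2 * ln K + ln (onorm ((*v) T))" using K(1) pos by (simp add: ln_mult)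
    finally have 1: "Re l \<le> 2 * ln K + ln (onorm ((*v) T))" .
    have "Z + Y \<le> 2 * exp (Re l + cmod (l - r))"
    proof -
      have "Re r \<le> Re l + cmod (l - r)" using abs_Re_le_cmod[of "l - r"] by simp
      then have "exp (Re r) \<le> exp (Re l + cmod (l - r))" by simp
      moreover have "exp (Re l) \<le> exp (Re l + cmod (l - r))" by simp
      ultimately show ?thesis unfolding Zl Yr by linarith
    qed
    then have "K * K * (Z + Y) \<le> K * K * (2 * exp (Re l + cmod (l - r)))"
      using K(1) by (intro mult_left_mono) auto
    then have "ln (onorm ((*v) T)) \<le> ln (K * K * (2 * exp (Re l + cmod (l - r))))"
      using order_trans[OF upper] pos K(1) by (intro ln_mono) auto
    also have "\<dots> = 2 * ln K + (ln 2 + (Re l + cmod (l - r)))" using K(1) by (simp add: ln_mult)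
    finally have 2: "ln (onorm ((*v) T)) \<le> 2 * ln K + (ln 2 + (Re l + cmod (l - r)))" .
    have "\<bar>ln (onorm ((*v) T)) - Re l\<bar> \<le> (2 * ln K + ln 2) + cmod (l - r)"
    proof -
      have "0 \<le> ln (2::real)" by simp
      then show ?thesis using 1 2 lnK norm_ge_zero[of "l - r"] by linarith
    qed
    note pos this
  }
  note main = this
  show thesis
    by (rule that[of "2 * ln K + ln 2"]) (use main in blast)+
qed

section \<open>Subadditivity and the Lyapunov exponent\<close>

lemma coef_power2: "coef a (2 ^ n * x) j = coef a x (j + n)"
  by (simp add: coef_def power_add mult_ac)

lemma transfer_matrix_add:
  "transfer_matrix a E x (m + n) = transfer_matrix a E (2 ^ n * x) m ** transfer_matrix a E x n"
proof (induction m)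
  case (Suc m)
  have "step_matrix a E (2 ^ n * x) m = step_matrix a E x (m + n)"
    by (simp add: step_matrix_def coef_power2 add_ac)
  then show ?case using Suc by (simp add: matrix_mul_assoc)
qed simp

lemma continuous_transfer_matrix:
  fixes a :: "real \<Rightarrow> real"
  assumes per: "circle_periodic a" and cont: "continuous_on UNIV a" and a: "\<And>x. a x \<noteq> 0"
  shows "continuous_on UNIV (\<lambda>x. transfer_matrix a E x n)"
proof (induction n)
  case 0
  show ?case by simp
next
  case (Suc n)
  have coef: "coef a x n = a (2 ^ n * x)" for n x
    unfolding coef_def by (rule circle_periodic_frac[OF per])
  have c: "continuous_on UNIV (\<lambda>x. coef a x n)" for n
    unfolding coef by (intro continuous_on_compose2[OF cont] continuous_intros) auto
  have nz: "coef a x n \<noteq> 0" for x n unfolding coef by (rule a)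
  have e: "continuous_on UNIV (\<lambda>x. vec_nth (vec_nth (step_matrix a E x n) i) j)" for i j :: 2
  proof -
    have "continuous_on UNIV (\<lambda>x. vec_nth (vec_nth (step_matrix a E x n) i) j)" if "i = 1 \<or> i = 2" "j = 1 \<or> j = 2"
      using that by (elim disjE; hypsubst; unfold step_matrix_entries; intro continuous_intros c ballI nz)
    then show ?thesis using exhaust_2[of i] exhaust_2[of j] by blast
  qed
  have t: "continuous_on UNIV (\<lambda>x. vec_nth (vec_nth (transfer_matrix a E x n) i) j)" for i j :: 2
    by (intro continuous_intros Suc)
  show ?case
    unfolding transfer_matrix.simps matrix_matrix_mult_def by (intro continuous_intros e t)
qed

text \<open>Subadditivity carries the value \<open>F n / n\<close> to all multiples
  \<open>k * n\<close>, where the constant \<open>C\<close> is divided by \<open>k * n\<close> and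
  disappears in the limit; only the linear rate \<open>D\<close> survives. The lower bound makes the
  infimum of \<open>F' n / n\<close> a genuine one.\<close>

lemma inf_subadditive_close:
  fixes F F' :: "nat \<Rightarrow> real"
  assumes sub: "\<And>k n. 0 < k \<Longrightarrow> F (k * n) \<le> real k * F n"
    and below: "\<And>n. - (b * real n + b) \<le> F' n"
    and close: "\<And>n. \<bar>F n - F' n\<bar> \<le> C + real n * D"
  shows "(INF n\<in>{0<..}. (1 / real n) * F' n) \<le> (INF n\<in>{0<..}. (1 / real n) * F n) + D"
proof -
  have bdd: "bdd_below ((\<lambda>n. (1 / real n) * F' n) ` {0<..})"
  proof (rule bdd_belowI2[where m = "- (2 * \<bar>b\<bar>)"])
    fix n :: nat assume "n \<in> {0<..}"
    then have n: "1 \<le> real n" by simp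
    have "b * real n \<le> \<bar>b\<bar> * real n" by (intro mult_right_mono) auto
    moreover have "b \<le> \<bar>b\<bar> * real n" using n mult_left_mono[of 1 "real n" "\<bar>b\<bar>"] by linarith
    ultimately have "- (2 * \<bar>b\<bar>) * real n \<le> F' n" using below[of n] by linarith
    then show "- (2 * \<bar>b\<bar>) \<le> (1 / real n) * F' n" using n by (simp add: pos_le_divide_eq)
  qed
  have "(INF n\<in>{0<..}. (1 / real n) * F' n) - D \<le> (1 / real n) * F n" if n: "0 < n" for n
  proof -
    have "(INF n\<in>{0<..}. (1 / real n) * F' n) - D \<le> (1 / real n) * F n + C / real n / real k" if k: "0 < k" for k
    proof -
      have kn: "k * n \<in> {0<..}" using k n by simp
      have "(INF n\<in>{0<..}. (1 / real n) * F' n) \<le> (1 / real (k * n)) * F' (k * n)"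
        by (rule cINF_lower[OF bdd kn])
      also have "\<dots> \<le> (1 / real (k * n)) * (real k * F n + C + real (k * n) * D)"
        using close[of "k * n"] sub[OF k, of n] by (intro mult_left_mono) auto
      also have "\<dots> = (1 / real n) * F n + C / real n / real k + D"
        using k n by (simp add: field_simps)
      finally show ?thesis by simp
    qed
    moreover have "(\<lambda>k. (1 / real n) * F n + C / real n / real k) \<longlonglongrightarrow> (1 / real n) * F n + 0"
      by (intro tendsto_intros lim_const_over_n)
    ultimately show ?thesis
      by (intro LIMSEQ_le_const[where X = "\<lambda>k. (1 / real n) * F n + C / real n / real k"]) (auto intro: exI[of _ 1])
  qed
  then have "(INF n\<in>{0<..}. (1 / real n) * F' n) - D \<le> (INF n\<in>{0<..}. (1 / real n) * F n)"
    by (intro cINF_greatest) auto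
  then show ?thesis by simp
qed

lemma abs_Re_log_cocycle_le:
  assumes "0 \<le> e" "e \<le> B" "\<And>x. 0 \<le> c x" "\<And>x. c x \<le> B" "z \<noteq> 0"
  shows "\<bar>Re (log_cocycle e c n x z)\<bar> \<le> 2 * B * real n"
  using assms(5)
proof (induction n arbitrary: z)
  case 0
  show ?case by simp
next
  case (Suc n)
  let ?t = "c (2 ^ n * x)"
  have "cmod (hstep e ?t z) = cmod z * exp (Re (hstep_log e ?t z))"
    using exp_hstep_log[OF Suc.prems, of e ?t] by (metis norm_exp_eq_Re norm_mult)
  then have "ln (cmod (hstep e ?t z)) - ln (cmod z) = Re (hstep_log e ?t z)"
    using Suc.prems by (simp add: ln_mult)
  then have "\<bar>Re (hstep_log e ?t z)\<bar> \<le> 2 * B"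
    using ln_norm_hstep[OF Suc.prems assms(1,2) assms(3,4), of "2 ^ n * x"] by simp
  moreover have "\<bar>Re (log_cocycle e c n x (hstep e ?t z))\<bar> \<le> 2 * B * real n"
    using Suc by simp
  moreover have "2 * B * real (Suc n) = 2 * B + 2 * B * real n" by (simp add: distrib_left)
  ultimately show ?case unfolding log_cocycle.simps plus_complex.sel by linarith
qed

definition mean_log_norm :: "(real \<Rightarrow> real) \<Rightarrow> real \<Rightarrow> nat \<Rightarrow> real" where
  "mean_log_norm a E n = circle_mean (\<lambda>x. ln (onorm ((*v) (transfer_matrix a E x n))))"

lemma lyapunov_eq: "lyapunov a E = (INF n\<in>{0<..}. (1 / real n) * mean_log_norm a E n)"
  by (simp add: lyapunov_def mean_log_norm_def circle_mean_def)

text \<open>The bound \<open>K\<close> is what a drift supplies: the directions \<open>1\<close> and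
  \<open>\<i>\<close> grow alike up to a bounded mean. The matrix norm then grows like a single
  vector, up to a constant. Subadditivity combines submultiplicativity of the norm with invariance
  of the mean.\<close>

lemma mean_log_norm_properties:
  fixes a :: "real \<Rightarrow> real"
  assumes a: "circle_lipschitz L a" "0 < m" "\<And>x. m \<le> a x" "\<And>x. a x \<le> M" and s: "0 < s" and E: "0 \<le> E"
    and K: "\<And>n. circle_mean (\<lambda>x. cmod (log_cocycle (E / s) (\<lambda>y. s / a y) n x 1 - log_cocycle (E / s) (\<lambda>y. s / a y) n x \<i>)) \<le> K"
  obtains C where "\<And>k n. 0 < k \<Longrightarrow> mean_log_norm a E (k * n) \<le> real k * mean_log_norm a E n"
    "\<And>n. \<bar>mean_log_norm a E n - circle_mean (\<lambda>x. Re (log_cocycle (E / s) (\<lambda>y. s / a y) n x 1))\<bar> \<le> C"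
proof -
  let ?e = "E / s" and ?c = "\<lambda>y. s / a y"
  define f where "f n x = ln (onorm ((*v) (transfer_matrix a E x n)))" for n x
  have per: "circle_periodic a" by (rule circle_lipschitz_periodic[OF a(1)])
  have apos: "0 < a x" for x using a(2,3) by (meson less_le_trans)
  obtain C where pos: "\<And>n x. 0 < onorm ((*v) (transfer_matrix a E x n))"
    and C': "\<And>n x. \<bar>ln (onorm ((*v) (transfer_matrix a E x n))) - Re (log_cocycle ?e ?c n (2 * x) 1)\<bar>
      \<le> C + cmod (log_cocycle ?e ?c n (2 * x) 1 - log_cocycle ?e ?c n (2 * x) \<i>)"
    by (rule ln_onorm_transfer_matrix[OF per a(2-4) s E]) (rule that)
  note C = C'[folded f_def]
  have cT: "continuous_on UNIV (\<lambda>x. transfer_matrix a E x n)" for n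
    by (rule continuous_transfer_matrix[OF per circle_lipschitz_continuous[OF a(1)]]) (metis apos less_irrefl)
  have "2-lipschitz_on UNIV (\<lambda>A :: real^2^2. onorm ((*v) A))"
    by (rule lipschitz_onI) (simp_all add: dist_norm onorm_matrix_lipschitz)
  then have "continuous_on UNIV (\<lambda>A :: real^2^2. onorm ((*v) A))" by (rule lipschitz_on_continuous_on)
  then have co: "continuous_on UNIV (\<lambda>x. onorm ((*v) (transfer_matrix a E x n)))" for n
    by (rule continuous_on_compose2[OF _ cT]) auto
  have cf: "continuous_on UNIV (f n)" for n
    unfolding f_def by (intro continuous_on_ln co) (metis pos less_irrefl)
  have pf: "circle_periodic (f n)" for n
  proof -
    have "coef a (x + 1) j = coef a x j" for x j
      unfolding coef_def using circle_periodic_frac[OF per] circle_periodicD[OF circle_periodic_power2[OF per]] by metis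
    then have "transfer_matrix a E (x + 1) n = transfer_matrix a E x n" for x
      by (induction n) (simp_all add: step_matrix_def)
    then show ?thesis by (simp add: circle_periodic_def f_def)
  qed
  have sub: "f (p + n) x \<le> f p (2 ^ n * x) + f n x" for p n x
  proof -
    have "onorm ((*v) (transfer_matrix a E x (p + n)))
        \<le> onorm ((*v) (transfer_matrix a E (2 ^ n * x) p)) * onorm ((*v) (transfer_matrix a E x n))"
      using onorm_compose[OF matrix_vector_mul_bounded_linear[of "transfer_matrix a E (2 ^ n * x) p"]
          matrix_vector_mul_bounded_linear[of "transfer_matrix a E x n"]]
      by (simp add: transfer_matrix_add o_def matrix_vector_mul_assoc)
    then have "f (p + n) x \<le> ln (onorm ((*v) (transfer_matrix a E (2 ^ n * x) p)) * onorm ((*v) (transfer_matrix a E x n)))"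
      unfolding f_def using pos by (intro ln_mono) auto
    then show ?thesis unfolding f_def ln_mult_pos[OF pos pos] .
  qed
  have msub: "mean_log_norm a E (p + n) \<le> mean_log_norm a E p + mean_log_norm a E n" for p n
  proof -
    have c2: "continuous_on UNIV (\<lambda>x. f p (2 ^ n * x))"
      by (intro continuous_on_compose2[OF cf] continuous_intros) auto
    have "circle_mean (f (p + n)) \<le> circle_mean (\<lambda>x. f p (2 ^ n * x) + f n x)"
      by (intro circle_mean_mono cf continuous_on_add c2 sub)
    also have "\<dots> = circle_mean (f p) + circle_mean (f n)"
      by (simp add: circle_mean_add[OF c2 cf] circle_mean_pullback[OF cf pf])
    finally show ?thesis unfolding mean_log_norm_def f_def .
  qed
  have "mean_log_norm a E (k * n) \<le> real k * mean_log_norm a E n" if "0 < k" for k n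
    using that
  proof (induction k)
    case (Suc k)
    show ?case
    proof (cases "k = 0")
      case False
      then have "mean_log_norm a E (n + k * n) \<le> mean_log_norm a E n + real k * mean_log_norm a E n"
        using Suc.IH msub[of n "k * n"] by linarith
      then show ?thesis by (simp add: algebra_simps)
    qed simp
  qed simp
  moreover have "\<bar>mean_log_norm a E n - circle_mean (\<lambda>x. Re (log_cocycle ?e ?c n x 1))\<bar> \<le> C + K" for n
  proof -
    have cl: "circle_lipschitz (\<bar>s\<bar> * (L / m\<^sup>2)) ?c"
      using circle_lipschitz_cmult[OF circle_lipschitz_inverse[OF a(1-3)], of s] by (simp add: divide_inverse)
    have c0: "0 \<le> ?c y" for y using s apos[of y] by simp
    have cu: "?c y \<le> max (s / m) ?e" for y
      using s a(2) a(3)[of y] apos[of y] by (auto intro!: max.coboundedI1 divide_left_mono)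
    have e: "0 \<le> ?e" "?e \<le> max (s / m) ?e" using s E by auto
    have cc: "continuous_on UNIV (\<lambda>x. log_cocycle ?e ?c n x z)" if "z \<noteq> 0" for z
      by (rule continuous_log_cocycle[OF cl c0 cu e that])
    define g where "g x = cmod (log_cocycle ?e ?c n x 1 - log_cocycle ?e ?c n x \<i>)" for x
    define h where "h x = Re (log_cocycle ?e ?c n x 1)" for x
    have cg: "continuous_on UNIV g" and ch: "continuous_on UNIV h"
      unfolding g_def h_def by (intro continuous_intros cc; simp)+
    have pl: "circle_periodic (\<lambda>x. log_cocycle ?e ?c n x z)" for z
      using circle_periodic_cocycle(2)[OF circle_lipschitz_periodic[OF cl]] by (simp add: circle_periodic_def)
    have pg: "circle_periodic g" and ph: "circle_periodic h"
      using pl by (simp_all add: g_def h_def circle_periodic_def)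
    have c2: "continuous_on UNIV (\<lambda>x. g (2 * x))" "continuous_on UNIV (\<lambda>x. h (2 * x))"
      by (intro continuous_on_compose2[OF cg] continuous_on_compose2[OF ch] continuous_intros; simp)+
    \<comment> \<open>The doubled base point disappears under the mean by invariance.\<close>
    have pull: "circle_mean (\<lambda>x. g (2 * x)) = circle_mean g" "circle_mean (\<lambda>x. h (2 * x)) = circle_mean h"
      using circle_mean_pullback[OF cg pg, of 1] circle_mean_pullback[OF ch ph, of 1] by simp_all
    have b: "\<bar>f n x - h (2 * x)\<bar> \<le> C + g (2 * x)" for x using C[of n x] by (simp add: g_def h_def)
    have "circle_mean (f n) \<le> circle_mean (\<lambda>x. h (2 * x) + (C + g (2 * x)))"
      using b by (intro circle_mean_mono cf continuous_on_add c2 continuous_on_const) (simp add: abs_le_iff, smt (verit))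
    also have "\<dots> = circle_mean h + (C + circle_mean g)"
      by (simp add: circle_mean_add continuous_on_add c2 pull)
    finally have 1: "circle_mean (f n) \<le> circle_mean h + (C + circle_mean g)" .
    have "circle_mean (\<lambda>x. h (2 * x)) \<le> circle_mean (\<lambda>x. f n x + (C + g (2 * x)))"
      using b by (intro circle_mean_mono cf continuous_on_add c2 continuous_on_const) (simp add: abs_le_iff, smt (verit))
    also have "\<dots> = circle_mean (f n) + (C + circle_mean g)"
      by (simp add: circle_mean_add continuous_on_add c2 cf pull)
    finally have 2: "circle_mean h \<le> circle_mean (f n) + (C + circle_mean g)" unfolding pull .
    have "circle_mean g \<le> K" unfolding g_def by (rule K)
    then show ?thesis using 1 2 unfolding mean_log_norm_def f_def[symmetric] h_def[symmetric] by (simp add: abs_le_iff)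
  qed
  ultimately show thesis by (rule that)
qed

subsection \<open>Local Hoelder continuity\<close>

text \<open>Stretching the imaginary axis by \<open>r\<close> conjugates the two cocycles. It
  changes the logarithm of the norm by a bounded amount, which the corrector absorbs, so \<delta> is
  unchanged. This links the balanced shears of the expansion with the original ones.\<close>

lemma uniform_drift_rescale:
  assumes drift: "uniform_drift e c \<delta> M v" and r: "0 < r"
  shows "\<exists>M v. uniform_drift (e / r) (\<lambda>t. r * c t) \<delta> M v"
proof -
  have \<delta>: "0 < \<delta>" and v: "\<And>y z. z \<noteq> 0 \<Longrightarrow> \<bar>v y z\<bar> \<le> M"
    and D: "\<And>y z. z \<noteq> 0 \<Longrightarrow> ln (cmod z) + v y z + \<delta> \<le>
      branch_avg (\<lambda>t. ln (cmod (hstep e (c t) z)) + v t (hstep e (c t) z)) y"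
    using drift by (auto simp: uniform_drift_def)
  define J where "J z = Complex (Re z) (r * Im z)" for z
  define I where "I z = Complex (Re z) (Im z / r)" for z
  define v' where "v' y z = v y (I z) + ln (cmod (I z)) - ln (cmod z)" for y z
  have JI: "J (I z) = z" and IJ: "I (J z) = z" for z
    using r by (simp_all add: J_def I_def complex_eq_iff)
  have I0: "I z \<noteq> 0" if "z \<noteq> 0" for z using that JI[of z] by (auto simp: J_def complex_eq_iff)
  have conj: "hstep (e / r) (r * t) (J z) = J (hstep e t z)" for t z
    using r by (simp add: J_def complex_eq_iff hstep_components algebra_simps)
  have diag: "cmod (Complex (Re z) (k * Im z)) \<le> (1 + k) * cmod z" if "0 < k" for k z
  proof -
    have "cmod (Complex (Re z) (k * Im z)) \<le> \<bar>Re z\<bar> + \<bar>k * Im z\<bar>"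
      using cmod_le[of "Complex (Re z) (k * Im z)"] by simp
    also have "\<dots> \<le> cmod z + k * cmod z"
      using that abs_Re_le_cmod[of z] abs_Im_le_cmod[of z] by (intro add_mono) (auto simp: abs_mult)
    finally show ?thesis by (simp add: algebra_simps)
  qed
  define \<rho> where "\<rho> = ln (1 + r) + ln (1 + 1 / r)"
  have lnr: "0 \<le> ln (1 + r)" "0 \<le> ln (1 + 1 / r)" using r by simp_all
  have rho: "\<bar>ln (cmod (I z)) - ln (cmod z)\<bar> \<le> \<rho>" if z: "z \<noteq> 0" for z
  proof -
    have p: "0 < cmod z" "0 < cmod (I z)" using z I0[OF z] by auto
    have q: "0 < 1 + r" "0 < 1 + 1 / r" using r by (simp_all add: add_pos_pos)
    have "cmod (I z) \<le> (1 + 1 / r) * cmod z" using diag[of "1 / r" z] r by (simp add: I_def)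
    then have "ln (cmod (I z)) \<le> ln ((1 + 1 / r) * cmod z)" using p by (intro ln_mono) auto
    moreover have "cmod z \<le> (1 + r) * cmod (I z)" using diag[of r "I z"] r JI[of z] by (simp add: J_def)
    then have "ln (cmod z) \<le> ln ((1 + r) * cmod (I z))" using p by (intro ln_mono) auto
    ultimately show ?thesis
      unfolding ln_mult_pos[OF q(1) p(2)] ln_mult_pos[OF q(2) p(1)] \<rho>_def using lnr by linarith
  qed
  have "uniform_drift (e / r) (\<lambda>t. r * c t) \<delta> (M + \<rho>) v'"
    unfolding uniform_drift_def
  proof (intro conjI allI impI \<delta>)
    fix y :: real and z :: complex assume z: "z \<noteq> 0"
    show "\<bar>v' y z\<bar> \<le> M + \<rho>" using v[OF I0[OF z], of y] rho[OF z] unfolding v'_def by linarith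
    have "ln (cmod (hstep (e / r) (r * c t) z)) + v' t (hstep (e / r) (r * c t) z)
        = ln (cmod (hstep e (c t) (I z))) + v t (hstep e (c t) (I z))" for t
      using conj[of "c t" "I z"] by (simp add: JI IJ v'_def)
    then show "ln (cmod z) + v' y z + \<delta> \<le>
        branch_avg (\<lambda>t. ln (cmod (hstep (e / r) (r * c t) z)) + v' t (hstep (e / r) (r * c t) z)) y"
      using D[OF I0[OF z], of y] by (simp add: v'_def)
  qed
  then show ?thesis by blast
qed

section \<open>From the rotation number to the density of states\<close>

lemma AE_circle_const: "(AE x in circle. P) \<Longrightarrow> P"
proof (rule ccontr)
  assume "AE x in circle. P" "\<not> P"
  then have "AE x in circle. (1::real) = 0" by simp
  then have "circle_mean (\<lambda>x. 1) = circle_mean (\<lambda>x. 0)"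
    unfolding circle_mean_def by (intro integral_cong_AE) auto
  then show False by simp
qed

text \<open>The count and the lifted angle over \<open>pi\<close> differ by at most 2, which
  vanishes after division by \<open>n\<close>, as does the shift from \<open>n\<close> to
  \<open>Suc n\<close> steps. The limit is unique because the circle has positive measure.\<close>

lemma integrated_dos_eq_rotation_number:
  fixes a :: "real \<Rightarrow> real"
  assumes a: "circle_lipschitz L a" "0 < m" "\<And>x. m \<le> a x" "\<And>x. a x \<le> M" and E: "0 \<le> E"
    and l: "AE x in circle. (\<lambda>n. Im (log_cocycle E (\<lambda>y. 1 / a y) n x 1) / real n) \<longlonglongrightarrow> l"
  shows "integrated_dos a E = l / pi"
proof -
  have lim: "AE x in circle. (\<lambda>N. real (eigenvalue_count a x N E) / real N) \<longlonglongrightarrow> l / pi"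
    using l
  proof eventually_elim
    case (elim x)
    define \<theta> where "\<theta> n = Im (log_cocycle E (\<lambda>y. 1 / a y) n x 1)" for n
    have "(\<lambda>n. \<theta> (Suc n) / real (Suc n)) \<longlonglongrightarrow> l"
      using LIMSEQ_Suc[OF elim] unfolding \<theta>_def .
    moreover have "(\<lambda>n. real (Suc n) / real n) \<longlonglongrightarrow> 1" by (rule LIMSEQ_Suc_n_over_n)
    ultimately have "(\<lambda>n. \<theta> (Suc n) / real (Suc n) * (real (Suc n) / real n) / pi) \<longlonglongrightarrow> l * 1 / pi"
      by (intro tendsto_intros) auto
    then have "(\<lambda>n. \<theta> (Suc n) / real n / pi) \<longlonglongrightarrow> l / pi"
      by (simp del: of_nat_Suc)
    moreover have "(\<lambda>n. real (eigenvalue_count a x n E) / real n - \<theta> (Suc n) / real n / pi) \<longlonglongrightarrow> 0"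
    proof (rule Lim_null_comparison)
      show "\<forall>\<^sub>F n in sequentially. norm (real (eigenvalue_count a x n E) / real n - \<theta> (Suc n) / real n / pi) \<le> 2 / real n"
        using eventually_ge_at_top[of 1]
      proof eventually_elim
        case (elim n)
        have "\<bar>real (eigenvalue_count a x n (1 * E)) - \<theta> (Suc n) / pi\<bar> \<le> 2"
          unfolding \<theta>_def by (rule eigenvalue_count_rotation[OF a]) (use elim E in simp_all)
        then have "\<bar>real (eigenvalue_count a x n E) - \<theta> (Suc n) / pi\<bar> / real n \<le> 2 / real n"
          by (intro divide_right_mono) auto
        moreover have "real (eigenvalue_count a x n E) / real n - \<theta> (Suc n) / real n / pi
            = (real (eigenvalue_count a x n E) - \<theta> (Suc n) / pi) / real n"
          by (simp add: diff_divide_distrib)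
        ultimately show ?case by (simp add: abs_divide)
      qed
      show "(\<lambda>n. 2 / real n) \<longlonglongrightarrow> 0" by (rule lim_const_over_n)
    qed
    ultimately have "(\<lambda>n. (real (eigenvalue_count a x n E) / real n - \<theta> (Suc n) / real n / pi) + \<theta> (Suc n) / real n / pi) \<longlonglongrightarrow> 0 + l / pi"
      by (intro tendsto_add)
    then show ?case by simp
  qed
  show ?thesis
    unfolding integrated_dos_def
  proof (rule the_equality)
    show "AE x in circle. (\<lambda>N. real (eigenvalue_count a x N E) / real N) \<longlonglongrightarrow> l / pi" by (rule lim)
    fix c assume "AE x in circle. (\<lambda>N. real (eigenvalue_count a x N E) / real N) \<longlonglongrightarrow> c"
    with lim have "AE x in circle. c = l / pi"
      by eventually_elim (rule LIMSEQ_unique)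
    then show "c = l / pi" by (rule AE_circle_const)
  qed
qed

text \<open>Stretching preserves the product of the two shear parameters. Equating its mean
  \<open>E * \<beta>\<close> with \<open>\<eta>\<^sup>2\<close> fixes the scale at which the drift
  was computed, and smallness of \<eta> becomes smallness of \<open>E\<close>.\<close>

lemma drift_of_c_const:
  fixes a :: "real \<Rightarrow> real"
  assumes a: "circle_lipschitz L a" "0 < m" "\<And>x. m \<le> a x" "\<And>x. a x \<le> M" and pos: "0 < c_const a"
  obtains E0 where "0 < E0"
    "\<And>E. 0 < E \<Longrightarrow> E < E0 \<Longrightarrow> \<exists>\<delta> M v. uniform_drift E (\<lambda>y. 1 / a y) \<delta> M v"
proof -
  define b where "b x = inverse (a x)" for x
  have apos: "0 < a x" for x using a(2,3) by (meson less_le_trans)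
  have bl: "circle_lipschitz (L / m\<^sup>2) b" unfolding b_def by (rule circle_lipschitz_inverse[OF a(1-3)])
  define \<beta> where "\<beta> = circle_mean b"
  have M: "0 < M" using apos[of 0] a(4)[of 0] by linarith
  have "inverse M \<le> \<beta>"
  proof -
    have "circle_mean (\<lambda>x. inverse M) \<le> \<beta>"
      unfolding \<beta>_def using apos a(4)
      by (intro circle_mean_mono continuous_on_const circle_lipschitz_continuous[OF bl]) (simp add: b_def le_imp_inverse_le)
    then show ?thesis by simp
  qed
  moreover have "0 < inverse M" using M by simp
  ultimately have \<beta>: "0 < \<beta>" by linarith
  define Q where "Q x = b x / \<beta> - 1" for x
  have Ql: "circle_lipschitz (\<bar>1 / \<beta>\<bar> * (L / m\<^sup>2) + 0) Q"
    using circle_lipschitz_add[OF circle_lipschitz_cmult[OF bl, of "1 / \<beta>"] circle_lipschitz_const[of "-1"]]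
    by (simp add: Q_def[abs_def])
  have Q0: "circle_mean Q = 0"
  proof -
    have cb: "continuous_on UNIV (\<lambda>x. 1 / \<beta> * b x)"
      by (intro continuous_on_mult continuous_on_const circle_lipschitz_continuous[OF bl])
    have "Q = (\<lambda>x. 1 / \<beta> * b x - 1)" by (simp add: Q_def fun_eq_iff)
    then have "circle_mean Q = 1 / \<beta> * \<beta> - 1"
      unfolding \<beta>_def by (simp only: circle_mean_diff[OF cb[unfolded \<beta>_def] continuous_on_const] circle_mean_cmult circle_mean_const)
    then show ?thesis using \<beta> by simp
  qed
  have Q1: "-1 \<le> Q x" for x using apos[of x] \<beta> by (simp add: Q_def b_def)
  obtain G where G: "circle_lipschitz (2 * ((\<bar>1 / \<beta>\<bar> * (L / m\<^sup>2) + 0) / 2)) G" "circle_mean G = 0"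
    "\<And>y. G y - branch_avg G y = branch_avg Q y - circle_mean (branch_avg Q)"
    by (rule poisson_equation[OF circle_lipschitz_branch_avg[OF Ql]]) (rule that)
  have G3: "G y - branch_avg G y = branch_avg Q y" for y
    using G(3)[of y] Q0 by (simp add: circle_mean_branch_avg[OF circle_lipschitz_continuous[OF Ql]])
  have be: "circle_mean (\<lambda>x. inverse (a x)) = \<beta>" "inverse (a x) / \<beta> - 1 = Q x" for x
    by (simp_all add: \<beta>_def b_def[abs_def] Q_def)
  have "c_const a = circle_mean (\<lambda>x. inverse (a x)) / 8 *
      (circle_mean (\<lambda>x. (inverse (a x) / circle_mean (\<lambda>x. inverse (a x)) - 1)\<^sup>2)
       + 2 * circle_mean (\<lambda>x. (inverse (a x) / circle_mean (\<lambda>x. inverse (a x)) - 1) * G x))"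
  proof (rule c_const_eq[OF _ _ G(1,2)])
    show "circle_mean (\<lambda>x. inverse (a x)) \<noteq> 0" unfolding be using \<beta> by simp
    show "circle_lipschitz (\<bar>1 / \<beta>\<bar> * (L / m\<^sup>2) + 0) (\<lambda>x. inverse (a x) / circle_mean (\<lambda>x. inverse (a x)) - 1)"
      unfolding be by (rule Ql)
    show "G y - branch_avg G y = branch_avg (\<lambda>x. inverse (a x) / circle_mean (\<lambda>x. inverse (a x)) - 1) y" for y
      unfolding be by (rule G3)
  qed
  then have "0 < \<beta> / 8 * (circle_mean (\<lambda>x. (Q x)\<^sup>2) + 2 * circle_mean (\<lambda>x. Q x * G x))"
    using pos unfolding be by (simp only:)
  then have \<sigma>: "0 < circle_mean (\<lambda>x. (Q x)\<^sup>2) + 2 * circle_mean (\<lambda>x. Q x * G x)"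
    by (rule zero_less_mult_pos) (use \<beta> in simp)
  obtain \<eta>0 where \<eta>0: "0 < \<eta>0"
    "\<And>\<eta>. 0 < \<eta> \<Longrightarrow> \<eta> < \<eta>0 \<Longrightarrow> \<exists>\<delta> M v. uniform_drift \<eta> (\<lambda>t. \<eta> * (1 + Q t)) \<delta> M v"
    by (rule uniform_drift_small_energy[OF Ql Q0 Q1 G(1,2) G3 \<sigma>]) (rule that)
  show thesis
  proof (rule that[of "\<eta>0\<^sup>2 / \<beta>"])
    show "0 < \<eta>0\<^sup>2 / \<beta>" using \<eta>0(1) \<beta> by simp
    fix E assume E: "0 < E" "E < \<eta>0\<^sup>2 / \<beta>"
    define \<eta> where "\<eta> = sqrt (E * \<beta>)"
    have \<eta>: "0 < \<eta>" "\<eta>\<^sup>2 = E * \<beta>" using E \<beta> by (simp_all add: \<eta>_def)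
    have "\<eta>\<^sup>2 < \<eta>0\<^sup>2" using E \<beta> \<eta>(2) by (simp add: pos_less_divide_eq)
    then have "\<eta> < \<eta>0" using \<eta>0(1) by (simp add: power2_less_imp_less)
    then obtain \<delta> M' v where "uniform_drift \<eta> (\<lambda>t. \<eta> * (1 + Q t)) \<delta> M' v" using \<eta>0(2) \<eta>(1) by blast
    \<comment> \<open>The factor \<open>\<beta> / \<eta>\<close> turns
      \<open>\<eta> * (1 + Q t)\<close> into \<open>1 / a t\<close> and the energy parameter \<eta>
      into \<open>E\<close>.\<close>
    then have "\<exists>M v. uniform_drift (\<eta> / (\<beta> / \<eta>)) (\<lambda>t. \<beta> / \<eta> * (\<eta> * (1 + Q t))) \<delta> M v"
      using \<eta> \<beta> by (intro uniform_drift_rescale) auto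
    moreover have "\<eta> / (\<beta> / \<eta>) = E" using \<eta> \<beta> by (simp add: power2_eq_square)
    moreover have "\<beta> / \<eta> * (\<eta> * (1 + Q t)) = 1 / a t" for t
      using \<eta> \<beta> by (simp add: Q_def b_def inverse_eq_divide)
    ultimately show "\<exists>\<delta> M v. uniform_drift E (\<lambda>y. 1 / a y) \<delta> M v" by auto
  qed
qed

theorem theorem1p5:
  fixes a :: "real \<Rightarrow> real"
  assumes "C1_circle a"
    and "0 < (INF x. a x)"
    and "(INF x. a x) < (SUP x. a x)"
    and "bdd_above (range a)"
    and "c_const a > 0"
  shows "\<exists>E\<^sub>0>0. \<forall>E\<in>{0<..<E\<^sub>0}. \<exists>\<tau>\<in>{0<..<1}. \<exists>\<epsilon>\<^sub>0>0. \<exists>C>0. \<forall>E'\<in>{0<..<E\<^sub>0}.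
           \<bar>E - E'\<bar> < \<epsilon>\<^sub>0 \<longrightarrow>
           \<bar>lyapunov a E - lyapunov a E'\<bar> + \<bar>integrated_dos a E - integrated_dos a E'\<bar>
             \<le> C * \<bar>E - E'\<bar> powr \<tau>"
proof -
  obtain L where L: "circle_lipschitz L a" by (rule C1_circle_lipschitz[OF assms(1)]) (rule that)
  define m M where "m = (INF x. a x)" and "M = (SUP x. a x)"
  have "bdd_below (range a)"
  proof (rule bdd_belowI2)
    show "- (\<bar>circle_mean a\<bar> + L) \<le> a x" for x
      using circle_lipschitz_bounded[OF L, of x] by linarith
  qed
  then have am: "m \<le> a x" and aM: "a x \<le> M" for x
    using assms(4) by (auto simp: m_def M_def intro: cINF_lower cSUP_upper)
  have m: "0 < m" using assms(2) by (simp add: m_def)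
  have apos: "0 < a x" for x using m am by (meson less_le_trans)
  obtain E0 where E0: "0 < E0"
    and drift: "\<And>E. 0 < E \<Longrightarrow> E < E0 \<Longrightarrow> \<exists>\<delta> M v. uniform_drift E (\<lambda>y. 1 / a y) \<delta> M v"
    by (rule drift_of_c_const[OF L m am aM assms(5)]) (rule that)
  have one: "0 < (1 :: real)" by simp
  define c where "c y = 1 / a y" for y
  \<comment> \<open>A common bound for the coefficients \<open>1 / a\<close> and for all energies
    considered.\<close>
  define B where "B = max (1 / m) E0"
  have cl: "circle_lipschitz (L / m\<^sup>2) c"
    using circle_lipschitz_inverse[OF L m am] by (simp add: c_def[abs_def] inverse_eq_divide)
  have c0: "0 \<le> c y" for y using apos[of y] by (simp add: c_def)
  have cB: "c y \<le> B" for y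
    using am[of y] m apos[of y] by (auto simp: c_def B_def intro!: max.coboundedI1 divide_left_mono)
  define R I where "R E n = circle_mean (\<lambda>x. Re (log_cocycle E c n x 1))"
    and "I E n = circle_mean (\<lambda>x. Im (log_cocycle E c n x 1))" for E n
  have rot: "(\<lambda>n. I E n / real n) \<longlonglongrightarrow> pi * integrated_dos a E" if E: "0 < E" "E < E0" for E
  proof -
    have EB: "0 \<le> E" "E \<le> B" using E by (auto simp: B_def)
    obtain l where l: "AE x in circle. (\<lambda>n. Im (log_cocycle E c n x 1) / real n) \<longlonglongrightarrow> l"
      "(\<lambda>n. circle_mean (\<lambda>x. Im (log_cocycle E c n x 1)) / real n) \<longlonglongrightarrow> l"
      by (rule rotation_number_exists[OF cl c0 cB EB]) (rule that)
    have "integrated_dos a E = l / pi"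
      by (rule integrated_dos_eq_rotation_number[OF L m am aM EB(1) l(1)[unfolded c_def[abs_def]]])
    then show ?thesis using l(2) by (simp add: I_def)
  qed
  show ?thesis
  proof (intro exI[of _ E0] conjI ballI E0)
    fix E assume "E \<in> {0<..<E0}"
    then have E: "0 < E" "E < E0" and EB: "0 \<le> E" "E \<le> B" by (auto simp: B_def)
    obtain \<delta> M' v where "uniform_drift E c \<delta> M' v" using drift[OF E] unfolding c_def[abs_def] by blast
    then obtain \<alpha> K where \<alpha>: "0 < \<alpha>" "\<alpha> < 1" and K0: "0 \<le> K"
      and K1: "\<And>n z w. z \<noteq> 0 \<Longrightarrow> w \<noteq> 0 \<Longrightarrow> circle_mean (\<lambda>x. cmod (log_cocycle E c n x z - log_cocycle E c n x w)) \<le> K"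
      and KR: "\<And>n z e'. z \<noteq> 0 \<Longrightarrow> 0 \<le> e' \<Longrightarrow> e' \<le> B \<Longrightarrow> \<bar>E - e'\<bar> \<le> 1 \<Longrightarrow>
        \<bar>circle_mean (\<lambda>x. Re (log_cocycle E c n x z)) - circle_mean (\<lambda>x. Re (log_cocycle e' c n x z))\<bar>
          \<le> real n * (K * \<bar>E - e'\<bar> powr \<alpha>)"
      and KI: "\<And>n z e'. z \<noteq> 0 \<Longrightarrow> 0 \<le> e' \<Longrightarrow> e' \<le> B \<Longrightarrow> \<bar>E - e'\<bar> \<le> 1 \<Longrightarrow>
        \<bar>circle_mean (\<lambda>x. Im (log_cocycle E c n x z)) - circle_mean (\<lambda>x. Im (log_cocycle e' c n x z))\<bar>
          \<le> real n * (K * \<bar>E - e'\<bar> powr \<alpha>)"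
      by (rule circle_mean_log_cocycle_holder[OF cl c0 cB EB]) (rule that)
    \<comment> \<open>The drift at each energy ties the norm to the cocycle there. The constant
      depends on \<open>e\<close> but not on \<open>n\<close>, so it has no effect on the growth
      rate.\<close>
    have norms: "\<exists>C. (\<forall>k n. 0 < k \<longrightarrow> mean_log_norm a e (k * n) \<le> real k * mean_log_norm a e n) \<and>
        (\<forall>n. \<bar>mean_log_norm a e n - R e n\<bar> \<le> C)" if e: "0 < e" "e < E0" for e
    proof -
      have eB: "0 \<le> e" "e \<le> B" using e by (auto simp: B_def)
      obtain \<delta> M' v where d: "uniform_drift e c \<delta> M' v" using drift[OF e] unfolding c_def[abs_def] by blast
      obtain K' where K': "\<And>n z w. z \<noteq> 0 \<Longrightarrow> w \<noteq> 0 \<Longrightarrow>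
          circle_mean (\<lambda>x. cmod (log_cocycle e c n x z - log_cocycle e c n x w)) \<le> K'"
        by (rule circle_mean_log_cocycle_holder[OF cl c0 cB eB d]) (rule that)
      obtain C where "\<And>k n. 0 < k \<Longrightarrow> mean_log_norm a e (k * n) \<le> real k * mean_log_norm a e n"
        "\<And>n. \<bar>mean_log_norm a e n - circle_mean (\<lambda>x. Re (log_cocycle (e / 1) (\<lambda>y. 1 / a y) n x 1))\<bar> \<le> C"
        by (rule mean_log_norm_properties[OF L m am aM one eB(1), where K = K'])
          (use K'[of 1 \<i>] in \<open>simp add: c_def[abs_def]\<close>, rule that)
      then show ?thesis unfolding R_def c_def[abs_def] div_by_1 by blast
    qed
    have below: "\<exists>b. \<forall>n. - (b * real n + b) \<le> mean_log_norm a e n"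
      if e: "0 < e" "e < E0" and C: "\<And>n. \<bar>mean_log_norm a e n - R e n\<bar> \<le> C" for e C
    proof (intro exI[of _ "2 * B + \<bar>C\<bar>"] allI)
      fix n
      have eB: "0 \<le> e" "e \<le> B" using e by (auto simp: B_def)
      have "\<bar>R e n\<bar> \<le> 2 * B * real n"
        unfolding R_def
        by (intro abs_circle_mean_le abs_Re_log_cocycle_le[OF eB c0 cB] continuous_on_Re
            continuous_log_cocycle[OF cl c0 cB eB]) auto
      moreover have "0 \<le> B" using eB by linarith
      moreover have "0 \<le> \<bar>C\<bar> * real n" by simp
      ultimately show "- ((2 * B + \<bar>C\<bar>) * real n + (2 * B + \<bar>C\<bar>)) \<le> mean_log_norm a e n"
        using C[of n] unfolding distrib_right by linarith
    qed
    show "\<exists>\<tau>\<in>{0<..<1}. \<exists>\<epsilon>\<^sub>0>0. \<exists>C>0. \<forall>E'\<in>{0<..<E0}. \<bar>E - E'\<bar> < \<epsilon>\<^sub>0 \<longrightarrow>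
        \<bar>lyapunov a E - lyapunov a E'\<bar> + \<bar>integrated_dos a E - integrated_dos a E'\<bar> \<le> C * \<bar>E - E'\<bar> powr \<tau>"
    \<comment> \<open>One \<open>K\<close> for each of the two quantities; the added 1 keeps the
      constant positive.\<close>
    proof (rule bexI[of _ \<alpha>], rule exI[of _ 1], rule conjI[OF one], rule exI[of _ "2 * K + 1"], intro conjI ballI impI)
      show "0 < 2 * K + 1" using K0 by simp
      show "\<alpha> \<in> {0<..<1}" using \<alpha> by simp
      fix E' assume "E' \<in> {0<..<E0}" and near: "\<bar>E - E'\<bar> < 1"
      then have E': "0 < E'" "E' < E0" and EB': "0 \<le> E'" "E' \<le> B" and near': "\<bar>E - E'\<bar> \<le> 1" by (auto simp: B_def)
      define D where "D = K * \<bar>E - E'\<bar> powr \<alpha>"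
      obtain C where sub: "\<And>k n. 0 < k \<Longrightarrow> mean_log_norm a E (k * n) \<le> real k * mean_log_norm a E n"
        and C: "\<And>n. \<bar>mean_log_norm a E n - R E n\<bar> \<le> C" using norms[OF E] by blast
      obtain C' where sub': "\<And>k n. 0 < k \<Longrightarrow> mean_log_norm a E' (k * n) \<le> real k * mean_log_norm a E' n"
        and C': "\<And>n. \<bar>mean_log_norm a E' n - R E' n\<bar> \<le> C'" using norms[OF E'] by blast
      \<comment> \<open>The rate \<open>D\<close> comes from the drift at \<open>E\<close> alone;
        the drift at \<open>E'\<close> enters only through the constant \<open>C'\<close>.\<close>
      have close: "\<bar>mean_log_norm a E n - mean_log_norm a E' n\<bar> \<le> (C + C') + real n * D" for n
        using C[of n] C'[of n] KR[of 1 E' n] EB' near' unfolding R_def[symmetric] D_def by simp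
      obtain b where b: "\<And>n. - (b * real n + b) \<le> mean_log_norm a E n" using below[OF E C] by blast
      obtain b' where b': "\<And>n. - (b' * real n + b') \<le> mean_log_norm a E' n" using below[OF E' C'] by blast
      have "lyapunov a E' \<le> lyapunov a E + D"
        unfolding lyapunov_eq by (rule inf_subadditive_close[OF sub b' close])
      moreover have "lyapunov a E \<le> lyapunov a E' + D"
        unfolding lyapunov_eq
        by (rule inf_subadditive_close[OF sub' b close[unfolded abs_minus_commute[of "mean_log_norm a E _"]]])
      ultimately have lyap: "\<bar>lyapunov a E - lyapunov a E'\<bar> \<le> D" by linarith
      have "\<bar>pi * integrated_dos a E - pi * integrated_dos a E'\<bar> \<le> D"
      proof (rule LIMSEQ_le_const2)
        show "(\<lambda>n. \<bar>I E n / real n - I E' n / real n\<bar>) \<longlonglongrightarrow> \<bar>pi * integrated_dos a E - pi * integrated_dos a E'\<bar>"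
          by (intro tendsto_intros rot E E')
        show "\<exists>N. \<forall>n\<ge>N. \<bar>I E n / real n - I E' n / real n\<bar> \<le> D"
        proof (intro exI[of _ 1] allI impI)
          fix n :: nat assume n: "1 \<le> n"
          have "\<bar>I E n - I E' n\<bar> \<le> real n * D"
            using KI[of 1 E' n] EB' near' unfolding I_def[symmetric] D_def by simp
          then have "\<bar>I E n - I E' n\<bar> / real n \<le> D" using n by (simp add: pos_divide_le_eq mult.commute)
          then show "\<bar>I E n / real n - I E' n / real n\<bar> \<le> D"
            by (simp add: abs_divide flip: diff_divide_distrib)
        qed
      qed
      then have "pi * \<bar>integrated_dos a E - integrated_dos a E'\<bar> \<le> D"
        by (simp add: abs_mult flip: right_diff_distrib)
      moreover have "1 * \<bar>integrated_dos a E - integrated_dos a E'\<bar> \<le> pi * \<bar>integrated_dos a E - integrated_dos a E'\<bar>"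
        using pi_gt3 by (intro mult_right_mono) auto
      ultimately have ids: "\<bar>integrated_dos a E - integrated_dos a E'\<bar> \<le> D" unfolding mult_1 by (rule order_trans[rotated])
      have "D \<ge> 0" "2 * D \<le> (2 * K + 1) * \<bar>E - E'\<bar> powr \<alpha>"
        using K0 by (simp_all add: D_def algebra_simps)
      then show "\<bar>lyapunov a E - lyapunov a E'\<bar> + \<bar>integrated_dos a E - integrated_dos a E'\<bar>
          \<le> (2 * K + 1) * \<bar>E - E'\<bar> powr \<alpha>" using lyap ids by linarith
    qed
  qed
qed

end
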